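(* Let $\Omega\subset\mathbb R^2$ be a bounded Lipschitz domain with connected complement $\mathbb R^2\setminus\overline\Omega$, let $\mathbf 0\in\partial\Omega$, and suppose that $\Omega\cap B_h=W\cap B_h=:S_h$ for some $h>0$, where $W$ is the open sector with angles $\theta_m,\theta_M$, which is non-degenerate: $-\pi<\theta_m<\theta_M<\pi$ and $\theta_M-\theta_m\ne\pi$. Let $(\mathbf v,\mathbf w)\in H^1(\Omega)^2\times H^1(\Omega)^2$ and $\omega\in\mathbb R_+$ satisfy $$\mathcal L\mathbf v+\omega^2\mathbf v=\mathbf 0\ \text{in }\Omega,\qquad \mathcal L\mathbf w+\omega^2(1+V)\mathbf w=\mathbf 0\ \text{in }\Omega,\qquad \mathbf w=\mathbf v,\ \ T_\nu\mathbf v+\eta\mathbf v=T_\nu\mathbf w\ \text{on }\Gamma,$$ where $\Gamma\subset\partial\Omega$ is an open subset containing $\Gamma_h^+\cup\Gamma_h^-$. Let $q:=1+V$. Suppose that, for some $\alpha\in(0,1)$, $\mathbf v\in C^\alpha(\overline{S_h})^2$, $q\mathbf w\in C^\alpha(\overline{S_h})^2$, and $\eta\in C^\alpha(\overline{\Gamma_h^\pm})$ with $\eta(\mathbf 0)\neq0$. Then $$\mathbf v(\mathbf 0)=\mathbf 0.$$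
   Context: Real constants $\lambda,\mu$ satisfy $\mu>0$ and $2\lambda+2\mu>0$. The Lamé operator is $\mathcal L\mathbf u=\mu\Delta\mathbf u+(\lambda+\mu)\nabla(\nabla\cdot\mathbf u)$. $V\in L^\infty(\Omega)$ is real-valued and nontrivial; $\eta\in L^\infty(\partial\Omega)$ is real-valued. Functions $\mathbf v,\mathbf w$ are $\mathbb C^2$-valued; the equations hold in the distributional sense and boundary values in the trace sense. With $\nu$ the outward unit normal and $\nu^\perp$ its anticlockwise rotation by $\pi/2$, the boundary traction is $T_\nu\mathbf v=2\mu\,\partial_\nu\mathbf v+\lambda\nu(\nabla\cdot\mathbf v)+\mu(\partial_2v_1-\partial_1v_2)\nu^\perp$. Sector: $W=\{\mathbf x\in\mathbb R^2:\mathbf x\ne\mathbf 0,\ \theta_m<\arg(x_1+\mathrm ix_2)<\theta_M\}$; its sides are $\Gamma^-=\{\mathbf x\ne\mathbf 0:\arg(x_1+\mathrm ix_2)=\theta_m\}$ and $\Gamma^+=\{\mathbf x\ne\mathbf 0:\arg(x_1+\mathrm ix_2)=\theta_M\}$. $B_h$ is the open disk of radius $h$ centred at $\mathbf 0$; $S_h=W\cap B_h$; $\Gamma_h^\pm=\Gamma^\pm\cap B_h$. *)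

theory Defs
  imports "HOL-Analysis.Analysis"
begin

definition pderiv_at :: "2 \<Rightarrow> (real^2 \<Rightarrow> complex) \<Rightarrow> real^2 \<Rightarrow> complex" where
  "pderiv_at i f x = frechet_derivative f (at x) (axis i 1)"

primrec C_k :: "nat \<Rightarrow> (real^2 \<Rightarrow> complex) \<Rightarrow> bool" where
  "C_k 0 f = continuous_on UNIV f"
| "C_k (Suc k) f = ((\<forall>x. f differentiable (at x)) \<and> (\<forall>i. C_k k (pderiv_at i f)))"

definition supp :: "(real^2 \<Rightarrow> complex) \<Rightarrow> (real^2) set" where
  "supp f = closure {x. f x \<noteq> 0}"

definition test_fun :: "(real^2) set \<Rightarrow> (real^2 \<Rightarrow> complex) \<Rightarrow> bool" where
  "test_fun U \<phi> \<longleftrightarrow> (\<forall>k. C_k k \<phi>) \<and> compact (supp \<phi>) \<and> supp \<phi> \<subseteq> U"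

definition laplacian :: "(real^2 \<Rightarrow> complex) \<Rightarrow> real^2 \<Rightarrow> complex" where
  "laplacian \<phi> x = (\<Sum>i\<in>UNIV. pderiv_at i (pderiv_at i \<phi>) x)"

definition L2 :: "'a measure \<Rightarrow> ('a \<Rightarrow> complex) \<Rightarrow> bool" where
  "L2 M f \<longleftrightarrow> f \<in> borel_measurable M \<and> integrable M (\<lambda>x. (norm (f x))\<^sup>2)"

definition L2_tendsto :: "'a measure \<Rightarrow> (nat \<Rightarrow> 'a \<Rightarrow> complex) \<Rightarrow> ('a \<Rightarrow> complex) \<Rightarrow> bool" where
  "L2_tendsto M F f \<longleftrightarrow> (\<lambda>n. \<integral>\<^sup>+x. ennreal ((norm (F n x - f x))\<^sup>2) \<partial>M) \<longlonglongrightarrow> 0"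

definition Linf :: "'a measure \<Rightarrow> ('a \<Rightarrow> real) \<Rightarrow> bool" where
  "Linf M f \<longleftrightarrow> f \<in> borel_measurable M \<and> (\<exists>C. AE x in M. \<bar>f x\<bar> \<le> C)"

definition is_weak_pderiv ::
  "(real^2) set \<Rightarrow> 2 \<Rightarrow> (real^2 \<Rightarrow> complex) \<Rightarrow> (real^2 \<Rightarrow> complex) \<Rightarrow> bool" where
  "is_weak_pderiv \<Omega> i f g \<longleftrightarrow> L2 (lebesgue_on \<Omega>) g \<and>
     (\<forall>\<phi>. test_fun \<Omega> \<phi> \<longrightarrow>
        (LINT x|lebesgue_on \<Omega>. f x * pderiv_at i \<phi> x) = - (LINT x|lebesgue_on \<Omega>. g x * \<phi> x))"

definition H1 :: "(real^2) set \<Rightarrow> (real^2 \<Rightarrow> complex) \<Rightarrow> bool" where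
  "H1 \<Omega> f \<longleftrightarrow> L2 (lebesgue_on \<Omega>) f \<and> (\<forall>i. \<exists>g. is_weak_pderiv \<Omega> i f g)"

text \<open>Only meaningful for \<open>f\<close> in \<open>H1 \<Omega>\<close>; it is then unique up to null sets.\<close>
definition weak_pderiv :: "(real^2) set \<Rightarrow> 2 \<Rightarrow> (real^2 \<Rightarrow> complex) \<Rightarrow> real^2 \<Rightarrow> complex" where
  "weak_pderiv \<Omega> i f = (SOME g. is_weak_pderiv \<Omega> i f g)"

definition H1_vec :: "(real^2) set \<Rightarrow> (real^2 \<Rightarrow> complex^2) \<Rightarrow> bool" where
  "H1_vec \<Omega> v \<longleftrightarrow> (\<forall>j. H1 \<Omega> (\<lambda>x. v x $ j))"

text \<open>Row \<open>j\<close>, column \<open>i\<close> holds \<open>\<partial>\<^sub>i v\<^sub>j\<close>.\<close>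
definition weak_grad :: "(real^2) set \<Rightarrow> (real^2 \<Rightarrow> complex^2) \<Rightarrow> real^2 \<Rightarrow> complex^2^2" where
  "weak_grad \<Omega> v x = (\<chi> j i. weak_pderiv \<Omega> i (\<lambda>y. v y $ j) x)"

text \<open>A bounded domain which near every boundary point is, after an orthogonal change of
  coordinates, the strict epigraph of a Lipschitz function.\<close>
definition bounded_lipschitz_domain :: "(real^2) set \<Rightarrow> bool" where
  "bounded_lipschitz_domain \<Omega> \<longleftrightarrow>
     open \<Omega> \<and> connected \<Omega> \<and> \<Omega> \<noteq> {} \<and> bounded \<Omega> \<and>
     (\<forall>p\<in>frontier \<Omega>. \<exists>r>0. \<exists>R :: real^2 \<Rightarrow> real^2. \<exists>g :: real \<Rightarrow> real. \<exists>L.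
        orthogonal_transformation R \<and> L-lipschitz_on UNIV g \<and>
        \<Omega> \<inter> ball p r = {x \<in> ball p r. R x $ 2 > g (R x $ 1)})"

text \<open>One-dimensional Hausdorff measure, with the normalisation that the unit segment has
  measure one. Since \<open>diameter\<close> is only meaningful on bounded sets, the covering sets are
  required to be bounded.\<close>
definition hausdorff1_pre :: "real \<Rightarrow> (real^2) set \<Rightarrow> ennreal" where
  "hausdorff1_pre \<delta> A =
     Inf {(\<Sum>n. ennreal (diameter (C n))) | C :: nat \<Rightarrow> (real^2) set.
            A \<subseteq> (\<Union>n. C n) \<and> (\<forall>n. bounded (C n) \<and> diameter (C n) \<le> \<delta>)}"

definition hausdorff1 :: "(real^2) measure" where
  "hausdorff1 = measure_of UNIV (sets borel) (\<lambda>A. SUP \<delta>\<in>{0<..}. hausdorff1_pre \<delta> A)"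

definition boundary_measure :: "(real^2) set \<Rightarrow> (real^2) measure" where
  "boundary_measure \<Omega> = completion (restrict_space hausdorff1 (frontier \<Omega>))"

text \<open>The trace operator is the continuous extension of the restriction map from smooth
  functions up to the boundary: \<open>g\<close> is the trace of \<open>f \<in> H1 \<Omega>\<close> if some smooth functions
  on the plane converge to \<open>f\<close> in \<open>H1 \<Omega>\<close> and to \<open>g\<close> in \<open>L2\<close> of the boundary. On a bounded
  Lipschitz domain the trace exists and is unique up to null sets.\<close>
definition has_trace :: "(real^2) set \<Rightarrow> (real^2 \<Rightarrow> complex) \<Rightarrow> (real^2 \<Rightarrow> complex) \<Rightarrow> bool" where
  "has_trace \<Omega> f g \<longleftrightarrow> H1 \<Omega> f \<and> L2 (boundary_measure \<Omega>) g \<and>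
     (\<exists>F. (\<forall>n. test_fun UNIV (F n)) \<and>
        L2_tendsto (lebesgue_on \<Omega>) F f \<and>
        (\<forall>i. L2_tendsto (lebesgue_on \<Omega>) (\<lambda>n. pderiv_at i (F n)) (weak_pderiv \<Omega> i f)) \<and>
        L2_tendsto (boundary_measure \<Omega>) F g)"

definition has_trace_vec ::
  "(real^2) set \<Rightarrow> (real^2 \<Rightarrow> complex^2) \<Rightarrow> (real^2 \<Rightarrow> complex^2) \<Rightarrow> bool" where
  "has_trace_vec \<Omega> v g \<longleftrightarrow> (\<forall>j. has_trace \<Omega> (\<lambda>x. v x $ j) (\<lambda>x. g x $ j))"

definition trace_eq_on ::
  "(real^2) set \<Rightarrow> (real^2) set \<Rightarrow> (real^2 \<Rightarrow> complex^2) \<Rightarrow> (real^2 \<Rightarrow> complex^2) \<Rightarrow> bool" where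
  "trace_eq_on \<Omega> \<Gamma> w v \<longleftrightarrow>
     (\<exists>tw tv. has_trace_vec \<Omega> w tw \<and> has_trace_vec \<Omega> v tv \<and>
        (AE x in boundary_measure \<Omega>. x \<in> \<Gamma> \<longrightarrow> tw x = tv x))"

text \<open>\<open>\<mu> \<Delta>v + (\<lambda> + \<mu>) \<nabla>(\<nabla>\<cdot>v) = F\<close> in the sense of distributions, with \<open>F\<close> square integrable.
  The formal adjoint carries both derivatives over to the test function without sign change.\<close>
definition weak_lame_eq ::
  "real \<Rightarrow> real \<Rightarrow> (real^2) set \<Rightarrow> (real^2 \<Rightarrow> complex^2) \<Rightarrow> (real^2 \<Rightarrow> complex^2) \<Rightarrow> bool" where
  "weak_lame_eq lam mu \<Omega> v F \<longleftrightarrow>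
     (\<forall>j. L2 (lebesgue_on \<Omega>) (\<lambda>x. F x $ j)) \<and>
     (\<forall>\<phi> j. test_fun \<Omega> \<phi> \<longrightarrow>
        (LINT x|lebesgue_on \<Omega>. of_real mu * (v x $ j) * laplacian \<phi> x +
            of_real (lam + mu) * (\<Sum>k\<in>UNIV. v x $ k * pderiv_at k (pderiv_at j \<phi>) x))
        = (LINT x|lebesgue_on \<Omega>. F x $ j * \<phi> x))"

definition perp :: "real^2 \<Rightarrow> real^2" where
  "perp n = vector [- (n $ 2), n $ 1]"

text \<open>The pointwise traction
  \<open>2\<mu> \<partial>\<^sub>\<nu>v + \<lambda> \<nu> (\<nabla>\<cdot>v) + \<mu> (\<partial>\<^sub>2 v\<^sub>1 - \<partial>\<^sub>1 v\<^sub>2) \<nu>\<^sup>\<perp>\<close> as a function of the gradient \<open>G = (\<partial>\<^sub>i v\<^sub>j)\<^sub>j\<^sub>i\<close>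
  and the normal \<open>n\<close>. It is linear in \<open>n\<close>.\<close>
definition traction :: "real \<Rightarrow> real \<Rightarrow> complex^2^2 \<Rightarrow> real^2 \<Rightarrow> complex^2" where
  "traction lam mu G n =
     (\<chi> j. of_real (2 * mu) * (\<Sum>i\<in>UNIV. of_real (n $ i) * G $ j $ i)
          + of_real (lam * n $ j) * (\<Sum>i\<in>UNIV. G $ i $ i)
          + of_real (mu * perp n $ j) * (G $ 1 $ 2 - G $ 2 $ 1))"

text \<open>For \<open>v\<close> in \<open>H1\<close> the traction has no pointwise meaning on the boundary: it is the functional
  \<open>\<phi> \<mapsto> \<langle>(T\<^sub>\<nu> v)\<^sub>j, \<phi>\<rangle>\<close> given by the divergence theorem, that is, the normal trace of the square
  integrable matrix field with columns \<open>traction (\<nabla>v) e\<^sub>k\<close>, whose row-wise divergence is the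
  image \<open>Lv\<close> of \<open>v\<close> under the Lame operator (supplied as an argument and subject to
  \<open>weak_lame_eq lam mu \<Omega> v Lv\<close>). If \<open>v\<close> is smooth up to the boundary, this is the boundary
  integral of \<open>traction (\<nabla>v) \<nu> $ j * \<phi>\<close> with \<open>\<nu>\<close> the outward unit normal.\<close>
definition traction_functional ::
  "real \<Rightarrow> real \<Rightarrow> (real^2) set \<Rightarrow> (real^2 \<Rightarrow> complex^2) \<Rightarrow> (real^2 \<Rightarrow> complex^2) \<Rightarrow>
   2 \<Rightarrow> (real^2 \<Rightarrow> complex) \<Rightarrow> complex" where
  "traction_functional lam mu \<Omega> v Lv j \<phi> =
     (LINT x|lebesgue_on \<Omega>.
        (\<Sum>k\<in>UNIV. traction lam mu (weak_grad \<Omega> v x) (axis k 1) $ j * pderiv_at k \<phi> x)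
        + Lv x $ j * \<phi> x)"

text \<open>\<open>T\<^sub>\<nu> v + \<eta> v = T\<^sub>\<nu> w\<close> on the relatively open part \<open>\<Gamma>\<close> of the boundary, tested against
  functions whose support meets the boundary only inside \<open>\<Gamma>\<close>.\<close>
definition traction_condition ::
  "real \<Rightarrow> real \<Rightarrow> (real^2) set \<Rightarrow> (real^2) set \<Rightarrow> (real^2 \<Rightarrow> real) \<Rightarrow>
   (real^2 \<Rightarrow> complex^2) \<Rightarrow> (real^2 \<Rightarrow> complex^2) \<Rightarrow>
   (real^2 \<Rightarrow> complex^2) \<Rightarrow> (real^2 \<Rightarrow> complex^2) \<Rightarrow> bool" where
  "traction_condition lam mu \<Omega> \<Gamma> \<eta> v Lv w Lw \<longleftrightarrow>
     weak_lame_eq lam mu \<Omega> v Lv \<and> weak_lame_eq lam mu \<Omega> w Lw \<and>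
     (\<exists>tv. has_trace_vec \<Omega> v tv \<and>
        (\<forall>\<phi> j. test_fun UNIV \<phi> \<and> supp \<phi> \<inter> frontier \<Omega> \<subseteq> \<Gamma> \<longrightarrow>
           traction_functional lam mu \<Omega> v Lv j \<phi>
             + (LINT x|boundary_measure \<Omega>. of_real (\<eta> x) * (tv x $ j) * \<phi> x)
           = traction_functional lam mu \<Omega> w Lw j \<phi>))"

definition arg2 :: "real^2 \<Rightarrow> real" where
  "arg2 x = Arg (Complex (x $ 1) (x $ 2))"

definition sector :: "real \<Rightarrow> real \<Rightarrow> (real^2) set" where
  "sector tm tM = {x. x \<noteq> 0 \<and> tm < arg2 x \<and> arg2 x < tM}"

definition ray :: "real \<Rightarrow> (real^2) set" where
  "ray t = {x. x \<noteq> 0 \<and> arg2 x = t}"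

definition holder_on ::
  "real \<Rightarrow> 'a::metric_space set \<Rightarrow> ('a \<Rightarrow> 'b::metric_space) \<Rightarrow> bool" where
  "holder_on \<alpha> S f \<longleftrightarrow> (\<exists>C. \<forall>x\<in>S. \<forall>y\<in>S. dist (f x) (f y) \<le> C * dist x y powr \<alpha>)"

text \<open>\<open>f \<in> C\<^sup>\<alpha>(closure S)\<close> for an almost-everywhere class \<open>f\<close>, with Hoelder representative \<open>g\<close>.\<close>
definition holder_rep ::
  "real \<Rightarrow> (real^2) set \<Rightarrow> (real^2 \<Rightarrow> complex^2) \<Rightarrow> (real^2 \<Rightarrow> complex^2) \<Rightarrow> bool" where
  "holder_rep \<alpha> S f g \<longleftrightarrow> holder_on \<alpha> (closure S) g \<and> (AE x in lebesgue_on S. f x = g x)"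

end

theory Submission
  imports Defs "HOL-Real_Asymp.Real_Asymp"
begin

text \<open>
  Put \<open>u = v - w\<close>, which has vanishing trace on the two sides and satisfies \<open>T\<^sub>\<nu> u = - \<eta> v\<close> there.
  Let \<open>\<iota>\<^sup>2 = -1\<close> and let \<open>F\<close> be holomorphic in \<open>z = x\<^sub>1 + \<iota> x\<^sub>2\<close>. The vector field \<open>(F, \<iota> F)\<close> is annihilated
  by the Lame operator, and the stress of \<open>u\<close> tested against it is
  \<open>2 \<mu> F' (\<partial>\<^sub>1 + \<iota> \<partial>\<^sub>2) (u\<^sub>1 + \<iota> u\<^sub>2)\<close>, which integrates by parts to zero up to the effect of a fixed
  cutoff \<open>X\<close> near the corner. We take \<open>F = (z + \<delta>)\<^sup>-\<^sup>4\<close> with \<open>\<delta> \<rightarrow> 0\<close>; its pole lies outside the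
  closed sector because \<open>-\<pi> < \<theta>\<^sub>m < \<theta>\<^sub>M < \<pi>\<close>. The cutoff terms stay bounded, the volume term
  is \<open>O(\<delta>\<^sup>-\<^sup>2)\<close>, and the boundary term is
  \<open>\<delta>\<^sup>-\<^sup>3 \<eta>(0) (v\<^sub>1 + \<iota> v\<^sub>2)(0) (1 / (3 a) + 1 / (3 b)) + o(\<delta>\<^sup>-\<^sup>3)\<close> with \<open>a\<close>, \<open>b\<close> the directions of the sides,
  where \<open>a + b \<noteq> 0\<close> as the angle is not \<open>\<pi>\<close>. Hence \<open>(v\<^sub>1 + \<iota> v\<^sub>2)(0) = 0\<close> for both square roots of \<open>-1\<close>.
\<close>

section \<open>Smooth functions on the plane\<close>

text \<open>The field \<open>(F, \<iota> F)\<close> is divergence free because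
  \<open>\<iota>\<close> squares to \<open>-1\<close>, and this is what removes \<open>lam\<close>:
  with \<open>T\<close> the stress of \<open>u\<close>, the pairing is \<open>F'\<close> times
  \<open>T11 - T22 + 2 \<iota> T12\<close>, where the divergence part cancels. As \<open>F'\<close>
  is again holomorphic, the next integration by parts leaves nothing where the cutoff is constant.
  For a kernel \<open>(z + \<delta>)^-p\<close> with \<open>p > 2\<close> the boundary term has
  order \<open>\<delta>^(1 - p)\<close> and the volume term \<open>\<delta>^(2 - p)\<close>, so the
  boundary wins; \<open>p = 4\<close> lets the volume integral be bounded by a product of two
  one-dimensional integrals. The work lies in low regularity. As \<open>u\<close> is only in
  \<open>H1\<close>, integration by parts runs through smooth approximants, and traces are
  \<open>L2\<close> limits of these; since the traces of \<open>v\<close> and \<open>w\<close> agree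
  on the sides, an estimate of the boundary terms is enough. The trace of \<open>v\<close> in the
  traction condition has to be matched with the Hoelder representative before a value at the corner
  makes sense. Test functions are smooth on the whole plane, so the pole of \<open>F\<close> must be
  filled in. Finally, the boundary carries Hausdorff measure, which must be recognised as length on
  the sides.\<close>

lemma pderiv_at_eqI: "(f has_derivative f') (at x) \<Longrightarrow> pderiv_at i f x = f' (axis i 1)"
  unfolding pderiv_at_def by (metis frechet_derivative_at)

lemma has_derivative_pderiv_at:
  assumes "f differentiable (at x)"
  shows "(f has_derivative (\<lambda>y. \<Sum>i\<in>UNIV. y $ i *\<^sub>R pderiv_at i f x)) (at x)"
proof -
  have d: "(f has_derivative frechet_derivative f (at x)) (at x)"
    using assms by (simp add: frechet_derivative_works)
  then interpret bounded_linear "frechet_derivative f (at x)" by (rule has_derivative_bounded_linear)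
  have "frechet_derivative f (at x) = (\<lambda>y. \<Sum>i\<in>UNIV. y $ i *\<^sub>R pderiv_at i f x)"
  proof
    fix y :: "real^2"
    have "y = (\<Sum>i\<in>UNIV. y $ i *\<^sub>R axis i 1)"
      by (metis (no_types, lifting) basis_expansion scalar_mult_eq_scaleR sum.cong)
    then have "frechet_derivative f (at x) y = frechet_derivative f (at x) (\<Sum>i\<in>UNIV. y $ i *\<^sub>R axis i 1)"
      by simp
    then show "frechet_derivative f (at x) y = (\<Sum>i\<in>UNIV. y $ i *\<^sub>R pderiv_at i f x)"
      by (simp add: sum scaleR pderiv_at_def)
  qed
  with d show ?thesis by simp
qed

lemma pderiv_at_mult:
  assumes "f differentiable (at x)" "g differentiable (at x)"
  shows "pderiv_at i (\<lambda>x. f x * g x) x = pderiv_at i f x * g x + f x * pderiv_at i g x"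
proof -
  obtain f' g' where d: "(f has_derivative f') (at x)" "(g has_derivative g') (at x)"
    using assms by (auto simp: differentiable_def)
  show ?thesis
    using pderiv_at_eqI[OF has_derivative_mult[OF d]] pderiv_at_eqI[OF d(1)] pderiv_at_eqI[OF d(2)]
    by (simp add: algebra_simps)
qed

lemma pderiv_at_add:
  assumes "f differentiable (at x)" "g differentiable (at x)"
  shows "pderiv_at i (\<lambda>x. f x + g x) x = pderiv_at i f x + pderiv_at i g x"
proof -
  obtain f' g' where d: "(f has_derivative f') (at x)" "(g has_derivative g') (at x)"
    using assms by (auto simp: differentiable_def)
  show ?thesis
    using pderiv_at_eqI[OF has_derivative_add[OF d]] pderiv_at_eqI[OF d(1)] pderiv_at_eqI[OF d(2)]
    by simp
qed

lemma pderiv_at_diff: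
  assumes "f differentiable (at x)" "g differentiable (at x)"
  shows "pderiv_at i (\<lambda>x. f x - g x) x = pderiv_at i f x - pderiv_at i g x"
proof -
  obtain f' g' where d: "(f has_derivative f') (at x)" "(g has_derivative g') (at x)"
    using assms by (auto simp: differentiable_def)
  show ?thesis
    using pderiv_at_eqI[OF has_derivative_diff[OF d]] pderiv_at_eqI[OF d(1)] pderiv_at_eqI[OF d(2)]
    by simp
qed

lemma pderiv_at_const [simp]: "pderiv_at i (\<lambda>x. c) = (\<lambda>x. 0)"
  by (rule ext) (rule pderiv_at_eqI[OF has_derivative_const])

lemma has_derivative_coord:
  "((\<lambda>x::real^2. complex_of_real (x $ j)) has_derivative (\<lambda>y. complex_of_real (y $ j))) (at x)"
  by (intro bounded_linear_imp_has_derivative bounded_linear_compose[OF bounded_linear_of_real]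
      bounded_linear_vec_nth)

lemma pderiv_at_coord: "pderiv_at i (\<lambda>x. complex_of_real (x $ j)) = (\<lambda>x. if i = j then 1 else 0)"
  by (rule ext) (simp add: pderiv_at_eqI[OF has_derivative_coord] axis_def)

lemma pderiv_at_inverse:
  assumes "f differentiable (at x)" "f x \<noteq> 0"
  shows "pderiv_at i (\<lambda>x. inverse (f x)) x = - (pderiv_at i f x * (inverse (f x) * inverse (f x)))"
proof -
  obtain f' where d: "(f has_derivative f') (at x)"
    using assms by (auto simp: differentiable_def)
  show ?thesis
    using pderiv_at_eqI[OF Deriv.has_derivative_inverse[OF assms(2) d]] pderiv_at_eqI[OF d]
    by simp
qed

lemma pderiv_at_scale:
  assumes "f differentiable (at (c *\<^sub>R x))"
  shows "pderiv_at i (\<lambda>x. f (c *\<^sub>R x)) x = of_real c * pderiv_at i f (c *\<^sub>R x)"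
proof -
  obtain f' where d: "(f has_derivative f') (at (c *\<^sub>R x))"
    using assms by (auto simp: differentiable_def)
  have e: "((\<lambda>x. c *\<^sub>R x) has_derivative (\<lambda>y. c *\<^sub>R y)) (at x)"
    by (auto intro!: derivative_eq_intros)
  have "linear f'" using d has_derivative_linear by blast
  then show ?thesis
    using pderiv_at_eqI[OF has_derivative_compose[OF e d]] pderiv_at_eqI[OF d]
    by (simp add: linear_scale scaleR_conv_of_real[of c "f' _"])
qed

section \<open>Stability of smoothness under algebraic operations and scaling\<close>

lemma differentiable_pointwiseE:
  assumes "C_k (Suc k) f" shows "f differentiable (at x)"
  using assms by simp

lemma C_k_continuous: "C_k k f \<Longrightarrow> continuous_on UNIV f"
  by (cases k)
    (auto intro!: differentiable_imp_continuous_on simp: differentiable_on_def differentiable_at_withinI)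

lemma C_k_mono: "C_k (Suc k) f \<Longrightarrow> C_k k f"
proof (induction k arbitrary: f)
  case 0
  then show ?case using C_k_continuous[OF 0] by simp
next
  case (Suc k)
  then show ?case by (metis C_k.simps(2))
qed

lemma C_k_const [simp]: "C_k k (\<lambda>x. c)"
  by (induction k arbitrary: c) (auto simp: pderiv_at_const)

lemma C_k_add: "C_k k f \<Longrightarrow> C_k k g \<Longrightarrow> C_k k (\<lambda>x. f x + g x)"
proof (induction k arbitrary: f g)
  case 0
  then show ?case by (simp add: continuous_on_add)
next
  case (Suc k)
  then have "pderiv_at i (\<lambda>x. f x + g x) = (\<lambda>x. pderiv_at i f x + pderiv_at i g x)" for i
    by (auto simp: pderiv_at_add)
  with Suc show ?case by (auto intro!: differentiable_add)
qed

lemma C_k_mult: "C_k k f \<Longrightarrow> C_k k g \<Longrightarrow> C_k k (\<lambda>x. f x * g x)"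
proof (induction k arbitrary: f g)
  case 0
  then show ?case by (simp add: continuous_on_mult)
next
  case (Suc k)
  then have e: "pderiv_at i (\<lambda>x. f x * g x) = (\<lambda>x. pderiv_at i f x * g x + f x * pderiv_at i g x)" for i
    by (auto simp: pderiv_at_mult)
  have "C_k k f" "C_k k g" using Suc.prems C_k_mono by blast+
  then show ?case using Suc unfolding C_k.simps e
    by (auto intro!: differentiable_mult C_k_add Suc.IH)
qed

lemma C_k_uminus: "C_k k f \<Longrightarrow> C_k k (\<lambda>x. - f x)"
  using C_k_mult[OF C_k_const[of k "-1"]] by fastforce

lemma C_k_diff: "C_k k f \<Longrightarrow> C_k k g \<Longrightarrow> C_k k (\<lambda>x. f x - g x)"
  using C_k_add[OF _ C_k_uminus] by fastforce

lemma C_k_power: "C_k k f \<Longrightarrow> C_k k (\<lambda>x. f x ^ n)"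
  by (induction n) (auto intro: C_k_mult)

lemma C_k_coord: "C_k k (\<lambda>x. complex_of_real (x $ j))"
proof (cases k)
  case 0
  then show ?thesis by (auto intro!: continuous_intros)
next
  case (Suc k')
  have "(\<lambda>x::real^2. complex_of_real (x $ j)) differentiable (at x)" for x
    using has_derivative_coord differentiable_def by blast
  then show ?thesis by (simp add: Suc pderiv_at_coord)
qed

lemma C_k_inverse: "C_k k f \<Longrightarrow> (\<And>x. f x \<noteq> 0) \<Longrightarrow> C_k k (\<lambda>x. inverse (f x))"
proof (induction k arbitrary: f)
  case 0
  then show ?case by (auto intro!: continuous_on_inverse)
next
  case (Suc k)
  then have e: "pderiv_at i (\<lambda>x. inverse (f x)) = (\<lambda>x. - (pderiv_at i f x * (inverse (f x) * inverse (f x))))" for i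
    by (auto simp: pderiv_at_inverse)
  have "C_k k (\<lambda>x. inverse (f x))" using Suc C_k_mono by blast
  then show ?case using Suc unfolding C_k.simps e
    by (auto intro!: differentiable_inverse C_k_uminus C_k_mult)
qed

lemma C_k_scale: "C_k k f \<Longrightarrow> C_k k (\<lambda>x. f (c *\<^sub>R x))"
proof (induction k arbitrary: f)
  case 0
  then have "continuous_on UNIV f" by simp
  then have "continuous_on UNIV (\<lambda>x. f (c *\<^sub>R x))"
    by (rule continuous_on_compose2) (auto intro!: continuous_intros)
  then show ?case by simp
next
  case (Suc k)
  then have e: "pderiv_at i (\<lambda>x. f (c *\<^sub>R x)) = (\<lambda>x. of_real c * pderiv_at i f (c *\<^sub>R x))" for i
    by (auto simp: pderiv_at_scale)
  have "(\<lambda>x. f (c *\<^sub>R x)) differentiable (at x)" for x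
  proof -
    have "(\<lambda>x::real^2. c *\<^sub>R x) differentiable (at x)" by (auto intro!: derivative_intros)
    moreover have "f differentiable (at (c *\<^sub>R x))" using Suc.prems by simp
    ultimately show ?thesis using differentiable_chain_at[of "\<lambda>x. c *\<^sub>R x" x f] by (simp add: o_def)
  qed
  then show ?case using Suc unfolding C_k.simps e
    by (auto intro!: C_k_mult)
qed

section \<open>Cutoffs and a smooth substitute for the reciprocal\<close>

text \<open>The family \<open>t\<^sup>-\<^sup>m exp (-1/t)\<close> is closed under differentiation, so that no polynomials are needed.\<close>
definition flat :: "nat \<Rightarrow> real \<Rightarrow> real" where
  "flat m t = (if t > 0 then inverse t ^ m * exp (- inverse t) else 0)"

text \<open>With \<open>s = inverse t\<close> the limit from the right is the decay of
  \<open>s ^ m / exp s\<close> at infinity; to the left of 0 the function vanishes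
  identically.\<close>

lemma flat_0: "flat m \<midarrow>0\<rightarrow> 0"
proof -
  have "((\<lambda>t::real. inverse t ^ m / exp (inverse t)) \<longlongrightarrow> 0) (at_right 0)"
    using filterlim_compose[OF tendsto_power_div_exp_0 filterlim_inverse_at_top_right, of m] .
  then have "(flat m \<longlongrightarrow> 0) (at_right 0)"
    by (rule Lim_transform_eventually)
      (auto simp: eventually_at_filter flat_def exp_minus divide_inverse)
  moreover have "(flat m \<longlongrightarrow> 0) (at_left 0)"
    by (rule Lim_transform_eventually[OF tendsto_const])
      (auto simp: eventually_at_filter flat_def)
  ultimately show ?thesis by (simp add: filterlim_split_at)
qed

lemma flat_deriv: "(flat m has_real_derivative flat (m + 2) t - of_nat m * flat (m + 1) t) (at t)"
proof (cases t "0::real" rule: linorder_cases)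
  case less
  then have ev: "\<forall>\<^sub>F s in nhds t. 0 = flat m s"
    by (intro eventually_nhds_in_open[of "{..<0}", THEN eventually_mono]) (auto simp: flat_def)
  have "((\<lambda>_. 0) has_real_derivative flat (m + 2) t - of_nat m * flat (m + 1) t) (at t)"
    using less by (simp add: flat_def)
  then show ?thesis using DERIV_cong_ev[OF refl ev refl] by blast
next
  case equal
  \<comment> \<open>The difference quotient of \<open>flat m\<close> at 0 is
    \<open>flat (m + 1)\<close>, so the limit at the next index is the derivative.\<close>
  have "(\<lambda>s. flat (m + 1) s) \<midarrow>0\<rightarrow> 0" by (rule flat_0)
  then have "((\<lambda>s. (flat m s - flat m 0) / (s - 0)) \<longlongrightarrow> 0) (at 0)"
    by (rule Lim_transform_eventually) (auto simp: eventually_at_filter flat_def divide_inverse)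
  then show ?thesis by (simp add: equal has_field_derivative_iff flat_def[of _ 0])
next
  case greater
  then have ev: "\<forall>\<^sub>F s in nhds t. inverse s ^ m * exp (- inverse s) = flat m s"
    by (intro eventually_nhds_in_open[of "{0<..}", THEN eventually_mono]) (auto simp: flat_def)
  have "((\<lambda>s. inverse s ^ m * exp (- inverse s)) has_real_derivative
      flat (m + 2) t - of_nat m * flat (m + 1) t) (at t)"
  proof -
    have t: "t \<noteq> 0" using greater by simp
    have e: "((\<lambda>s. exp (- inverse s)) has_real_derivative exp (- inverse t) * (inverse t)\<^sup>2) (at t)"
      using t by (auto intro!: derivative_eq_intros simp: power2_eq_square)
    \<comment> \<open>The power rule brings in the exponent \<open>m - 1\<close>, truncated at
      \<open>m = 0\<close>; hence the case split.\<close>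
    show ?thesis
      by (rule DERIV_cong[OF DERIV_mult[OF DERIV_power[OF DERIV_inverse[OF t]] e]], cases m)
        (use greater in \<open>simp_all add: flat_def algebra_simps power2_eq_square\<close>)
  qed
  then show ?thesis using DERIV_cong_ev[OF refl ev refl] by blast
qed

text \<open>Each derivative raises the index of \<open>flat\<close>, so the induction runs over all
  \<open>m\<close> at once. The inner function is real, but smoothness is only defined for complex
  values; hence the embeddings.\<close>

lemma C_k_flat: "C_k k (\<lambda>x. of_real (r x)) \<Longrightarrow> C_k k (\<lambda>x. of_real (flat m (r x)))"
proof (induction k arbitrary: m)
  case 0
  then have "continuous_on UNIV (\<lambda>x. Re (complex_of_real (r x)))"
    by (intro continuous_on_Re) simp
  moreover have "continuous_on UNIV (flat m)"
    using flat_deriv DERIV_isCont by (metis continuous_at_imp_continuous_on)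
  ultimately have "continuous_on UNIV (\<lambda>x. flat m (r x))"
    by (auto intro: continuous_on_compose2[of UNIV "flat m"])
  then show ?case by (auto intro!: continuous_intros)
next
  case (Suc k)
  have d: "((\<lambda>x. complex_of_real (flat m (r x))) has_derivative
      (\<lambda>y. of_real (flat (m + 2) (r x) - of_nat m * flat (m + 1) (r x)) *
         frechet_derivative (\<lambda>x. of_real (r x)) (at x) y)) (at x)" for x
  proof -
    let ?D = "frechet_derivative (\<lambda>x. complex_of_real (r x)) (at x)"
    let ?c = "flat (m + 2) (r x) - of_nat m * flat (m + 1) (r x)"
    have 0: "((\<lambda>x. complex_of_real (r x)) has_derivative ?D) (at x)"
      using Suc.prems by (simp add: frechet_derivative_works)
    have 1: "(r has_derivative (\<lambda>y. Re (?D y))) (at x)"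
      using bounded_linear.has_derivative[OF bounded_linear_Re 0] by simp
    have 2: "((\<lambda>x. flat m (r x)) has_derivative (\<lambda>y. ?c * Re (?D y))) (at x)"
      using has_derivative_compose[OF 1 flat_deriv[unfolded has_field_derivative_def]] by simp
    have 3: "((\<lambda>x. complex_of_real (r x)) has_derivative (\<lambda>y. of_real (Re (?D y)))) (at x)"
      using bounded_linear.has_derivative[OF bounded_linear_of_real 1] .
    have "?D = (\<lambda>y. of_real (Re (?D y)))" using has_derivative_unique[OF 0 3] .
    then have "of_real (Re (?D y)) = ?D y" for y by metis
    moreover have "((\<lambda>x. complex_of_real (flat m (r x))) has_derivative (\<lambda>y. of_real (?c * Re (?D y)))) (at x)"
      using bounded_linear.has_derivative[OF bounded_linear_of_real 2] .
    ultimately show ?thesis by (simp only: of_real_mult)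
  qed
  have e: "pderiv_at i (\<lambda>x. complex_of_real (flat m (r x))) =
     (\<lambda>x. (of_real (flat (m + 2) (r x)) - of_nat m * of_real (flat (m + 1) (r x))) *
         pderiv_at i (\<lambda>x. of_real (r x)) x)" for i
    by (rule ext, subst pderiv_at_eqI[OF d]) (simp add: pderiv_at_def)
  have "C_k k (\<lambda>x. of_real (flat m (r x)))" for m
    using Suc.IH C_k_mono[OF Suc.prems] by blast
  then show ?case using Suc.prems d unfolding C_k.simps e
    by (auto intro!: C_k_mult C_k_diff simp: differentiable_def) 
qed

lemma flat_nonneg: "flat m t \<ge> 0" and flat_pos: "t > 0 \<Longrightarrow> flat m t > 0"
  and flat_nonpos_arg: "t \<le> 0 \<Longrightarrow> flat m t = 0"
  by (auto simp: flat_def)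

lemma C_k_norm_sq: "C_k k (\<lambda>x. complex_of_real ((norm x)\<^sup>2))"
proof -
  have "C_k k (\<lambda>x. complex_of_real (x $ 1) ^ 2 + complex_of_real (x $ 2) ^ 2)"
    by (intro C_k_add C_k_power C_k_coord)
  moreover have "(\<lambda>x::real^2. complex_of_real ((norm x)\<^sup>2)) = (\<lambda>x. complex_of_real (x $ 1) ^ 2 + complex_of_real (x $ 2) ^ 2)"
  proof
    fix x :: "real^2"
    have "(norm x)\<^sup>2 = (x $ 1)\<^sup>2 + (x $ 2)\<^sup>2"
      unfolding power2_norm_eq_inner by (simp add: inner_vec_def sum_2 power2_eq_square)
    then show "complex_of_real ((norm x)\<^sup>2) = complex_of_real (x $ 1) ^ 2 + complex_of_real (x $ 2) ^ 2"
      by (metis of_real_add of_real_power)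
  qed
  ultimately show ?thesis by simp
qed

text \<open>The quotient \<open>p / (p + q)\<close>, where \<open>p\<close> vanishes exactly outside
  the ball of radius \<open>b\<close> and \<open>q\<close> exactly inside that of radius
  \<open>a\<close>; since \<open>a < b\<close> the denominator never vanishes.\<close>

lemma smooth_cutoff:
  assumes "0 < a" "a < (b::real)"
  obtains X where "\<And>k. C_k k X" "\<And>x. norm x \<le> a \<Longrightarrow> X x = 1" "\<And>x. norm x \<ge> b \<Longrightarrow> X x = 0"
proof
  let ?p = "\<lambda>x::real^2. flat 0 (b\<^sup>2 - (norm x)\<^sup>2)" and ?q = "\<lambda>x::real^2. flat 0 ((norm x)\<^sup>2 - a\<^sup>2)"
  let ?X = "\<lambda>x. complex_of_real (?p x) * inverse (of_real (?p x) + of_real (?q x))"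
  have ab: "a\<^sup>2 < b\<^sup>2" using assms by (simp add: power_strict_mono)
  have pos: "?p x + ?q x > 0" for x
  proof (cases "norm x < b")
    case True
    then have "(norm x)\<^sup>2 < b\<^sup>2" by (simp add: power_strict_mono)
    then show ?thesis using flat_pos flat_nonneg by (meson add_pos_nonneg diff_gt_0_iff_gt)
  next
    case False
    then have "b\<^sup>2 \<le> (norm x)\<^sup>2" using assms by (simp add: power_mono)
    then show ?thesis using ab flat_pos flat_nonneg by (meson add_nonneg_pos diff_gt_0_iff_gt order_less_le_trans)
  qed
  have nz: "complex_of_real (?p x) + of_real (?q x) \<noteq> 0" for x
    using pos[of x] by (metis of_real_add of_real_eq_0_iff order_less_irrefl)
  have A: "C_k k (\<lambda>x. complex_of_real (?p x))" for k
  proof (rule C_k_flat)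
    have "C_k k (\<lambda>x. of_real (b\<^sup>2) - complex_of_real ((norm x)\<^sup>2))"
      by (intro C_k_diff C_k_const C_k_norm_sq)
    then show "C_k k (\<lambda>x. complex_of_real (b\<^sup>2 - (norm x)\<^sup>2))" by (simp only: of_real_diff)
  qed
  have B: "C_k k (\<lambda>x. complex_of_real (?q x))" for k
  proof (rule C_k_flat)
    have "C_k k (\<lambda>x. complex_of_real ((norm x)\<^sup>2) - of_real (a\<^sup>2))"
      by (intro C_k_diff C_k_const C_k_norm_sq)
    then show "C_k k (\<lambda>x. complex_of_real ((norm x)\<^sup>2 - a\<^sup>2))" by (simp only: of_real_diff)
  qed
  show "C_k k ?X" for k by (intro C_k_mult C_k_inverse C_k_add A B nz)
  show "?X x = 1" if "norm x \<le> a" for x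
  proof -
    have "(norm x)\<^sup>2 \<le> a\<^sup>2" using that by (simp add: power_mono)
    then have "?q x = 0" by (simp add: flat_nonpos_arg)
    then show ?thesis using nz[of x] by simp
  qed
  show "?X x = 0" if "norm x \<ge> b" for x
  proof -
    have "(norm x)\<^sup>2 \<ge> b\<^sup>2" using that assms by (simp add: power_mono)
    then show ?thesis by (simp add: flat_nonpos_arg)
  qed
qed

text \<open>Test functions have to be smooth everywhere, including at the pole
  \<open>(-d, 0)\<close> off the closed sector. The reciprocal is altered only within distance
  \<open>c\<close> of that pole.\<close>

lemma smooth_regularized_inverse:
  fixes \<iota> :: complex
  assumes "\<iota>\<^sup>2 = -1" and c: "c > 0"
  obtains m where "\<And>k. C_k k m"
    "\<And>x. norm (of_real (x $ 1 + d) + \<iota> * of_real (x $ 2)) \<ge> c \<Longrightarrow>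
       m x = inverse (of_real (x $ 1 + d) + \<iota> * of_real (x $ 2))"
proof
  let ?N = "\<lambda>x::real^2. (x $ 1 + d)\<^sup>2 + (x $ 2)\<^sup>2"
  let ?z = "\<lambda>x::real^2. of_real (x $ 1 + d) + \<iota> * of_real (x $ 2)"
  let ?zc = "\<lambda>x::real^2. of_real (x $ 1) + of_real d - \<iota> * of_real (x $ 2)"
  \<comment> \<open>\<open>1/z\<close> is written as conjugate over squared modulus, and the latter is made positive near the pole.\<close>
  let ?m = "\<lambda>x::real^2. ?zc x * inverse (of_real (?N x + flat 0 (c\<^sup>2 - ?N x)))"
  have \<iota>: "\<iota> = \<i> \<or> \<iota> = - \<i>"
    using assms(1) by (metis power2_eq_iff power2_i)
  have N: "(norm (?z x))\<^sup>2 = ?N x" for x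
    using \<iota> by (auto simp: cmod_power2)
  have prod: "?zc x * ?z x = of_real (?N x)" for x
  proof -
    have "\<iota> * (\<iota> * y) = - y" for y
      using assms(1) by (simp add: mult.assoc[symmetric] power2_eq_square)
    note this[simp]
    show ?thesis by (simp add: algebra_simps power2_eq_square)
  qed
  have pos: "?N x + flat 0 (c\<^sup>2 - ?N x) > 0" for x
  proof (cases "?N x = 0")
    case True
    then show ?thesis using c flat_pos[of "c\<^sup>2"] by simp
  next
    case False
    then have "?N x > 0" by (metis N zero_less_power2 power_zero_numeral zero_power2 not_gr_zero zero_le_power2 order_le_less)
    then show ?thesis using flat_nonneg by (meson add_pos_nonneg)
  qed
  have CN: "C_k k (\<lambda>x. complex_of_real (?N x))" for k
  proof -
    have "C_k k (\<lambda>x. (complex_of_real (x $ 1) + of_real d)^2 + (of_real (x $ 2))^2)"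
      by (intro C_k_add C_k_power C_k_coord C_k_const)
    then show ?thesis by simp
  qed
  have CF: "C_k k (\<lambda>x. complex_of_real (flat 0 (c\<^sup>2 - ?N x)))" for k
  proof (rule C_k_flat)
    have "C_k k (\<lambda>x. of_real (c\<^sup>2) - complex_of_real (?N x))"
      by (intro C_k_diff C_k_const CN)
    then show "C_k k (\<lambda>x. complex_of_real (c\<^sup>2 - ?N x))" by (simp only: of_real_diff)
  qed
  have "C_k k (\<lambda>x. ?zc x * inverse (complex_of_real (?N x) + of_real (flat 0 (c\<^sup>2 - ?N x))))" for k
  proof (intro C_k_mult C_k_inverse C_k_add C_k_diff C_k_coord C_k_const CN CF)
    show "complex_of_real (?N x) + of_real (flat 0 (c\<^sup>2 - ?N x)) \<noteq> 0" for x
      using pos[of x] by (metis of_real_add of_real_eq_0_iff order_less_irrefl)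
  qed
  then show "C_k k ?m" for k by (simp only: of_real_add)
  show "?m x = inverse (?z x)" if "norm (?z x) \<ge> c" for x
  proof -
    have "?N x \<ge> c\<^sup>2" using that c N by (metis power_mono less_imp_le)
    then have "?m x = ?zc x * inverse (of_real (?N x))" by (simp add: flat_nonpos_arg)
    also have "\<dots> = inverse (?z x)"
    proof -
      have "?z x \<noteq> 0" using that c by auto
      moreover have "of_real (?N x) = ?zc x * ?z x" using prod by simp
      moreover have "?zc x \<noteq> 0"
      proof
        assume "?zc x = 0"
        then have "complex_of_real (?N x) = 0" using prod[of x] by simp
        then have "?N x = 0" using of_real_eq_0_iff by blast
        then show False using \<open>?N x \<ge> c\<^sup>2\<close> c by simp
      qed
      ultimately show ?thesis by (simp only: inverse_mult_distrib) (simp add: mult.assoc[symmetric])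
    qed
    finally show ?thesis .
  qed
qed

section \<open>Supports and locality of derivatives\<close>

lemma supp_subset_cball:
  assumes "\<And>x. norm x \<ge> b \<Longrightarrow> f x = 0" shows "supp f \<subseteq> cball 0 b"
  unfolding supp_def using assms
  by (intro closure_minimal) (auto, metis linear)

lemma compact_suppI:
  assumes "\<And>x. norm x \<ge> b \<Longrightarrow> f x = 0" shows "compact (supp f)"
  using supp_subset_cball[OF assms] unfolding supp_def
  by (meson bounded_cball bounded_subset closed_closure compact_eq_bounded_closed)

lemma pderiv_at_cong_open:
  assumes "open S" "x \<in> S" "\<And>y. y \<in> S \<Longrightarrow> f y = g y" "(g has_derivative g') (at x)"
  shows "pderiv_at i f x = g' (axis i 1)"
  using has_derivative_transform_within_open[OF assms(4,1,2), of f] assms(3) pderiv_at_eqI by metis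

lemma pderiv_at_outside_supp: "x \<notin> supp f \<Longrightarrow> pderiv_at i f x = 0"
  by (rule pderiv_at_cong_open[of "- supp f" x f "\<lambda>_. 0"])
    (auto simp: supp_def dest: contra_subsetD[OF closure_subset])

section \<open>One-dimensional Hausdorff measure on lines\<close>

text \<open>The set function inside \<open>hausdorff1\<close>, named because it is needed on
  arbitrary sets: \<open>measure_of\<close> returns it on Borel sets only once it is known to be
  countably additive there.\<close>

definition hausdorff1_outer :: "(real^2) set \<Rightarrow> ennreal" where
  "hausdorff1_outer A = (SUP \<delta>\<in>{0<..}. hausdorff1_pre \<delta> A)"

lemma hausdorff1_pre_le:
  assumes "A \<subseteq> (\<Union>n. C n)" "\<And>n. bounded (C n)" "\<And>n. diameter (C n) \<le> \<delta>"
  shows "hausdorff1_pre \<delta> A \<le> (\<Sum>n. ennreal (diameter (C n)))"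
  unfolding hausdorff1_pre_def using assms by (intro Inf_lower) auto

lemma le_hausdorff1_preI:
  assumes "\<And>C. A \<subseteq> (\<Union>n. C n) \<Longrightarrow> (\<And>n. bounded (C n)) \<Longrightarrow> (\<And>n. diameter (C n) \<le> \<delta>)
     \<Longrightarrow> b \<le> (\<Sum>n. ennreal (diameter (C n)))"
  shows "b \<le> hausdorff1_pre \<delta> A"
  unfolding hausdorff1_pre_def using assms by (intro Inf_greatest) auto

section \<open>Monotonicity and countable subadditivity\<close>

lemma hausdorff1_pre_mono: "A \<subseteq> B \<Longrightarrow> hausdorff1_pre \<delta> A \<le> hausdorff1_pre \<delta> B"
  by (rule le_hausdorff1_preI, rule hausdorff1_pre_le) auto

lemma hausdorff1_pre_antimono: "\<delta> \<le> \<delta>' \<Longrightarrow> hausdorff1_pre \<delta>' A \<le> hausdorff1_pre \<delta> A"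
  by (rule le_hausdorff1_preI, rule hausdorff1_pre_le) (auto intro: order_trans)

lemma hausdorff1_outer_mono: "A \<subseteq> B \<Longrightarrow> hausdorff1_outer A \<le> hausdorff1_outer B"
  unfolding hausdorff1_outer_def by (intro SUP_mono) (auto intro: hausdorff1_pre_mono)

lemma hausdorff1_pre_le_outer: "\<delta> > 0 \<Longrightarrow> hausdorff1_pre \<delta> A \<le> hausdorff1_outer A"
  unfolding hausdorff1_outer_def by (intro SUP_upper) auto

lemma hausdorff1_outer_empty: "hausdorff1_outer {} = 0"
proof -
  have "hausdorff1_pre \<delta> {} \<le> 0" if "\<delta> > 0" for \<delta>
    using hausdorff1_pre_le[of "{}" "\<lambda>_. {}" \<delta>] that by simp
  then show ?thesis unfolding hausdorff1_outer_def by (auto intro!: SUP_eqI)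
qed

text \<open>Near-optimal coverings of the \<open>A i\<close>, with excess
  \<open>e / 2 ^ (i + 1)\<close>, are merged into a single sequence by the pairing function.\<close>

lemma hausdorff1_pre_countably_subadditive:
  assumes "\<delta> > 0"
  shows "hausdorff1_pre \<delta> (\<Union>i. A i) \<le> (\<Sum>i::nat. hausdorff1_pre \<delta> (A i))"
proof (rule ennreal_le_epsilon)
  fix e :: real
  assume fin: "(\<Sum>i. hausdorff1_pre \<delta> (A i)) < top" and e: "0 < e"
  have "\<exists>C. A i \<subseteq> (\<Union>n. C n) \<and> (\<forall>n. bounded (C n)) \<and> (\<forall>n. diameter (C n) \<le> \<delta>) \<and>
      (\<Sum>n. ennreal (diameter (C n))) \<le> hausdorff1_pre \<delta> (A i) + ennreal (e * (1/2) ^ Suc i)" for i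
  proof (rule ccontr)
    assume "\<not> ?thesis"
    then have "hausdorff1_pre \<delta> (A i) + ennreal (e * (1/2) ^ Suc i) \<le> hausdorff1_pre \<delta> (A i)"
      by (intro le_hausdorff1_preI) (meson le_cases)
    moreover have "hausdorff1_pre \<delta> (A i) < top"
      using fin ennreal_suminf_lessD by blast
    moreover have "ennreal (e * (1/2) ^ Suc i) > 0" using e by simp
    ultimately show False
      by (metis add.right_neutral ennreal_add_left_cancel_less less_le_not_le top.not_eq_extremum)
  qed
  then obtain C where C: "\<And>i. A i \<subseteq> (\<Union>n. C i n)" "\<And>i n. bounded (C i n)" "\<And>i n. diameter (C i n) \<le> \<delta>"
    "\<And>i. (\<Sum>n. ennreal (diameter (C i n))) \<le> hausdorff1_pre \<delta> (A i) + ennreal (e * (1/2) ^ Suc i)"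
    by metis
  define D where "D k = (case prod_decode k of (i, n) \<Rightarrow> C i n)" for k
  have "hausdorff1_pre \<delta> (\<Union>i. A i) \<le> (\<Sum>k. ennreal (diameter (D k)))"
  proof (rule hausdorff1_pre_le)
    show "(\<Union>i. A i) \<subseteq> (\<Union>k. D k)"
    proof
      fix x assume "x \<in> (\<Union>i. A i)"
      then obtain i n where "x \<in> C i n" using C(1) by blast
      then have "x \<in> D (prod_encode (i, n))" by (simp add: D_def)
      then show "x \<in> (\<Union>k. D k)" by blast
    qed
  qed (auto simp: D_def C split: prod.split)
  also have "\<dots> = (\<Sum>i. \<Sum>n. ennreal (diameter (C i n)))"
    using suminf_ennreal_2dimen[where f="\<lambda>(i, n). ennreal (diameter (C i n))" and g="\<lambda>i. \<Sum>n. ennreal (diameter (C i n))"]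
    by (simp add: D_def o_def split_def)
  also have "\<dots> \<le> (\<Sum>i. hausdorff1_pre \<delta> (A i) + ennreal (e * (1/2) ^ Suc i))"
    by (intro suminf_le C) auto
  also have "\<dots> = (\<Sum>i. hausdorff1_pre \<delta> (A i)) + (\<Sum>i. ennreal (e * (1/2) ^ Suc i))"
    by (simp add: suminf_add)
  also have "(\<Sum>i. ennreal (e * (1/2) ^ Suc i)) = ennreal e"
  proof -
    have "(\<lambda>i. e * (1/2) ^ Suc i) sums (e * 1)" by (intro sums_mult power_half_series)
    then show ?thesis using e by (intro suminf_ennreal_eq) auto
  qed
  finally show "hausdorff1_pre \<delta> (\<Union>i. A i) \<le> (\<Sum>i. hausdorff1_pre \<delta> (A i)) + ennreal e" .
qed

lemma hausdorff1_outer_countably_subadditive: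
  "hausdorff1_outer (\<Union>i. A i) \<le> (\<Sum>i::nat. hausdorff1_outer (A i))"
proof -
  have "hausdorff1_pre \<delta> (\<Union>i. A i) \<le> (\<Sum>i. hausdorff1_outer (A i))" if "\<delta> > 0" for \<delta>
    using hausdorff1_pre_countably_subadditive[OF that]
    by (rule order_trans) (intro suminf_le hausdorff1_pre_le_outer that summableI)
  then show ?thesis unfolding hausdorff1_outer_def[of "\<Union>i. A i"] by (intro SUP_least) auto
qed

lemma outer_measure_space_hausdorff1: "outer_measure_space (Pow UNIV) hausdorff1_outer"
  unfolding outer_measure_space_def positive_def increasing_def countably_subadditive_def
  using hausdorff1_outer_empty hausdorff1_outer_mono hausdorff1_outer_countably_subadditive by auto

lemma hausdorff1_outer_subadditive: "hausdorff1_outer (A \<union> B) \<le> hausdorff1_outer A + hausdorff1_outer B"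
proof -
  interpret sigma_algebra UNIV "Pow UNIV :: (real^2) set set" by (rule sigma_algebra_Pow)
  have "subadditive (Pow UNIV) hausdorff1_outer"
    using outer_measure_space_hausdorff1 countably_subadditive_subadditive
    by (auto simp: outer_measure_space_def)
  then have "hausdorff1_outer (A \<union> (B - A)) \<le> hausdorff1_outer A + hausdorff1_outer (B - A)"
    by (intro subadditiveD) auto
  also have "\<dots> \<le> hausdorff1_outer A + hausdorff1_outer B"
    by (intro add_left_mono hausdorff1_outer_mono) auto
  finally show ?thesis by simp
qed

text \<open>Once \<open>\<delta> < \<rho>\<close>, no covering set meets both \<open>A\<close> and
  \<open>B\<close>, so a covering of the union splits into two. Sets that miss the relevant part are
  replaced by the empty set, of diameter 0, which keeps the indexing.\<close>

lemma hausdorff1_outer_separated: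
  assumes "\<rho> > 0" "\<And>x y. x \<in> A \<Longrightarrow> y \<in> B \<Longrightarrow> dist x y \<ge> \<rho>"
  shows "hausdorff1_outer A + hausdorff1_outer B \<le> hausdorff1_outer (A \<union> B)"
proof -
  have *: "hausdorff1_pre \<delta> A + hausdorff1_pre \<delta> B \<le> hausdorff1_pre \<delta> (A \<union> B)" if \<delta>: "0 < \<delta>" "\<delta> < \<rho>" for \<delta>
  proof (rule le_hausdorff1_preI)
    fix C :: "nat \<Rightarrow> (real^2) set"
    assume C: "A \<union> B \<subseteq> (\<Union>n. C n)" "\<And>n. bounded (C n)" "\<And>n. diameter (C n) \<le> \<delta>"
    define CA where "CA n = (if C n \<inter> A = {} then {} else C n)" for n
    define CB where "CB n = (if C n \<inter> B = {} then {} else C n)" for n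
    have "hausdorff1_pre \<delta> A \<le> (\<Sum>n. ennreal (diameter (CA n)))"
      using C \<delta> by (intro hausdorff1_pre_le) (fastforce simp: CA_def)+
    moreover have "hausdorff1_pre \<delta> B \<le> (\<Sum>n. ennreal (diameter (CB n)))"
      using C \<delta> by (intro hausdorff1_pre_le) (fastforce simp: CB_def)+
    ultimately have "hausdorff1_pre \<delta> A + hausdorff1_pre \<delta> B \<le>
        (\<Sum>n. ennreal (diameter (CA n))) + (\<Sum>n. ennreal (diameter (CB n)))"
      by (rule add_mono)
    also have "\<dots> = (\<Sum>n. ennreal (diameter (CA n)) + ennreal (diameter (CB n)))"
      by (simp add: suminf_add)
    also have "\<dots> \<le> (\<Sum>n. ennreal (diameter (C n)))"
    proof (intro suminf_le summableI)
      fix n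
      have "C n \<inter> A = {} \<or> C n \<inter> B = {}"
      proof (rule ccontr)
        assume "\<not> ?thesis"
        then obtain x y where xy: "x \<in> C n" "x \<in> A" "y \<in> C n" "y \<in> B" by blast
        then have "dist x y \<le> diameter (C n)" using C(2) diameter_bounded_bound by blast
        then show False using assms(2) xy C(3)[of n] \<delta> by fastforce
      qed
      then show "ennreal (diameter (CA n)) + ennreal (diameter (CB n)) \<le> ennreal (diameter (C n))"
        by (auto simp: CA_def CB_def)
    qed
    finally show "hausdorff1_pre \<delta> A + hausdorff1_pre \<delta> B \<le> (\<Sum>n. ennreal (diameter (C n)))" .
  qed
  have "hausdorff1_outer A + hausdorff1_outer B =
     (SUP \<delta>\<in>{0<..}. hausdorff1_pre \<delta> A + hausdorff1_pre \<delta> B)"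
    unfolding hausdorff1_outer_def
  proof (rule SUP_add_directed_ennreal[symmetric])
    fix i j :: real assume "i \<in> {0<..}" "j \<in> {0<..}"
    then show "\<exists>k\<in>{0<..}. hausdorff1_pre i A + hausdorff1_pre j B \<le> hausdorff1_pre k A + hausdorff1_pre k B"
      by (intro bexI[of _ "min i j"] add_mono hausdorff1_pre_antimono) auto
  qed
  also have "\<dots> \<le> hausdorff1_outer (A \<union> B)"
  proof (rule SUP_least)
    fix \<delta> :: real assume "\<delta> \<in> {0<..}"
    have "hausdorff1_pre \<delta> A + hausdorff1_pre \<delta> B \<le> hausdorff1_pre (min \<delta> (\<rho>/2)) A + hausdorff1_pre (min \<delta> (\<rho>/2)) B"
      by (intro add_mono hausdorff1_pre_antimono) auto
    also have "\<dots> \<le> hausdorff1_pre (min \<delta> (\<rho>/2)) (A \<union> B)"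
      using \<open>\<delta> \<in> {0<..}\<close> assms(1) by (intro *) auto
    also have "\<dots> \<le> hausdorff1_outer (A \<union> B)"
      using \<open>\<delta> \<in> {0<..}\<close> assms(1) by (intro hausdorff1_pre_le_outer) auto
    finally show "hausdorff1_pre \<delta> A + hausdorff1_pre \<delta> B \<le> hausdorff1_outer (A \<union> B)" .
  qed
  finally show ?thesis .
qed

lemma hausdorff1_outer_separated_sum:
  fixes R :: "nat \<Rightarrow> (real^2) set"
  assumes R: "\<And>k. R k \<subseteq> A"
    and sep: "\<And>k. \<exists>\<rho>>0. \<forall>x\<in>(\<Union>j<k. R j). \<forall>y\<in>R k. dist x y \<ge> \<rho>"
  shows "(\<Sum>k. hausdorff1_outer (R k)) \<le> hausdorff1_outer A"
proof -
  have "(\<Sum>k<n. hausdorff1_outer (R k)) \<le> hausdorff1_outer (\<Union>k<n. R k)" for n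
  proof (induction n)
    case (Suc n)
    obtain \<rho> where "\<rho> > 0" "\<forall>x\<in>(\<Union>j<n. R j). \<forall>y\<in>R n. dist x y \<ge> \<rho>" using sep by blast
    then have sep': "hausdorff1_outer (\<Union>k<n. R k) + hausdorff1_outer (R n) \<le> hausdorff1_outer ((\<Union>k<n. R k) \<union> R n)"
      by (intro hausdorff1_outer_separated) auto
    have "(\<Sum>k<Suc n. hausdorff1_outer (R k)) \<le> hausdorff1_outer (\<Union>k<n. R k) + hausdorff1_outer (R n)"
      using add_right_mono[OF Suc.IH, of "hausdorff1_outer (R n)"] by simp
    also note sep'
    also have "(\<Union>k<n. R k) \<union> R n = (\<Union>k<Suc n. R k)" by (auto simp: lessThan_Suc)
    finally show ?case .
  qed simp
  then have "(\<Sum>k<n. hausdorff1_outer (R k)) \<le> hausdorff1_outer A" for n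
    by (rule order_trans) (use R in \<open>auto intro!: hausdorff1_outer_mono\<close>)
  then show ?thesis by (intro suminf_le_const summableI)
qed

lemma ennreal_suminf_tail_less:
  fixes f :: "nat \<Rightarrow> ennreal"
  assumes "(\<Sum>k. f k) < top" "0 < e"
  obtains n where "(\<Sum>k. f (k + n)) \<le> ennreal e"
proof -
  have fin: "f k < top" for k using assms(1) ennreal_suminf_lessD by blast
  have sm: "summable (\<lambda>k. enn2real (f k))"
    using assms(1) by (intro summable_suminf_not_top) (use fin in \<open>auto simp: less_top\<close>)
  obtain n where n: "norm (\<Sum>k. enn2real (f (k + n))) < e"
    using suminf_exist_split[OF assms(2) sm] by blast
  have "(\<Sum>k. f (k + n)) = (\<Sum>k. ennreal (enn2real (f (k + n))))" using fin by (simp add: less_top)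
  also have "\<dots> = ennreal (\<Sum>k. enn2real (f (k + n)))"
    using sm by (intro suminf_ennreal2) (auto simp: summable_iff_shift[of "\<lambda>k. enn2real (f k)"])
  also have "\<dots> \<le> ennreal e" using n by (intro ennreal_leI) auto
  finally show ?thesis using that by blast
qed

text \<open>Caratheodory's criterion for metric outer measures. The points of \<open>A - C\<close>
  at distance at least \<open>1 / (n + 1)\<close> from \<open>C\<close> are separated from
  \<open>A \<inter> C\<close>, and the remaining ones lie in a tail of shells around
  \<open>C\<close>.\<close>

lemma hausdorff1_outer_closed:
  assumes "closed C"
  shows "hausdorff1_outer (A \<inter> C) + hausdorff1_outer (A - C) \<le> hausdorff1_outer A"
proof (cases "C = {} \<or> hausdorff1_outer A = top")
  \<comment> \<open>For empty \<open>C\<close> the default value \<open>infdist x {} = 0\<close>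
    would spoil the shells; an infinite outer measure makes the claim trivial.\<close>
  case True
  then show ?thesis by (auto simp: hausdorff1_outer_empty)
next
  case False
  \<comment> \<open>The shells \<open>R k\<close> of even index are separated from each other, and so are the odd ones;
    hence their outer measures are summable.\<close>
  define d where "d x = infdist x C" for x
  define R where "R k = {x \<in> A. 1 / real (k + 2) \<le> d x \<and> d x < 1 / real (k + 1)}" for k
  have dtri: "d x \<le> d y + dist x y" for x y unfolding d_def by (rule infdist_triangle)
  have sep: "\<exists>\<rho>>0. \<forall>x\<in>(\<Union>j<k. R (2 * j + p)). \<forall>y\<in>R (2 * k + p). dist x y \<ge> \<rho>" for k p
  proof (cases "k = 0")
    case True
    then show ?thesis by (auto intro: exI[of _ 1])
  next
    case False
    \<comment> \<open>The gap is the width of the skipped shell of index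
      \<open>2 * k + p - 1\<close>.\<close>
    let ?\<rho> = "1 / real (2 * k + p) - 1 / real (2 * k + p + 1)"
    have "1 / real (2 * k + p + 1) < 1 / real (2 * k + p)"
      using False by (intro divide_strict_left_mono mult_pos_pos) auto
    then have "?\<rho> > 0" by simp
    moreover have "dist x y \<ge> ?\<rho>" if "x \<in> R (2 * j + p)" "j < k" "y \<in> R (2 * k + p)" for x y j
    proof -
      have "1 / real (2 * k + p) \<le> 1 / real (2 * j + p + 2)"
        using that(2) by (intro divide_left_mono mult_pos_pos) auto
      also have "\<dots> \<le> d x" using that(1) by (simp add: R_def)
      finally have "1 / real (2 * k + p) \<le> d x" .
      moreover have "d y < 1 / real (2 * k + p + 1)" using that(3) by (simp add: R_def)
      ultimately show ?thesis using dtri[of x y] by linarith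
    qed
    ultimately show ?thesis by (intro exI[of _ ?\<rho>]) auto
  qed
  have RA: "R k \<subseteq> A" for k by (auto simp: R_def)
  have par: "(\<Sum>k. hausdorff1_outer (R (2 * k + p))) \<le> hausdorff1_outer A" for p
    by (rule hausdorff1_outer_separated_sum[of "\<lambda>k. R (2 * k + p)", OF RA sep])
  have "(\<Sum>k<n. hausdorff1_outer (R k)) \<le> hausdorff1_outer A + hausdorff1_outer A" for n
  proof -
    have "(\<Sum>k<n. hausdorff1_outer (R k)) \<le> (\<Sum>k<2 * n. hausdorff1_outer (R k))"
      by (intro sum_mono2) auto
    also have "\<dots> = (\<Sum>k<n. hausdorff1_outer (R (2 * k + 0))) + (\<Sum>k<n. hausdorff1_outer (R (2 * k + 1)))"
      by (induction n) (simp_all add: algebra_simps)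
    also have "\<dots> \<le> (\<Sum>k. hausdorff1_outer (R (2 * k + 0))) + (\<Sum>k. hausdorff1_outer (R (2 * k + 1)))"
      by (intro add_mono sum_le_suminf summableI) auto
    also have "\<dots> \<le> hausdorff1_outer A + hausdorff1_outer A"
      by (intro add_mono par)
    finally show ?thesis .
  qed
  then have "(\<Sum>k. hausdorff1_outer (R k)) \<le> hausdorff1_outer A + hausdorff1_outer A"
    by (intro suminf_le_const summableI)
  also have "\<dots> < top" using False by (simp add: less_top)
  finally have fin: "(\<Sum>k. hausdorff1_outer (R k)) < top" .
  show ?thesis
  proof (rule ennreal_le_epsilon)
    fix e :: real assume "0 < e"
    then obtain n where n: "(\<Sum>k. hausdorff1_outer (R (k + n))) \<le> ennreal e"
      using ennreal_suminf_tail_less[OF fin] by blast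
    define An where "An = {x \<in> A. d x \<ge> 1 / real (n + 1)}"
    have "A - C \<subseteq> An \<union> (\<Union>k. R (k + n))"
    proof
      fix x assume x: "x \<in> A - C"
      then have dx: "d x > 0" unfolding d_def
        using in_closed_iff_infdist_zero[of C x] infdist_nonneg[of x C] assms False by (auto simp: order_le_less)
      show "x \<in> An \<union> (\<Union>k. R (k + n))"
      proof (cases "d x \<ge> 1 / real (n + 1)")
        case False
        \<comment> \<open>The shell that contains \<open>x\<close> is the first one whose inner
          radius does not exceed \<open>d x\<close>.\<close>
        define m where "m = (LEAST m. 1 / real (m + 2) \<le> d x)"
        obtain m0 where "inverse (real (Suc m0)) < d x" using reals_Archimedean[OF dx] by blast
        moreover have "1 / real (m0 + 2) \<le> inverse (real (Suc m0))" by (simp add: field_simps)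
        ultimately have "1 / real (m0 + 2) \<le> d x" by linarith
        then have m: "1 / real (m + 2) \<le> d x" unfolding m_def by (rule LeastI)
        have "n \<le> m"
        proof (rule ccontr)
          assume "\<not> n \<le> m"
          then have "1 / real (n + 1) \<le> 1 / real (m + 2)" by (intro divide_left_mono mult_pos_pos) auto
          then show False using m False by linarith
        qed
        have "d x < 1 / real (m + 1)"
        proof (cases "m = n")
          case True
          then show ?thesis using False by simp
        next
          case mn: False
          then obtain m' where m': "m = Suc m'" using \<open>n \<le> m\<close> by (cases m) auto
          have "\<not> 1 / real (m' + 2) \<le> d x"
            using not_less_Least[of m' "\<lambda>m. 1 / real (m + 2) \<le> d x"] m' unfolding m_def[symmetric] by simp
          then show ?thesis by (simp add: m')
        qed
        then have "x \<in> R ((m - n) + n)" using m \<open>n \<le> m\<close> x by (simp add: R_def)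
        then show ?thesis by blast
      qed (use x in \<open>auto simp: An_def\<close>)
    qed
    then have "hausdorff1_outer (A - C) \<le> hausdorff1_outer (An \<union> (\<Union>k. R (k + n)))"
      by (rule hausdorff1_outer_mono)
    also have "\<dots> \<le> hausdorff1_outer An + hausdorff1_outer (\<Union>k. R (k + n))"
      by (rule hausdorff1_outer_subadditive)
    also have "\<dots> \<le> hausdorff1_outer An + ennreal e"
      using hausdorff1_outer_countably_subadditive n by (intro add_left_mono) (rule order_trans)
    finally have "hausdorff1_outer (A \<inter> C) + hausdorff1_outer (A - C) \<le> (hausdorff1_outer (A \<inter> C) + hausdorff1_outer An) + ennreal e"
      by (simp add: add.assoc add_left_mono)
    also have "hausdorff1_outer (A \<inter> C) + hausdorff1_outer An \<le> hausdorff1_outer (A \<inter> C \<union> An)"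
    proof (rule hausdorff1_outer_separated)
      show "1 / real (n + 1) > 0" by simp
      fix x y assume "x \<in> A \<inter> C" "y \<in> An"
      then show "dist x y \<ge> 1 / real (n + 1)"
        using infdist_le[of x C y] by (auto simp: An_def d_def dist_commute)
    qed
    also have "\<dots> \<le> hausdorff1_outer A" by (intro hausdorff1_outer_mono) (auto simp: An_def)
    finally show "hausdorff1_outer (A \<inter> C) + hausdorff1_outer (A - C) \<le> hausdorff1_outer A + ennreal e"
      by (simp add: add_right_mono)
  qed
qed

text \<open>The Caratheodory measurable sets form a sigma-algebra that contains the closed sets,
  hence the Borel sets, and the outer measure is countably additive on it.\<close>

lemma hausdorff1_emeasure:
  assumes "A \<in> sets borel" shows "emeasure hausdorff1 A = hausdorff1_outer A"
proof -
  interpret P: sigma_algebra UNIV "Pow UNIV :: (real^2) set set" by (rule sigma_algebra_Pow)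
  let ?L = "lambda_system UNIV (Pow UNIV) hausdorff1_outer"
  have ms: "measure_space UNIV ?L hausdorff1_outer"
    by (rule P.caratheodory_lemma[OF outer_measure_space_hausdorff1])
  have cl: "C \<in> ?L" if "closed C" for C
  proof -
    have "hausdorff1_outer (x \<inter> C) + hausdorff1_outer (x - C) = hausdorff1_outer x" for x
      using hausdorff1_outer_closed[OF that, of x] hausdorff1_outer_subadditive[of "x \<inter> C" "x - C"]
      by (simp add: Int_Diff_Un antisym)
    then show ?thesis unfolding P.lambda_system_eq by simp
  qed
  have sub: "sets borel \<subseteq> ?L"
  proof -
    have "sigma_sets UNIV (Collect closed) \<subseteq> ?L"
      using ms cl by (intro sigma_algebra.sigma_sets_subset) (auto simp: measure_space_def)
    then show ?thesis unfolding borel_eq_closed by simp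
  qed
  have "measure_space UNIV (sets borel) hausdorff1_outer"
    using ms sub sets.sigma_algebra_axioms[of "borel :: (real^2) measure"]
    unfolding measure_space_def positive_def countably_additive_def by (auto simp: subset_iff)
  then show ?thesis
    unfolding hausdorff1_def hausdorff1_outer_def[symmetric] measure_space_def
    using assms by (subst emeasure_measure_of_sigma) (auto simp: hausdorff1_outer_def[abs_def])
qed

lemma sets_hausdorff1 [simp, measurable_cong]: "sets hausdorff1 = sets borel"
  unfolding hausdorff1_def by (metis sets.sigma_sets_eq sets_measure_of space_borel top_greatest Pow_UNIV)

lemma space_hausdorff1 [simp]: "space hausdorff1 = UNIV"
  using sets_eq_imp_space_eq[OF sets_hausdorff1] by simp

text \<open>Upper bound: cut the segment into pieces of length at most \<open>\<delta>\<close>.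
  Lower bound: projecting a covering onto the line does not increase diameters, and Lebesgue measure
  on the line is countably subadditive.\<close>

lemma hausdorff1_outer_segment:
  fixes e :: "real^2"
  assumes e: "norm e = 1" and lu: "l \<le> u"
  shows "hausdorff1_outer ((\<lambda>s. s *\<^sub>R e) ` {l<..<u}) = ennreal (u - l)" (is "hausdorff1_outer ?S = _")
proof (rule antisym)
  have "hausdorff1_pre \<delta> ?S \<le> ennreal (u - l)" if "\<delta> > 0" for \<delta>
  proof -
    obtain n where n: "real n > (u - l) / \<delta>" "n > 0"
      by (metis gr_zeroI not_less_zero of_nat_0_less_iff order_less_trans reals_Archimedean2 le_less_linear max_less_iff_conj)
    define w where "w = (u - l) / n"
    have w: "0 \<le> w" "w \<le> \<delta>" "n * w = u - l"
      using n that lu by (auto simp: w_def field_simps)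
    define C where "C i = (if i < n then (\<lambda>s. s *\<^sub>R e) ` {l + i * w .. l + (i + 1) * w} else {})" for i :: nat
    have diam: "diameter (C i) \<le> (if i < n then w else 0)" for i
    proof (cases "i < n")
      case True
      have "diameter (C i) \<le> w"
      proof (rule diameter_le)
        show "C i \<noteq> {} \<or> 0 \<le> w" using w by simp
        fix x y assume "x \<in> C i" "y \<in> C i"
        then have xy: "x \<in> (\<lambda>s. s *\<^sub>R e) ` {l + i * w .. l + (i + 1) * w}" "y \<in> (\<lambda>s. s *\<^sub>R e) ` {l + i * w .. l + (i + 1) * w}"
          using True by (simp_all only: C_def if_True)
        obtain s where s: "x = s *\<^sub>R e" "s \<in> {l + i * w .. l + (i + 1) * w}" using xy(1) by (rule imageE)
        obtain t where t: "y = t *\<^sub>R e" "t \<in> {l + i * w .. l + (i + 1) * w}" using xy(2) by (rule imageE)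
        note st = s(1) t(1) s(2) t(2)
        have "norm (x - y) = \<bar>s - t\<bar>" unfolding st using e by (simp flip: scaleR_diff_left)
        also have "\<dots> \<le> w" using st by (auto simp: algebra_simps)
        finally show "norm (x - y) \<le> w" .
      qed
      then show ?thesis using True by simp
    qed (simp add: C_def)
    have "hausdorff1_pre \<delta> ?S \<le> (\<Sum>i. ennreal (diameter (C i)))"
    proof (rule hausdorff1_pre_le)
      show "?S \<subseteq> (\<Union>i. C i)"
      proof
        fix x assume "x \<in> ?S"
        then obtain s where s: "l < s" "s < u" "x = s *\<^sub>R e" by auto
        then have wp: "w > 0" using w n by (simp add: w_def)
        define i where "i = nat \<lfloor>(s - l) / w\<rfloor>"
        have "real i \<le> (s - l) / w" "(s - l) / w < real i + 1"
          using s wp by (auto simp: i_def of_nat_nat floor_less_iff)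
        then have i: "i * w \<le> s - l" "s - l < (i + 1) * w" using wp by (auto simp: field_simps)
        have "i < n"
        proof (rule ccontr)
          assume "\<not> i < n"
          then have "n * w \<le> i * w" using wp by simp
          then show False using i s w by linarith
        qed
        then have "x \<in> C i" using i s by (auto simp: C_def)
        then show "x \<in> (\<Union>i. C i)" by blast
      qed
      show "bounded (C i)" for i
      proof (cases "i < n")
        case True
        have "compact (C i)" unfolding C_def using True
          by (auto intro!: compact_continuous_image continuous_intros)
        then show ?thesis by (rule compact_imp_bounded)
      qed (simp add: C_def)
      show "diameter (C i) \<le> \<delta>" for i using diam[of i] w that by (auto split: if_splits)
    qed
    also have "\<dots> \<le> (\<Sum>i. ennreal (if i < n then w else 0))"
      by (intro suminf_le summableI ennreal_leI diam)
    also have "\<dots> = (\<Sum>i<n. ennreal (if i < n then w else 0))"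
      by (intro suminf_finite) auto
    also have "\<dots> = ennreal (n * w)" using w(1)
      by (simp add: ennreal_of_nat_eq_real_of_nat ennreal_mult)
    finally show ?thesis unfolding w(3) .
  qed
  then show "hausdorff1_outer ?S \<le> ennreal (u - l)"
    unfolding hausdorff1_outer_def by (intro SUP_least) auto
next
  have "ennreal (u - l) \<le> hausdorff1_pre 1 ?S"
  proof (rule le_hausdorff1_preI)
    fix C :: "nat \<Rightarrow> (real^2) set"
    assume C: "?S \<subseteq> (\<Union>n. C n)" "\<And>n. bounded (C n)"
    define P where "P n = (\<lambda>x. x \<bullet> e) ` C n" for n
    \<comment> \<open>The projection of an arbitrary covering set need not be measurable; its
      interval hull is, and has length at most the diameter of the set.\<close>
    define I where "I n = (if C n = {} then {} else {Inf (P n)..Sup (P n)})" for n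
    have bP: "bounded (P n)" for n unfolding P_def
      by (intro bounded_linear_image C bounded_linear_inner_left)
    have P: "x \<bullet> e \<in> I n" if "x \<in> C n" for x n
      using that bP[of n] unfolding I_def P_def
      by (auto intro!: cInf_lower cSup_upper bounded_imp_bdd_below bounded_imp_bdd_above)
    have len: "emeasure lborel (I n) \<le> ennreal (diameter (C n))" for n
    proof (cases "C n = {}")
      case False
      have d: "p - q \<le> diameter (C n)" if "p \<in> P n" "q \<in> P n" for p q
      proof -
        obtain x y where xy: "x \<in> C n" "y \<in> C n" "p = x \<bullet> e" "q = y \<bullet> e" using \<open>p \<in> P n\<close> \<open>q \<in> P n\<close> P_def by auto
        have "p - q = (x - y) \<bullet> e" by (simp add: xy inner_diff_left)
        also have "\<dots> \<le> norm (x - y) * norm e" by (rule norm_cauchy_schwarz)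
        also have "\<dots> \<le> diameter (C n)"
          using diameter_bounded_bound[OF C(2) xy(1,2)] e by (simp add: dist_norm)
        finally show ?thesis .
      qed
      have ne: "P n \<noteq> {}" using False P_def by auto
      have "p - diameter (C n) \<le> Inf (P n)" if "p \<in> P n" for p
        using d[OF that] ne by (intro cInf_greatest) (auto simp: algebra_simps)
      then have "Sup (P n) \<le> Inf (P n) + diameter (C n)"
        using ne by (intro cSup_least) (auto simp: algebra_simps)
      moreover have "Inf (P n) \<le> Sup (P n)"
        using ne bP by (intro cInf_le_cSup) (auto intro: bounded_imp_bdd_below bounded_imp_bdd_above)
      ultimately show ?thesis using False by (simp add: I_def ennreal_leI)
    qed (simp add: I_def)
    have "ennreal (u - l) = emeasure lborel {l<..<u}" using lu by simp
    also have "\<dots> \<le> emeasure lborel (\<Union>n. I n)"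
    proof (rule emeasure_mono)
      show "{l<..<u} \<subseteq> (\<Union>n. I n)"
      proof
        fix s assume "s \<in> {l<..<u}"
        then obtain n where "s *\<^sub>R e \<in> C n" using C(1) by blast
        then have "(s *\<^sub>R e) \<bullet> e \<in> I n" by (rule P)
        then show "s \<in> (\<Union>n. I n)" using e by (auto simp: dot_square_norm)
      qed
    qed (auto simp: I_def)
    also have "\<dots> \<le> (\<Sum>n. emeasure lborel (I n))"
      by (rule emeasure_subadditive_countably) (auto simp: I_def)
    also have "\<dots> \<le> (\<Sum>n. ennreal (diameter (C n)))"
      by (intro suminf_le summableI len)
    finally show "ennreal (u - l) \<le> (\<Sum>n. ennreal (diameter (C n)))" .
  qed
  also have "\<dots> \<le> hausdorff1_outer ?S" by (rule hausdorff1_pre_le_outer) simp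
  finally show "ennreal (u - l) \<le> hausdorff1_outer ?S" .
qed

text \<open>The coordinate \<open>x \<bullet> e\<close> pushes Hausdorff measure on the line forward
  to a Borel measure that gives intervals their length, and this characterises Lebesgue
  measure.\<close>

lemma nn_integral_hausdorff1_line:
  fixes e :: "real^2"
  assumes e: "norm e = 1" and [measurable]: "f \<in> borel_measurable borel"
  shows "(\<integral>\<^sup>+x. f x * indicator (range (\<lambda>s. s *\<^sub>R e)) x \<partial>hausdorff1) = (\<integral>\<^sup>+s. f (s *\<^sub>R e) \<partial>lborel)"
proof -
  let ?L = "range (\<lambda>s. s *\<^sub>R e)"
  have ee: "e \<bullet> e = 1" using e by (simp add: dot_square_norm)
  have Leq: "?L = {x. x = (x \<bullet> e) *\<^sub>R e}" using ee by auto
  have [measurable]: "?L \<in> sets borel"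
  proof -
    have "closed {x. x = (x \<bullet> e) *\<^sub>R e}" by (intro closed_Collect_eq continuous_intros)
    then show ?thesis unfolding Leq by (rule borel_closed)
  qed
  define N where "N = distr (restrict_space hausdorff1 ?L) borel (\<lambda>x. x \<bullet> e)"
  have mes [measurable]: "(\<lambda>x. x \<bullet> e) \<in> measurable (restrict_space hausdorff1 ?L) borel"
    by (intro measurable_restrict_space1) measurable
  have "lborel = N"
  proof (rule lborel_eqI)
    fix l u :: real assume lu: "\<And>b. b \<in> Basis \<Longrightarrow> l \<bullet> b \<le> u \<bullet> b"
    then have lu: "l \<le> u" by simp
    have im: "(\<lambda>x. x \<bullet> e) -` {l<..<u} \<inter> ?L = (\<lambda>s. s *\<^sub>R e) ` {l<..<u}"
      using ee by auto
    have [measurable]: "(\<lambda>x. x \<bullet> e) -` {l<..<u} \<inter> ?L \<in> sets borel"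
      using measurable_sets_borel[of "\<lambda>x. x \<bullet> e" borel "{l<..<u}"] by (intro sets.Int) auto
    have "emeasure N {l<..<u} = emeasure hausdorff1 ((\<lambda>x. x \<bullet> e) -` {l<..<u} \<inter> ?L)"
      unfolding N_def by (subst emeasure_distr) (auto simp: space_restrict_space emeasure_restrict_space)
    also have "\<dots> = ennreal (u - l)"
      unfolding im
      unfolding hausdorff1_emeasure[OF \<open>(\<lambda>x. x \<bullet> e) -` {l<..<u} \<inter> ?L \<in> sets borel\<close>, unfolded im]
      using hausdorff1_outer_segment[OF e lu] .
    finally show "emeasure N (box l u) = ennreal (\<Prod>b\<in>Basis. (u - l) \<bullet> b)"
      by (simp add: box_real)
  qed (simp add: N_def)
  then have "(\<integral>\<^sup>+s. f (s *\<^sub>R e) \<partial>lborel) = (\<integral>\<^sup>+s. f (s *\<^sub>R e) \<partial>N)" by simp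
  also have "\<dots> = (\<integral>\<^sup>+x. f ((x \<bullet> e) *\<^sub>R e) \<partial>restrict_space hausdorff1 ?L)"
    unfolding N_def by (rule nn_integral_distr[OF mes]) measurable
  also have "\<dots> = (\<integral>\<^sup>+x. f ((x \<bullet> e) *\<^sub>R e) * indicator ?L x \<partial>hausdorff1)"
    by (rule nn_integral_restrict_space) simp
  also have "\<dots> = (\<integral>\<^sup>+x. f x * indicator ?L x \<partial>hausdorff1)"
    by (intro nn_integral_cong) (auto simp: indicator_def Leq)
  finally show ?thesis by simp
qed

section \<open>Sectors and oblique coordinates\<close>

lemma vec2_eq_iff: "x = y \<longleftrightarrow> x $ 1 = y $ 1 \<and> x $ 2 = y $ 2" for x y :: "'a^2"
  by (auto simp: vec_eq_iff forall_2)

text \<open>The determinant of the matrix with columns \<open>a\<close> and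
  \<open>b\<close>.\<close>

definition cross2 :: "real^2 \<Rightarrow> real^2 \<Rightarrow> real" where
  "cross2 a b = a $ 1 * b $ 2 - a $ 2 * b $ 1"

text \<open>The coefficient set \<open>J\<close> is a parameter because both the open cone
  (\<open>{0<..}\<close>) and the closed cone (\<open>{0..}\<close>) occur: the former is a convex
  sector, the latter the complement of a reflex one.\<close>

definition cone2 :: "real set \<Rightarrow> real^2 \<Rightarrow> real^2 \<Rightarrow> (real^2) set" where
  "cone2 J a b = {r *\<^sub>R a + s *\<^sub>R b | r s. r \<in> J \<and> s \<in> J}"

lemma cross2_comb:
  "cross2 (r *\<^sub>R a + s *\<^sub>R b) b = r * cross2 a b" "cross2 a (r *\<^sub>R a + s *\<^sub>R b) = s * cross2 a b"
  by (simp_all add: cross2_def algebra_simps)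

text \<open>Cramer's rule in the basis \<open>a\<close>, \<open>b\<close>.\<close>

lemma cross2_coords:
  assumes "cross2 a b \<noteq> 0"
  shows "x = (cross2 x b / cross2 a b) *\<^sub>R a + (cross2 a x / cross2 a b) *\<^sub>R b"
  using assms by (simp add: vec2_eq_iff cross2_def divide_simps) (simp add: algebra_simps)

lemma cone2_iff:
  assumes "cross2 a b \<noteq> 0"
  shows "x \<in> cone2 J a b \<longleftrightarrow> cross2 x b / cross2 a b \<in> J \<and> cross2 a x / cross2 a b \<in> J"
proof
  assume "x \<in> cone2 J a b"
  then show "cross2 x b / cross2 a b \<in> J \<and> cross2 a x / cross2 a b \<in> J"
    using assms by (auto simp: cone2_def cross2_comb)
next
  assume "cross2 x b / cross2 a b \<in> J \<and> cross2 a x / cross2 a b \<in> J"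
  then show "x \<in> cone2 J a b" using cross2_coords[OF assms, of x] unfolding cone2_def by blast
qed

lemma cone2_comb_iff:
  assumes "cross2 a b \<noteq> 0"
  shows "r *\<^sub>R a + s *\<^sub>R b \<in> cone2 J a b \<longleftrightarrow> r \<in> J \<and> s \<in> J"
  using assms by (simp add: cone2_iff cross2_comb)

section \<open>Polar angles and sectors\<close>

definition dir :: "real \<Rightarrow> real^2" where "dir t = vector [cos t, sin t]"

lemma dir_nth [simp]: "dir t $ 1 = cos t" "dir t $ 2 = sin t"
  by (simp_all add: dir_def)

lemma cross2_dir: "cross2 (dir s) (dir t) = sin (t - s)"
  by (simp add: cross2_def sin_diff mult.commute)

lemma norm_vec2: "norm (x :: real^2) = sqrt ((x $ 1)\<^sup>2 + (x $ 2)\<^sup>2)"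
  by (simp add: norm_vec_def L2_set_def sum_2)

lemma norm_dir [simp]: "norm (dir t) = 1"
  by (simp add: norm_vec2)

lemma arg2_bounds: "- pi < arg2 x" "arg2 x \<le> pi"
  using Arg_bounded by (auto simp: arg2_def)

lemma polar2: "x = norm x *\<^sub>R dir (arg2 x)"
proof -
  let ?z = "Complex (x $ 1) (x $ 2)"
  have n: "cmod ?z = norm x" by (simp add: norm_vec2 cmod_def)
  have "?z = of_real (norm x) * cis (arg2 x)"
    unfolding arg2_def n[symmetric] using rcis_cmod_Arg[of ?z] by (simp add: rcis_def)
  then have "x $ 1 = norm x * cos (arg2 x)" "x $ 2 = norm x * sin (arg2 x)"
    by (simp_all add: complex_eq_iff)
  then show ?thesis by (simp add: vec2_eq_iff)
qed

lemma arg2_dir: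
  assumes "r > 0" "- pi < t" "t \<le> pi"
  shows "arg2 (r *\<^sub>R dir t) = t"
proof -
  have "Complex (r * cos t) (r * sin t) = rcis r t" by (simp add: rcis_def complex_eq_iff)
  then show ?thesis using assms by (simp add: arg2_def Arg_rcis)
qed

lemma ray_eq:
  assumes "- pi < t" "t < pi"
  shows "ray t = (\<lambda>s. s *\<^sub>R dir t) ` {0<..}"
proof (intro set_eqI iffI)
  fix x assume "x \<in> ray t"
  then have "x \<noteq> 0" "arg2 x = t" by (auto simp: ray_def)
  then show "x \<in> (\<lambda>s. s *\<^sub>R dir t) ` {0<..}"
    using polar2[of x] by (metis greaterThan_iff image_eqI zero_less_norm_iff)
next
  fix x assume "x \<in> (\<lambda>s. s *\<^sub>R dir t) ` {0<..}"
  then obtain s where "s > 0" "x = s *\<^sub>R dir t" by auto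
  then show "x \<in> ray t" using arg2_dir[of s t] assms norm_dir[of t] 
    by (auto simp: ray_def simp del: norm_dir)
qed

text \<open>A reflex sector is larger than the cone over its sides; it is the complement of the
  closed cone they span. By Cramer's rule and polar coordinates both cases become sign conditions on
  \<open>sin (t - \<theta>)\<close> and \<open>sin (\<theta> - s)\<close>.\<close>

lemma sector_eq:
  assumes "- pi < s" "s < t" "t < pi" "t - s \<noteq> pi"
  shows "sector s t = (if t - s < pi then cone2 {0<..} (dir s) (dir t)
                       else - cone2 {0..} (dir s) (dir t))"
proof (rule set_eqI)
  fix x :: "real^2"
  define \<theta> where "\<theta> = arg2 x"
  have \<theta>: "- pi < \<theta>" "\<theta> \<le> pi" using arg2_bounds unfolding \<theta>_def by auto
  have nz: "sin (t - s) \<noteq> 0"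
  proof (cases "t - s < pi")
    case True
    then show ?thesis using sin_gt_zero[of "t - s"] assms by simp
  next
    case False
    then show ?thesis using sin_lt_zero[of "t - s"] assms by simp
  qed
  have c: "cross2 x (dir t) = norm x * sin (t - \<theta>)" "cross2 (dir s) x = norm x * sin (\<theta> - s)"
    using arg_cong[OF polar2[of x], of "\<lambda>y. cross2 y (dir t)"] arg_cong[OF polar2[of x], of "cross2 (dir s)"]
    unfolding \<theta>_def by (simp_all add: cross2_def sin_diff algebra_simps)
  have sinneg: "sin y \<le> 0" if "-pi \<le> y" "y \<le> 0 \<or> pi \<le> y" "y \<le> 2 * pi" for y :: real
    using that sin_ge_zero[of "-y"] sin_ge_zero[of "y - pi"] by auto
  \<comment> \<open>Differences of two angles range over two periods; the alternative below
    \<open>- pi\<close> is later ruled out by combining the two sign conditions.\<close>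
  have sinpos: "0 < y \<and> y < pi \<or> y < - pi" if "sin y > 0" "- 2 * pi \<le> y" "y < 2 * pi" for y :: real
  proof (rule ccontr)
    assume "\<not> ?thesis"
    then have "sin y \<le> 0" using that by (intro sinneg) auto
    with that show False by simp
  qed
  have nzd: "cross2 (dir s) (dir t) \<noteq> 0" using nz by (simp add: cross2_dir)
  show "x \<in> sector s t \<longleftrightarrow> x \<in> (if t - s < pi then cone2 {0<..} (dir s) (dir t)
                       else - cone2 {0..} (dir s) (dir t))"
  proof (cases "x = 0")
    case True
    then show ?thesis using cone2_iff[OF nzd, of x] by (auto simp: sector_def cross2_def)
  next
    case x: False
    then have nx: "norm x > 0" by simp
    show ?thesis
    proof (cases "t - s < pi")
      case True
      then have pos: "sin (t - s) > 0" using assms by (intro sin_gt_zero) auto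
      have "s < \<theta> \<and> \<theta> < t \<longleftrightarrow> sin (t - \<theta>) > 0 \<and> sin (\<theta> - s) > 0"
      proof
        assume "s < \<theta> \<and> \<theta> < t"
        then show "sin (t - \<theta>) > 0 \<and> sin (\<theta> - s) > 0"
          using True by (intro conjI sin_gt_zero) auto
      next
        assume "sin (t - \<theta>) > 0 \<and> sin (\<theta> - s) > 0"
        then have "0 < t - \<theta> \<and> t - \<theta> < pi \<or> t - \<theta> < - pi" "0 < \<theta> - s \<and> \<theta> - s < pi \<or> \<theta> - s < - pi"
          using sinpos[of "t - \<theta>"] sinpos[of "\<theta> - s"] \<theta> assms by simp_all
        then show "s < \<theta> \<and> \<theta> < t" using True assms by auto
      qed
      moreover have "x \<in> cone2 {0<..} (dir s) (dir t) \<longleftrightarrow> sin (t - \<theta>) > 0 \<and> sin (\<theta> - s) > 0"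
        unfolding cone2_iff[OF nzd] c cross2_dir using nx pos by (simp add: zero_less_mult_iff zero_less_divide_iff)
      ultimately show ?thesis using True x by (simp add: sector_def \<theta>_def)
    next
      case False
      then have neg: "sin (t - s) < 0" using assms by (intro sin_lt_zero) auto
      have "s < \<theta> \<and> \<theta> < t \<longleftrightarrow> \<not> (sin (t - \<theta>) \<le> 0 \<and> sin (\<theta> - s) \<le> 0)"
      proof
        assume a: "s < \<theta> \<and> \<theta> < t"
        then have "t - \<theta> < pi \<or> \<theta> - s < pi" using assms by auto
        then have "sin (t - \<theta>) > 0 \<or> sin (\<theta> - s) > 0" using a sin_gt_zero[of "t - \<theta>"] sin_gt_zero[of "\<theta> - s"] by auto
        then show "\<not> (sin (t - \<theta>) \<le> 0 \<and> sin (\<theta> - s) \<le> 0)" by auto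
      next
        assume a: "\<not> (sin (t - \<theta>) \<le> 0 \<and> sin (\<theta> - s) \<le> 0)"
        show "s < \<theta> \<and> \<theta> < t"
        proof (rule ccontr)
          assume "\<not> (s < \<theta> \<and> \<theta> < t)"
          then have "\<theta> \<le> s \<or> t \<le> \<theta>" by auto
          then have "sin (t - \<theta>) \<le> 0 \<and> sin (\<theta> - s) \<le> 0"
            using \<theta> assms False by (intro conjI sinneg) auto
          then show False using a by simp
        qed
      qed
      moreover have "x \<in> cone2 {0..} (dir s) (dir t) \<longleftrightarrow> sin (t - \<theta>) \<le> 0 \<and> sin (\<theta> - s) \<le> 0"
        unfolding cone2_iff[OF nzd] c cross2_dir using nx neg
        by (auto simp: zero_le_divide_iff mult_le_0_iff zero_le_mult_iff)
      ultimately show ?thesis using False x by (auto simp: sector_def \<theta>_def)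
    qed
  qed
qed

text \<open>Quantifies that the closed sector avoids the negative real axis: \<open>\<kappa>\<close>
  is minus the cosine of the largest absolute angle, clipped at 0, and stays below 1 because that
  angle stays below \<open>pi\<close>.\<close>

lemma sector_halfplane_bound:
  assumes "- pi < s" "t < pi"
  obtains \<kappa> where "0 \<le> \<kappa>" "\<kappa> < 1"
    "\<And>x. x = 0 \<or> s \<le> arg2 x \<and> arg2 x \<le> t \<Longrightarrow> x $ 1 \<ge> - \<kappa> * norm x"
proof
  define \<kappa> where "\<kappa> = max 0 (- cos (max 0 (max (- s) t)))"
  have b: "0 \<le> max 0 (max (- s) t)" "max 0 (max (- s) t) < pi" using assms by auto
  show "0 \<le> \<kappa>" by (simp add: \<kappa>_def)
  have "cos (max 0 (max (- s) t)) > cos pi" using b by (intro cos_monotone_0_pi) auto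
  then show "\<kappa> < 1" by (simp add: \<kappa>_def)
  fix x :: "real^2" assume x: "x = 0 \<or> s \<le> arg2 x \<and> arg2 x \<le> t"
  show "x $ 1 \<ge> - \<kappa> * norm x"
  proof (cases "x = 0")
    case False
    then have "\<bar>arg2 x\<bar> \<le> max 0 (max (- s) t)" using x by auto
    then have "cos (max 0 (max (- s) t)) \<le> cos \<bar>arg2 x\<bar>" using b by (intro cos_monotone_0_pi_le) auto
    then have "- \<kappa> \<le> cos (arg2 x)" by (simp add: \<kappa>_def)
    then have "- \<kappa> * norm x \<le> cos (arg2 x) * norm x" by (intro mult_right_mono) auto
    also have "\<dots> = x $ 1" using arg_cong[OF polar2[of x], of "\<lambda>y. y $ 1"] by simp
    finally show ?thesis .
  qed simp
qed

text \<open>Bounds the distance of \<open>x\<close> from the pole \<open>(-\<delta>, 0)\<close> from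
  below by a multiple of \<open>norm x + \<delta>\<close>. The cross term is at least
  \<open>- \<kappa>\<close> times \<open>2 * \<delta> * norm x\<close>, which in turn is at most the
  sum of the two squares.\<close>

lemma norm_shift_ge:
  assumes "0 \<le> \<kappa>" "\<kappa> < 1" "(x :: real^2) $ 1 \<ge> - \<kappa> * norm x" "\<delta> \<ge> 0"
  shows "(x $ 1 + \<delta>)\<^sup>2 + (x $ 2)\<^sup>2 \<ge> (1 - \<kappa>) / 2 * (norm x + \<delta>)\<^sup>2"
proof -
  have n: "(norm x)\<^sup>2 = (x $ 1)\<^sup>2 + (x $ 2)\<^sup>2" by (simp add: norm_vec2)
  have "2 * \<delta> * x $ 1 \<ge> 2 * \<delta> * (- \<kappa> * norm x)" using assms by (intro mult_left_mono) auto
  then have 1: "(x $ 1 + \<delta>)\<^sup>2 + (x $ 2)\<^sup>2 \<ge> (norm x)\<^sup>2 + \<delta>\<^sup>2 - \<kappa> * (2 * \<delta> * norm x)"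
    unfolding n by (simp add: power2_eq_square algebra_simps)
  have sq: "2 * \<delta> * norm x \<le> (norm x)\<^sup>2 + \<delta>\<^sup>2" using sum_squares_bound[of \<delta> "norm x"] by simp
  then have "\<kappa> * (2 * \<delta> * norm x) \<le> \<kappa> * ((norm x)\<^sup>2 + \<delta>\<^sup>2)" using assms by (intro mult_left_mono) auto
  moreover have "(1 - \<kappa>) * (2 * \<delta> * norm x) \<le> (1 - \<kappa>) * ((norm x)\<^sup>2 + \<delta>\<^sup>2)"
    using sq assms by (intro mult_left_mono) auto
  moreover have "(norm x + \<delta>)\<^sup>2 = ((norm x)\<^sup>2 + \<delta>\<^sup>2) + 2 * \<delta> * norm x"
    by (simp add: power2_eq_square algebra_simps)
  ultimately show ?thesis using 1 by (simp only: left_diff_distrib) argo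
qed

section \<open>Lebesgue measure in oblique coordinates\<close>

lemma vector_2_eq: "vector [x, y] = x *\<^sub>R axis 1 1 + y *\<^sub>R (axis 2 1 :: real^2)"
  by (simp add: vec2_eq_iff axis_def)

lemma measurable_vec2 [measurable]:
  assumes "f \<in> borel_measurable M" "g \<in> borel_measurable M"
  shows "(\<lambda>x. vector [f x, g x] :: real^2) \<in> borel_measurable M"
proof -
  have "continuous_on UNIV (\<lambda>(x, y). vector [x, y] :: real^2)"
    unfolding vector_2_eq case_prod_beta by (intro continuous_intros)
  from borel_measurable_continuous_on[OF this, of "\<lambda>x. (f x, g x)" M]
  show ?thesis using assms by (simp add: borel_prod[symmetric])
qed

lemma lborel_vec2: "(lborel :: (real^2) measure) = distr (lborel \<Otimes>\<^sub>M lborel) borel (\<lambda>(x, y). vector [x, y])"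
proof (rule lborel_eqI)
  have [measurable]: "(\<lambda>(x, y). vector [x, y] :: real^2) \<in> borel_measurable (lborel \<Otimes>\<^sub>M lborel)"
    unfolding case_prod_beta by measurable
  fix l u :: "real^2"
  assume lu: "\<And>b. b \<in> Basis \<Longrightarrow> l \<bullet> b \<le> u \<bullet> b"
  have ab: "axis 1 1 \<noteq> (axis 2 1 :: real^2)" by (simp add: axis_eq_axis)
  have Basis: "(Basis :: (real^2) set) = {axis 1 1, axis 2 1}"
    by (auto simp: Basis_vec_def) (metis exhaust_2)
  have lu: "l $ 1 \<le> u $ 1" "l $ 2 \<le> u $ 2"
    using lu[of "axis 1 1"] lu[of "axis 2 1"] by (auto simp: Basis inner_axis)
  have "(\<lambda>(x, y). vector [x, y] :: real^2) -` box l u \<inter> space (lborel \<Otimes>\<^sub>M lborel)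
      = {l $ 1<..<u $ 1} \<times> {l $ 2<..<u $ 2}"
    by (auto simp: box_def Basis inner_axis space_pair_measure)
  then have "emeasure (distr (lborel \<Otimes>\<^sub>M lborel) borel (\<lambda>(x, y). vector [x, y])) (box l u)
      = emeasure (lborel \<Otimes>\<^sub>M lborel) ({l $ 1<..<u $ 1} \<times> {l $ 2<..<u $ 2})"
    by (subst emeasure_distr) auto
  also have "\<dots> = ennreal (u $ 1 - l $ 1) * ennreal (u $ 2 - l $ 2)"
    using lu by (subst lborel.emeasure_pair_measure_Times) auto
  also have "\<dots> = ennreal (\<Prod>b\<in>Basis. (u - l) \<bullet> b)"
    using lu ab by (simp add: Basis inner_axis ennreal_mult inner_diff_left)
  finally show "emeasure (distr (lborel \<Otimes>\<^sub>M lborel) borel (\<lambda>(x, y). vector [x, y])) (box l u)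
      = ennreal (\<Prod>b\<in>Basis. (u - l) \<bullet> b)" .
qed simp

lemma nn_integral_lborel_vec2:
  assumes [measurable]: "f \<in> borel_measurable borel"
  shows "(\<integral>\<^sup>+x. f x \<partial>(lborel :: (real^2) measure)) = (\<integral>\<^sup>+x. \<integral>\<^sup>+y. f (vector [x, y]) \<partial>lborel \<partial>lborel)"
  by (subst lborel_vec2, subst nn_integral_distr)
    (simp_all add: lborel.nn_integral_fst[symmetric])

text \<open>The linear substitution is factored into two one-dimensional affine ones with Fubini in
  between. The factorisation divides by the first coordinate of \<open>a\<close>; if that is 0, the
  roles of \<open>a\<close> and \<open>b\<close> are exchanged.\<close>

lemma nn_integral_lborel_coords:
  fixes a b :: "real^2"
  assumes D: "cross2 a b \<noteq> 0" and f: "f \<in> borel_measurable borel"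
  shows "(\<integral>\<^sup>+x. f x \<partial>lborel) = ennreal \<bar>cross2 a b\<bar> * (\<integral>\<^sup>+r. \<integral>\<^sup>+s. f (r *\<^sub>R a + s *\<^sub>R b) \<partial>lborel \<partial>lborel)"
proof -
  note [measurable] = f
  have Fub: "(\<integral>\<^sup>+x. \<integral>\<^sup>+y. g x y \<partial>lborel \<partial>lborel) = (\<integral>\<^sup>+y. \<integral>\<^sup>+x. g x y \<partial>lborel \<partial>lborel)"
    if [measurable]: "(\<lambda>(x, y). g x y) \<in> borel_measurable (lborel \<Otimes>\<^sub>M lborel)" for g :: "real \<Rightarrow> real \<Rightarrow> ennreal"
    using lborel_pair.Fubini'[of g] that by simp
  have *: "(\<integral>\<^sup>+x. f x \<partial>lborel) = ennreal \<bar>cross2 a b\<bar> * (\<integral>\<^sup>+s. \<integral>\<^sup>+r. f (r *\<^sub>R a + s *\<^sub>R b) \<partial>lborel \<partial>lborel)"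
    if a1: "a $ 1 \<noteq> 0" and D: "cross2 a b \<noteq> 0" for a b :: "real^2"
  proof -
    \<comment> \<open>For the point \<open>r a + s b\<close> with first coordinate \<open>x\<close>,
      the second coordinate is \<open>?k * x + ?d * s\<close>. Substituting for the second
      coordinate at fixed \<open>x\<close> gives the factor \<open>?d\<close>, then for
      \<open>x\<close> at fixed \<open>s\<close> the factor \<open>a $ 1\<close>; their product is
      the determinant.\<close>
    let ?k = "a $ 2 / a $ 1" and ?d = "cross2 a b / a $ 1"
    have "(\<integral>\<^sup>+x. f x \<partial>lborel) = (\<integral>\<^sup>+x. \<integral>\<^sup>+y. f (vector [x, y]) \<partial>lborel \<partial>lborel)"
      by (rule nn_integral_lborel_vec2) measurable
    also have "\<dots> = (\<integral>\<^sup>+x. ennreal \<bar>?d\<bar> * (\<integral>\<^sup>+s. f (vector [x, ?k * x + ?d * s]) \<partial>lborel) \<partial>lborel)"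
      using a1 D by (intro nn_integral_cong nn_integral_real_affine) simp_all
    also have "\<dots> = ennreal \<bar>?d\<bar> * (\<integral>\<^sup>+x. \<integral>\<^sup>+s. f (vector [x, ?k * x + ?d * s]) \<partial>lborel \<partial>lborel)"
      by (rule nn_integral_cmult) measurable
    also have "(\<integral>\<^sup>+x. \<integral>\<^sup>+s. f (vector [x, ?k * x + ?d * s]) \<partial>lborel \<partial>lborel)
       = (\<integral>\<^sup>+s. \<integral>\<^sup>+x. f (vector [x, ?k * x + ?d * s]) \<partial>lborel \<partial>lborel)"
      by (rule Fub) measurable
    also have "\<dots> = (\<integral>\<^sup>+s. ennreal \<bar>a $ 1\<bar> * (\<integral>\<^sup>+r. f (vector [b $ 1 * s + a $ 1 * r, ?k * (b $ 1 * s + a $ 1 * r) + ?d * s]) \<partial>lborel) \<partial>lborel)"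
      using a1 by (intro nn_integral_cong nn_integral_real_affine) simp_all
    also have "\<dots> = ennreal \<bar>a $ 1\<bar> * (\<integral>\<^sup>+s. \<integral>\<^sup>+r. f (vector [b $ 1 * s + a $ 1 * r, ?k * (b $ 1 * s + a $ 1 * r) + ?d * s]) \<partial>lborel \<partial>lborel)"
      by (rule nn_integral_cmult) measurable
    also have "(\<lambda>s r. f (vector [b $ 1 * s + a $ 1 * r, ?k * (b $ 1 * s + a $ 1 * r) + ?d * s]))
       = (\<lambda>s r. f (r *\<^sub>R a + s *\<^sub>R b))"
    proof (intro ext arg_cong[where f=f])
      fix s r
      show "vector [b $ 1 * s + a $ 1 * r, ?k * (b $ 1 * s + a $ 1 * r) + ?d * s] = r *\<^sub>R a + s *\<^sub>R b"
        using a1 by (simp add: vec2_eq_iff cross2_def field_simps)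
    qed
    also have "ennreal \<bar>?d\<bar> * (ennreal \<bar>a $ 1\<bar> * (\<integral>\<^sup>+s. \<integral>\<^sup>+r. f (r *\<^sub>R a + s *\<^sub>R b) \<partial>lborel \<partial>lborel))
      = ennreal \<bar>cross2 a b\<bar> * (\<integral>\<^sup>+s. \<integral>\<^sup>+r. f (r *\<^sub>R a + s *\<^sub>R b) \<partial>lborel \<partial>lborel)"
      using a1 by (simp add: mult.assoc[symmetric] ennreal_mult[symmetric] abs_mult)
    finally show ?thesis .
  qed
  show ?thesis
  proof (cases "a $ 1 = 0")
    case False
    have "(\<integral>\<^sup>+s. \<integral>\<^sup>+r. f (r *\<^sub>R a + s *\<^sub>R b) \<partial>lborel \<partial>lborel)
        = (\<integral>\<^sup>+r. \<integral>\<^sup>+s. f (r *\<^sub>R a + s *\<^sub>R b) \<partial>lborel \<partial>lborel)"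
      by (rule Fub) measurable
    then show ?thesis using *[OF False D] by simp
  next
    case True
    then have "b $ 1 \<noteq> 0" "cross2 b a \<noteq> 0" using D by (auto simp: cross2_def)
    from *[OF this] show ?thesis by (simp add: cross2_def add.commute abs_minus_commute mult.commute)
  qed
qed

lemma lborel_coords:
  fixes a b :: "real^2"
  assumes D: "cross2 a b \<noteq> 0"
  shows "lborel = density (distr (lborel \<Otimes>\<^sub>M lborel) borel (\<lambda>(r, s). r *\<^sub>R a + s *\<^sub>R b)) (\<lambda>_. ennreal \<bar>cross2 a b\<bar>)"
    (is "_ = density ?M _")
proof (rule measure_eqI)
  fix A :: "(real^2) set" assume "A \<in> sets lborel"
  then have A [measurable]: "A \<in> sets borel" by simp
  have m [measurable]: "(\<lambda>(r, s). r *\<^sub>R a + s *\<^sub>R b) \<in> measurable (lborel \<Otimes>\<^sub>M lborel) borel"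
    by measurable
  have "emeasure lborel A = (\<integral>\<^sup>+x. indicator A x \<partial>lborel)" by simp
  also have "\<dots> = ennreal \<bar>cross2 a b\<bar> * (\<integral>\<^sup>+r. \<integral>\<^sup>+s. indicator A (r *\<^sub>R a + s *\<^sub>R b) \<partial>lborel \<partial>lborel)"
    by (rule nn_integral_lborel_coords[OF D]) measurable
  also have "(\<integral>\<^sup>+r. \<integral>\<^sup>+s. indicator A (r *\<^sub>R a + s *\<^sub>R b) \<partial>lborel \<partial>lborel) = (\<integral>\<^sup>+x. indicator A x \<partial>?M)"
    by (subst nn_integral_distr) (simp_all add: lborel.nn_integral_fst[symmetric])
  also have "ennreal \<bar>cross2 a b\<bar> * (\<integral>\<^sup>+x. indicator A x \<partial>?M) = emeasure (density ?M (\<lambda>_. ennreal \<bar>cross2 a b\<bar>)) A"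
    by (simp add: emeasure_density nn_integral_cmult)
  finally show "emeasure lborel A = emeasure (density ?M (\<lambda>_. ennreal \<bar>cross2 a b\<bar>)) A" .
qed simp

lemma integral_lborel_coords:
  fixes a b :: "real^2" and f :: "real^2 \<Rightarrow> complex"
  assumes D: "cross2 a b \<noteq> 0" and f: "integrable lborel f"
  shows "(LINT x|lborel. f x) = \<bar>cross2 a b\<bar> *\<^sub>R (LINT s|lborel. LINT r|lborel. f (r *\<^sub>R a + s *\<^sub>R b))"
proof -
  let ?M = "distr (lborel \<Otimes>\<^sub>M lborel) borel (\<lambda>(r, s). r *\<^sub>R a + s *\<^sub>R b)"
  have fm [measurable]: "f \<in> borel_measurable borel" using f by auto
  have m [measurable]: "(\<lambda>(r, s). r *\<^sub>R a + s *\<^sub>R b) \<in> measurable (lborel \<Otimes>\<^sub>M lborel) borel"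
    by measurable
  have "integrable (density ?M (\<lambda>_. ennreal \<bar>cross2 a b\<bar>)) f" using f lborel_coords[OF D] by simp
  then have "integrable ?M (\<lambda>x. \<bar>cross2 a b\<bar> *\<^sub>R f x)" by (subst (asm) integrable_density) auto
  then have "integrable ?M (\<lambda>x. (1 / \<bar>cross2 a b\<bar>) *\<^sub>R (\<bar>cross2 a b\<bar> *\<^sub>R f x))"
    by (rule integrable_scaleR_right)
  then have "integrable ?M f" using D by simp
  then have i: "integrable (lborel \<Otimes>\<^sub>M lborel) (\<lambda>(r, s). f (r *\<^sub>R a + s *\<^sub>R b))"
    by (subst (asm) integrable_distr_eq) (auto simp: split_def)
  have "(LINT x|lborel. f x) = (LINT x|density ?M (\<lambda>_. ennreal \<bar>cross2 a b\<bar>). f x)"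
    using lborel_coords[OF D] by simp
  also have "\<dots> = \<bar>cross2 a b\<bar> *\<^sub>R (LINT x|?M. f x)"
    by (subst integral_density) auto
  also have "(LINT x|?M. f x) = (LINT (r, s)|(lborel \<Otimes>\<^sub>M lborel). f (r *\<^sub>R a + s *\<^sub>R b))"
    by (subst integral_distr) (auto simp: split_def)
  also have "\<dots> = (LINT s|lborel. LINT r|lborel. f (r *\<^sub>R a + s *\<^sub>R b))"
    using lborel_pair.integral_snd[OF i] by simp
  finally show ?thesis .
qed

lemma integrable_continuous_compact_supp:
  fixes f :: "real^2 \<Rightarrow> complex"
  assumes "continuous_on UNIV f" "compact K" "\<And>x. x \<notin> K \<Longrightarrow> f x = 0"
  shows "integrable lborel f"
proof -
  have "integrable lborel (\<lambda>x. indicator K x *\<^sub>R f x)"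
    using assms by (intro borel_integrable_compact) (auto intro: continuous_on_subset)
  also have "(\<lambda>x. indicator K x *\<^sub>R f x) = f" using assms(3) by (auto simp: indicator_def)
  finally show ?thesis .
qed

section \<open>Integration by parts on sectors\<close>

lemma integral_halfline_deriv:
  fixes g g' :: "real \<Rightarrow> complex"
  assumes d: "\<And>r. (g has_vector_derivative g' r) (at r)" and c: "continuous_on UNIV g'"
    and z: "\<And>r. \<bar>r\<bar> \<ge> R \<Longrightarrow> g r = 0" and z': "\<And>r. \<bar>r\<bar> \<ge> R \<Longrightarrow> g' r = 0" and R: "R > 0"
  shows "J = {0..} \<or> J = {0<..} \<Longrightarrow> (LINT r|lborel. indicator J r *\<^sub>R g' r) = - g 0"
    and "(LINT r|lborel. g' r) = 0"
proof -
  have FTC: "(LINT r|lborel. indicator {l..R} r *\<^sub>R g' r) = g R - g l" if "l \<le> R" for l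
    using has_bochner_integral_FTC_Icc[OF that, of g g'] d c
    by (intro has_bochner_integral_integral_eq) (auto intro: has_vector_derivative_at_within continuous_on_subset)
  have "(LINT r|lborel. indicator J r *\<^sub>R g' r) = (LINT r|lborel. indicator {0..R} r *\<^sub>R g' r)" if J: "J = {0..} \<or> J = {0<..}"
  proof (rule integral_cong_AE)
    have "AE r in lborel. r \<noteq> (0::real)" by (rule AE_lborel_singleton)
    then show "AE r in lborel. indicator J r *\<^sub>R g' r = indicator {0..R} r *\<^sub>R g' r"
      by (rule AE_mp) (intro AE_I2 impI, use J z' in \<open>auto simp: indicator_def\<close>)
    have [measurable]: "g' \<in> borel_measurable borel" using c by (rule borel_measurable_continuous_onI)
    have [measurable]: "J \<in> sets borel" using J by auto
    show "(\<lambda>r. indicat_real J r *\<^sub>R g' r) \<in> borel_measurable lborel"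
      "(\<lambda>r. indicat_real {0..R} r *\<^sub>R g' r) \<in> borel_measurable lborel" by measurable
  qed
  then show "J = {0..} \<or> J = {0<..} \<Longrightarrow> (LINT r|lborel. indicator J r *\<^sub>R g' r) = - g 0"
    using FTC[of 0] z[of R] R by simp
  have "(LINT r|lborel. g' r) = (LINT r|lborel. indicator {-R..R} r *\<^sub>R g' r)"
    using z' by (intro Bochner_Integration.integral_cong) (auto simp: indicator_def abs_if)
  then show "(LINT r|lborel. g' r) = 0" using FTC[of "-R"] R z by simp
qed

definition dderiv :: "real^2 \<Rightarrow> (real^2 \<Rightarrow> complex) \<Rightarrow> real^2 \<Rightarrow> complex" where
  "dderiv a f x = (\<Sum>i\<in>UNIV. a $ i *\<^sub>R pderiv_at i f x)"

lemma dderiv_linear: "dderiv (r *\<^sub>R a + s *\<^sub>R b) f x = r *\<^sub>R dderiv a f x + s *\<^sub>R dderiv b f x"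
  by (simp add: dderiv_def sum_2 algebra_simps)

lemma dderiv_axis: "dderiv (axis i 1) f x = pderiv_at i f x"
  by (simp add: dderiv_def axis_def if_distrib[of "\<lambda>c. c *\<^sub>R _"] cong: if_cong)

lemma has_vector_derivative_dderiv:
  assumes "C_k (Suc 0) f"
  shows "((\<lambda>r. f (r *\<^sub>R a + y)) has_vector_derivative dderiv a f (r *\<^sub>R a + y)) (at r)"
proof -
  have 1: "((\<lambda>r. r *\<^sub>R a + y) has_derivative (\<lambda>h. h *\<^sub>R a)) (at r)"
    by (auto intro!: derivative_eq_intros)
  have 2: "(f has_derivative (\<lambda>h. \<Sum>i\<in>UNIV. h $ i *\<^sub>R pderiv_at i f (r *\<^sub>R a + y))) (at (r *\<^sub>R a + y))"
    using assms by (intro has_derivative_pderiv_at) simp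
  show ?thesis
    using has_derivative_compose[OF 1 2]
    by (simp add: has_vector_derivative_def dderiv_def scaleR_sum_right)
qed

lemma continuous_dderiv:
  assumes "C_k (Suc 0) f" shows "continuous_on UNIV (dderiv a f)"
  unfolding dderiv_def[abs_def] using assms by (intro continuous_intros) simp

lemma dderiv_outside_supp: "x \<notin> supp f \<Longrightarrow> dderiv a f x = 0"
  by (simp add: dderiv_def pderiv_at_outside_supp)

lemma outside_supp: "x \<notin> supp f \<Longrightarrow> f x = 0"
  using closure_subset[of "{x. f x \<noteq> 0}"] by (auto simp: supp_def)

lemma line_leaves_compact:
  fixes a b :: "real^2"
  assumes "a \<noteq> 0" "compact K"
  obtains R where "R > 0" "\<And>r. \<bar>r\<bar> \<ge> R \<Longrightarrow> r *\<^sub>R a + y \<notin> K"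
proof -
  obtain B where B: "B > 0" "\<And>x. x \<in> K \<Longrightarrow> norm x \<le> B"
    using compact_imp_bounded[OF assms(2)] unfolding bounded_pos by auto
  show ?thesis
  proof
    show "(B + norm y + 1) / norm a > 0" using B assms(1) by (simp add: add_pos_nonneg)
    fix r assume "\<bar>r\<bar> \<ge> (B + norm y + 1) / norm a"
    then have "\<bar>r\<bar> * norm a \<ge> B + norm y + 1" using assms(1) by (simp add: field_simps)
    moreover have "norm (r *\<^sub>R a) \<le> norm (r *\<^sub>R a + y) + norm y"
      using norm_triangle_ineq4[of "r *\<^sub>R a + y" y] by simp
    ultimately have "norm (r *\<^sub>R a + y) > B" by simp
    then show "r *\<^sub>R a + y \<notin> K" using B(2) by force
  qed
qed

lemma borel_cone2:
  assumes D: "cross2 a b \<noteq> 0" and J: "J \<in> sets borel"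
  shows "cone2 J a b \<in> sets borel"
proof -
  have "cone2 J a b = (\<lambda>x. cross2 x b / cross2 a b) -` J \<inter> (\<lambda>x. cross2 a x / cross2 a b) -` J"
    using cone2_iff[OF D] by auto
  moreover have "(\<lambda>x. cross2 x b / cross2 a b) \<in> borel_measurable borel"
    "(\<lambda>x. cross2 a x / cross2 a b) \<in> borel_measurable borel" 
    unfolding cross2_def by (intro borel_measurable_continuous_onI continuous_intros; use D in \<open>simp add: cross2_def\<close>)+
  ultimately show ?thesis
    using measurable_sets_borel[OF _ J] by auto
qed

text \<open>In the coordinates \<open>r a + s b\<close> the derivative along \<open>a\<close> is the
  one in \<open>r\<close>, so the inner integral leaves only the value at \<open>r = 0\<close>, that
  is, on the ray along \<open>b\<close>. The integral over the plane is needed to pass to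
  complements of cones.\<close>

lemma integral_dderiv_cone:
  fixes a b :: "real^2"
  assumes D: "cross2 a b \<noteq> 0" and G: "C_k (Suc 0) G" "compact (supp G)"
  shows "J = {0..} \<or> J = {0<..} \<Longrightarrow> (LINT x|lborel. indicator (cone2 J a b) x *\<^sub>R dderiv a G x)
           = - (\<bar>cross2 a b\<bar> *\<^sub>R (LINT s|lborel. indicator J s *\<^sub>R G (s *\<^sub>R b)))"
    and "(LINT x|lborel. dderiv a G x) = 0"
proof -
  have a: "a \<noteq> 0" using D by (auto simp: cross2_def)
  have int: "integrable lborel (dderiv a G)"
    by (rule integrable_continuous_compact_supp[OF continuous_dderiv[OF G(1)] G(2)]) (rule dderiv_outside_supp)
  have one: "(LINT r|lborel. indicator J r *\<^sub>R dderiv a G (r *\<^sub>R a + y)) = - G y" 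
    if J: "J = {0..} \<or> J = {0<..}" for y J
  proof -
    obtain R where R: "R > 0" "\<And>r. \<bar>r\<bar> \<ge> R \<Longrightarrow> r *\<^sub>R a + y \<notin> supp G"
      using line_leaves_compact[OF a G(2)] by blast
    have "continuous_on UNIV (\<lambda>r. dderiv a G (r *\<^sub>R a + y))"
      by (rule continuous_on_compose2[OF continuous_dderiv[OF G(1)]]) (auto intro!: continuous_intros)
    from integral_halfline_deriv(1)[OF has_vector_derivative_dderiv[OF G(1)] this _ _ R(1) J]
    show ?thesis using R(2) by (simp add: dderiv_outside_supp outside_supp)
  qed
  have all: "(LINT r|lborel. dderiv a G (r *\<^sub>R a + y)) = 0" for y
  proof -
    obtain R where R: "R > 0" "\<And>r. \<bar>r\<bar> \<ge> R \<Longrightarrow> r *\<^sub>R a + y \<notin> supp G"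
      using line_leaves_compact[OF a G(2)] by blast
    have "continuous_on UNIV (\<lambda>r. dderiv a G (r *\<^sub>R a + y))"
      by (rule continuous_on_compose2[OF continuous_dderiv[OF G(1)]]) (auto intro!: continuous_intros)
    from integral_halfline_deriv(2)[OF has_vector_derivative_dderiv[OF G(1)] this _ _ R(1)]
    show ?thesis using R(2) by (simp add: dderiv_outside_supp outside_supp)
  qed
  show "(LINT x|lborel. dderiv a G x) = 0"
    by (subst integral_lborel_coords[OF D int]) (simp add: all)
  assume J: "J = {0..} \<or> J = {0<..}"
  have [measurable]: "J \<in> sets borel" using J by auto
  have "cone2 J a b \<in> sets borel" by (rule borel_cone2[OF D]) measurable
  then have int': "integrable lborel (\<lambda>x. indicator (cone2 J a b) x *\<^sub>R dderiv a G x)"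
    using int by (intro integrable_mult_indicator) auto
  have "(LINT x|lborel. indicator (cone2 J a b) x *\<^sub>R dderiv a G x)
    = \<bar>cross2 a b\<bar> *\<^sub>R (LINT s|lborel. LINT r|lborel. indicator (cone2 J a b) (r *\<^sub>R a + s *\<^sub>R b) *\<^sub>R dderiv a G (r *\<^sub>R a + s *\<^sub>R b))"
    by (rule integral_lborel_coords[OF D int'])
  also have "(\<lambda>s r. indicator (cone2 J a b) (r *\<^sub>R a + s *\<^sub>R b) *\<^sub>R dderiv a G (r *\<^sub>R a + s *\<^sub>R b))
     = (\<lambda>s r. indicat_real J s *\<^sub>R (indicat_real J r *\<^sub>R dderiv a G (r *\<^sub>R a + s *\<^sub>R b)))"
    by (intro ext) (auto simp: indicator_def cone2_comb_iff[OF D])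
  finally show "(LINT x|lborel. indicator (cone2 J a b) x *\<^sub>R dderiv a G x)
           = - (\<bar>cross2 a b\<bar> *\<^sub>R (LINT s|lborel. indicator J s *\<^sub>R G (s *\<^sub>R b)))"
    by (simp add: one[OF J] del: scaleR_scaleR)
qed

lemma cone2_commute: "cone2 J a b = cone2 J b a"
  by (auto simp: cone2_def) (metis add.commute)+

lemma cross2_commute: "cross2 b a = - cross2 a b"
  by (simp add: cross2_def)

text \<open>The divergence theorem on a sector, reduced to an estimate: it will be applied to
  differences of approximants, whose boundary terms need only be small. A coordinate direction is
  expanded in \<open>a\<close> and \<open>b\<close>, and each of these derivatives contributes an
  integral over the other side.\<close>

lemma divergence_bound_cone:
  fixes a b :: "real^2"
  assumes D: "cross2 a b \<noteq> 0" and W: "W = cone2 {0<..} a b \<or> W = - cone2 {0..} a b"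
  obtains C where "C \<ge> 0" "\<And>G k. C_k (Suc 0) G \<Longrightarrow> compact (supp G) \<Longrightarrow>
     ennreal (norm (LINT x|lborel. indicator W x *\<^sub>R pderiv_at k G x)) \<le>
     ennreal C * ((\<integral>\<^sup>+s\<in>{0<..}. norm (G (s *\<^sub>R a)) \<partial>lborel) + (\<integral>\<^sup>+s\<in>{0<..}. norm (G (s *\<^sub>R b)) \<partial>lborel))"
proof
  \<comment> \<open>In the constant \<open>C\<close> below, the coefficients of both coordinate
    directions are summed, so that it does not depend on \<open>k\<close>.\<close>
  let ?D = "\<bar>cross2 a b\<bar>"
  let ?\<alpha> = "\<lambda>k. cross2 (axis k 1) b / cross2 a b" and ?\<beta> = "\<lambda>k. cross2 a (axis k 1) / cross2 a b"
  define C where "C = ?D * (\<Sum>k\<in>UNIV. \<bar>?\<alpha> k\<bar> + \<bar>?\<beta> k\<bar>)"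
  show C0: "C \<ge> 0" by (auto simp: C_def intro!: mult_nonneg_nonneg sum_nonneg)
  fix G :: "real^2 \<Rightarrow> complex" and k :: 2
  assume G: "C_k (Suc 0) G" "compact (supp G)"
  let ?I = "\<lambda>c. (\<integral>\<^sup>+s\<in>{0<..}. norm (G (s *\<^sub>R c)) \<partial>lborel)"
  have int: "integrable lborel (dderiv c G)" for c
    by (rule integrable_continuous_compact_supp[OF continuous_dderiv[OF G(1)] G(2)]) (rule dderiv_outside_supp)
  have D': "cross2 b a \<noteq> 0" using D cross2_commute[of b a] by simp
  have int': "integrable lborel (\<lambda>x. indicator (cone2 J a b) x *\<^sub>R dderiv c G x)" if "J = {0..} \<or> J = {0<..}" for J c
    using int borel_cone2[OF D, of J] that by (intro integrable_mult_indicator) auto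
  have bd: "ennreal (norm (LINT s|lborel. indicator J s *\<^sub>R G (s *\<^sub>R c))) \<le> ?I c" if J: "J = {0..} \<or> J = {0<..}" for J c
  proof -
    \<comment> \<open>The Bochner integral of a non-integrable function is 0, so the bound holds in
      either case.\<close>
    have "ennreal (norm (LINT s|lborel. indicator J s *\<^sub>R G (s *\<^sub>R c))) \<le> (\<integral>\<^sup>+s. norm (indicator J s *\<^sub>R G (s *\<^sub>R c)) \<partial>lborel)"
      using integral_norm_bound_ennreal[of lborel "\<lambda>s. indicator J s *\<^sub>R G (s *\<^sub>R c)"]
      by (cases "integrable lborel (\<lambda>s. indicator J s *\<^sub>R G (s *\<^sub>R c))") (auto simp: not_integrable_integral_eq)
    also have "\<dots> = ?I c"
    proof (rule nn_integral_cong_AE)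
      have "AE r in lborel. r \<noteq> (0::real)" by (rule AE_lborel_singleton)
      then show "AE s in lborel. ennreal (norm (indicator J s *\<^sub>R G (s *\<^sub>R c))) = ennreal (norm (G (s *\<^sub>R c))) * indicator {0<..} s"
        by (rule AE_mp) (intro AE_I2 impI, use J in \<open>auto simp: indicator_def\<close>)
    qed
    finally show ?thesis .
  qed
  \<comment> \<open>For a reflex sector \<open>\<sigma> = -1\<close>: the derivative integrates to 0
    over the plane, so passing to the complementary cone only changes the sign.\<close>
  obtain J \<sigma> where J: "J = {0..} \<or> J = {0<..}" and s: "\<bar>\<sigma>\<bar> = (1::real)" and Wm: "W \<in> sets borel"
    and Wc: "\<And>c. c \<in> {a, b} \<Longrightarrow> (LINT x|lborel. indicator W x *\<^sub>R dderiv c G x)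
      = \<sigma> *\<^sub>R (LINT x|lborel. indicator (cone2 J a b) x *\<^sub>R dderiv c G x)"
  proof (cases "W = cone2 {0<..} a b")
    case True
    show ?thesis
      by (rule that[of "{0<..}" 1]) (use True borel_cone2[OF D, of "{0<..}"] in auto)
  next
    case False
    then have W: "W = - cone2 {0..} a b" using W by simp
    have "(LINT x|lborel. indicator W x *\<^sub>R dderiv c G x) = - (LINT x|lborel. indicator (cone2 {0..} a b) x *\<^sub>R dderiv c G x)"
      if "(LINT x|lborel. dderiv c G x) = 0" for c
    proof -
      have "(\<lambda>x. indicator W x *\<^sub>R dderiv c G x) = (\<lambda>x. dderiv c G x - indicator (cone2 {0..} a b) x *\<^sub>R dderiv c G x)"
        by (auto simp: W indicator_def)
      then show ?thesis using int[of c] int'[of "{0..}" c] that by simp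
    qed
    then show ?thesis
      using integral_dderiv_cone(2)[OF D G] integral_dderiv_cone(2)[OF D' G] borel_cone2[OF D, of "{0..}"]
      by (intro that[of "{0..}" "-1"]) (auto simp: W)
  qed
  have intW: "integrable lborel (\<lambda>x. indicator W x *\<^sub>R dderiv c G x)" for c
    using int Wm by (intro integrable_mult_indicator) auto
  have A: "ennreal (norm (LINT x|lborel. indicator W x *\<^sub>R dderiv a G x)) \<le> ennreal ?D * ?I b"
    using bd[OF J, of b] s by (simp add: Wc integral_dderiv_cone(1)[OF D G J] ennreal_mult mult_left_mono abs_mult)
  have B: "ennreal (norm (LINT x|lborel. indicator W x *\<^sub>R dderiv b G x)) \<le> ennreal ?D * ?I a"
    using bd[OF J, of a] s integral_dderiv_cone(1)[OF D' G J]
    by (simp add: Wc cone2_commute[of J b a] cross2_commute[of b a] ennreal_mult mult_left_mono abs_mult)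
  have "(LINT x|lborel. indicator W x *\<^sub>R pderiv_at k G x) = 
      (LINT x|lborel. ?\<alpha> k *\<^sub>R (indicator W x *\<^sub>R dderiv a G x) + ?\<beta> k *\<^sub>R (indicator W x *\<^sub>R dderiv b G x))"
  proof (rule Bochner_Integration.integral_cong)
    fix x
    have "pderiv_at k G x = dderiv (?\<alpha> k *\<^sub>R a + ?\<beta> k *\<^sub>R b) G x"
      using cross2_coords[OF D, of "axis k 1"] dderiv_axis by metis
    also have "\<dots> = ?\<alpha> k *\<^sub>R dderiv a G x + ?\<beta> k *\<^sub>R dderiv b G x" by (rule dderiv_linear)
    finally show "indicator W x *\<^sub>R pderiv_at k G x = ?\<alpha> k *\<^sub>R (indicator W x *\<^sub>R dderiv a G x) + ?\<beta> k *\<^sub>R (indicator W x *\<^sub>R dderiv b G x)"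
      by (simp add: scaleR_right_distrib mult.commute)
  qed simp
  also have "\<dots> = ?\<alpha> k *\<^sub>R (LINT x|lborel. indicator W x *\<^sub>R dderiv a G x) + ?\<beta> k *\<^sub>R (LINT x|lborel. indicator W x *\<^sub>R dderiv b G x)"
    by (subst Bochner_Integration.integral_add) (use intW in \<open>simp_all del: scaleR_scaleR\<close>)
  finally have eq: "(LINT x|lborel. indicator W x *\<^sub>R pderiv_at k G x)
     = ?\<alpha> k *\<^sub>R (LINT x|lborel. indicator W x *\<^sub>R dderiv a G x) + ?\<beta> k *\<^sub>R (LINT x|lborel. indicator W x *\<^sub>R dderiv b G x)" .
  have "norm (LINT x|lborel. indicator W x *\<^sub>R pderiv_at k G x)
     \<le> \<bar>?\<alpha> k\<bar> * norm (LINT x|lborel. indicator W x *\<^sub>R dderiv a G x) + \<bar>?\<beta> k\<bar> * norm (LINT x|lborel. indicator W x *\<^sub>R dderiv b G x)"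
    unfolding eq norm_scaleR[symmetric] by (rule norm_triangle_ineq)
  then have "ennreal (norm (LINT x|lborel. indicator W x *\<^sub>R pderiv_at k G x))
     \<le> ennreal \<bar>?\<alpha> k\<bar> * ennreal (norm (LINT x|lborel. indicator W x *\<^sub>R dderiv a G x)) + ennreal \<bar>?\<beta> k\<bar> * ennreal (norm (LINT x|lborel. indicator W x *\<^sub>R dderiv b G x))"
    by (subst (1 2) ennreal_mult[symmetric], simp_all del: ennreal_plus add: ennreal_plus[symmetric] ennreal_leI)
  also have "\<dots> \<le> ennreal \<bar>?\<alpha> k\<bar> * (ennreal ?D * ?I b) + ennreal \<bar>?\<beta> k\<bar> * (ennreal ?D * ?I a)"
    by (intro add_mono mult_left_mono A B) auto
  also have "\<dots> = ennreal (\<bar>?\<alpha> k\<bar> * ?D) * ?I b + ennreal (\<bar>?\<beta> k\<bar> * ?D) * ?I a"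
    by (simp only: ennreal_mult abs_ge_zero mult.assoc)
  also have "\<dots> \<le> ennreal C * ?I b + ennreal C * ?I a"
  proof (intro add_mono mult_right_mono ennreal_leI)
    have k: "\<bar>?\<alpha> k\<bar> + \<bar>?\<beta> k\<bar> \<le> (\<Sum>k\<in>UNIV. \<bar>?\<alpha> k\<bar> + \<bar>?\<beta> k\<bar>)"
      by (rule member_le_sum) auto
    then have k': "\<bar>?\<alpha> k\<bar> \<le> (\<Sum>k\<in>UNIV. \<bar>?\<alpha> k\<bar> + \<bar>?\<beta> k\<bar>)" "\<bar>?\<beta> k\<bar> \<le> (\<Sum>k\<in>UNIV. \<bar>?\<alpha> k\<bar> + \<bar>?\<beta> k\<bar>)"
      by linarith+
    show "\<bar>?\<alpha> k\<bar> * ?D \<le> C" "\<bar>?\<beta> k\<bar> * ?D \<le> C"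
      unfolding C_def mult.commute[of ?D] by (intro mult_right_mono k' abs_ge_zero)+
  qed auto
  finally show "ennreal (norm (LINT x|lborel. indicator W x *\<^sub>R pderiv_at k G x)) \<le> ennreal C * (?I a + ?I b)"
    by (simp add: distrib_left add.commute)
qed

section \<open>Square integrable functions and the geometry of a corner\<close>

lemma tendsto_0_le_ennreal:
  fixes f g :: "nat \<Rightarrow> ennreal"
  assumes "g \<longlonglongrightarrow> 0" "\<And>n. f n \<le> g n" shows "f \<longlonglongrightarrow> 0"
  by (rule tendsto_sandwich[OF _ _ tendsto_const assms(1)]) (intro always_eventually allI assms(2) zero_le)+

lemma tendsto_power2_0_ennreal:
  fixes f :: "nat \<Rightarrow> ennreal"
  assumes "(\<lambda>n. (f n)\<^sup>2) \<longlonglongrightarrow> 0" shows "f \<longlonglongrightarrow> 0"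
proof (rule order_tendstoI)
  fix y :: ennreal assume "0 < y"
  then have "0 < y * y" by (simp add: ennreal_zero_less_mult_iff)
  moreover have 2: "(\<lambda>n. f n * f n) \<longlonglongrightarrow> 0" using assms by (simp add: power2_eq_square)
  ultimately have "\<forall>\<^sub>F n in sequentially. f n * f n < y * y" using order_tendstoD(2)[OF 2] by blast
  then show "\<forall>\<^sub>F n in sequentially. f n < y"
    by (rule eventually_mono) (meson leD leI mult_mono zero_le)
qed auto

lemma tendsto_0_ennreal_norm:
  fixes f :: "nat \<Rightarrow> 'a::real_normed_vector"
  assumes "(\<lambda>n. ennreal (norm (f n))) \<longlonglongrightarrow> 0" shows "f \<longlonglongrightarrow> 0"
proof -
  have "(\<lambda>n. norm (f n)) \<longlonglongrightarrow> 0"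
    using assms by (subst (asm) ennreal_0[symmetric], subst (asm) tendsto_ennreal_iff) auto
  then show ?thesis by (simp add: tendsto_norm_zero_iff)
qed

text \<open>Cauchy-Schwarz against the indicator of \<open>A\<close>, kept in squared form so that
  no square roots of extended reals occur.\<close>

lemma L2_tendsto_L1:
  assumes F: "\<And>n. F n \<in> borel_measurable M" "f \<in> borel_measurable M" and A: "A \<in> sets M" "emeasure M A < \<infinity>"
    and lim: "L2_tendsto M F f"
  shows "(\<lambda>n. \<integral>\<^sup>+x\<in>A. ennreal (norm (F n x - f x)) \<partial>M) \<longlonglongrightarrow> 0"
proof -
  note [measurable] = F A(1)
  let ?X = "\<lambda>n. \<integral>\<^sup>+x\<in>A. ennreal (norm (F n x - f x)) \<partial>M"
  have le: "(?X n)\<^sup>2 \<le> (\<integral>\<^sup>+x. ennreal ((norm (F n x - f x))\<^sup>2) \<partial>M) * emeasure M A" for n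
  proof -
    have "(?X n)\<^sup>2 \<le> (\<integral>\<^sup>+x. ennreal (norm (F n x - f x)) ^ 2 \<partial>M) * (\<integral>\<^sup>+x. indicator A x ^ 2 \<partial>M)"
      by (rule Cauchy_Schwarz_nn_integral) measurable
    also have "(\<integral>\<^sup>+x. indicator A x ^ 2 \<partial>M) = (\<integral>\<^sup>+x. indicator A x \<partial>M)"
      by (intro nn_integral_cong) (auto simp: indicator_def)
    finally show ?thesis by (simp add: ennreal_power)
  qed
  have "(\<lambda>n. (\<integral>\<^sup>+x. ennreal ((norm (F n x - f x))\<^sup>2) \<partial>M) * emeasure M A) \<longlonglongrightarrow> 0 * emeasure M A"
    using lim A(2) unfolding L2_tendsto_def by (intro tendsto_mult_ennreal tendsto_const) auto
  then have "(\<lambda>n. (?X n)\<^sup>2) \<longlonglongrightarrow> 0"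
    by (intro tendsto_0_le_ennreal[OF _ le]) simp
  then show ?thesis by (rule tendsto_power2_0_ennreal)
qed

lemma L2_integrable_on:
  assumes "L2 M f" "A \<in> sets M" "emeasure M A < \<infinity>"
  shows "integrable M (\<lambda>x. indicator A x *\<^sub>R f x)"
proof -
  have [measurable]: "f \<in> borel_measurable M" "A \<in> sets M" using assms by (auto simp: L2_def)
  have "integrable M (\<lambda>x. indicat_real A x + (norm (f x))\<^sup>2)"
    using assms by (intro Bochner_Integration.integrable_add) (auto simp: L2_def less_top)
  then show ?thesis
  proof (rule Bochner_Integration.integrable_bound)
    have "norm (f x) \<le> 1 + (norm (f x))\<^sup>2" for x
    proof (cases "norm (f x) \<le> 1")
      case False
      then have "norm (f x) * 1 \<le> norm (f x) * norm (f x)" by (intro mult_left_mono) auto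
      then show ?thesis by (simp add: power2_eq_square)
    qed (simp add: add_increasing2)
    then show "AE x in M. norm (indicat_real A x *\<^sub>R f x) \<le> norm (indicat_real A x + (norm (f x))\<^sup>2)"
      by (intro AE_I2) (auto simp: indicator_def)
  qed measurable
qed

lemma L2_integrable:
  assumes "L2 M f" "emeasure M (space M) < \<infinity>" shows "integrable M f"
proof -
  have "integrable M (\<lambda>x. indicator (space M) x *\<^sub>R f x)"
    using assms by (intro L2_integrable_on) auto
  then show ?thesis by (rule Bochner_Integration.integrable_cong[THEN iffD1, rotated 2]) auto
qed

lemma L2_tendsto_integral:
  assumes F: "\<And>n. F n \<in> borel_measurable M" "L2 M f" and fin: "emeasure M (space M) < \<infinity>"
    and lim: "L2_tendsto M F f" and \<psi>: "\<psi> \<in> borel_measurable M" "\<And>x. norm (\<psi> x) \<le> B"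
    and int: "\<And>n. integrable M (\<lambda>x. F n x * \<psi> x)"
  shows "(\<lambda>n. LINT x|M. F n x * \<psi> x) \<longlonglongrightarrow> (LINT x|M. f x * \<psi> x)"
proof -
  note [measurable] = F(1) \<psi>(1)
  have fm [measurable]: "f \<in> borel_measurable M" using F(2) by (auto simp: L2_def)
  have B: "0 \<le> B" using \<psi>(2) norm_ge_zero order_trans by blast
  have fi: "integrable M (\<lambda>x. f x * \<psi> x)"
  proof (rule Bochner_Integration.integrable_bound)
    show "integrable M (\<lambda>x. B * norm (f x))" using L2_integrable[OF F(2) fin] by simp
    show "AE x in M. norm (f x * \<psi> x) \<le> norm (B * norm (f x))"
      using \<psi>(2) B by (intro AE_I2) (simp add: norm_mult abs_mult mult.commute mult_right_mono)
  qed measurable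
  have L1: "(\<lambda>n. \<integral>\<^sup>+x\<in>space M. ennreal (norm (F n x - f x)) \<partial>M) \<longlonglongrightarrow> 0"
    using fin by (intro L2_tendsto_L1 F fm lim) auto
  have "(\<lambda>n. ennreal B * (\<integral>\<^sup>+x\<in>space M. ennreal (norm (F n x - f x)) \<partial>M)) \<longlonglongrightarrow> ennreal B * 0"
    by (intro tendsto_mult_ennreal tendsto_const L1) auto
  then have "(\<lambda>n. ennreal (norm ((LINT x|M. F n x * \<psi> x) - (LINT x|M. f x * \<psi> x)))) \<longlonglongrightarrow> 0"
    unfolding mult_zero_right
  proof (rule tendsto_0_le_ennreal)
      fix n
      have "(LINT x|M. F n x * \<psi> x) - (LINT x|M. f x * \<psi> x) = (LINT x|M. F n x * \<psi> x - f x * \<psi> x)"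
        using int fi by simp
      then have "ennreal (norm ((LINT x|M. F n x * \<psi> x) - (LINT x|M. f x * \<psi> x))) \<le> (\<integral>\<^sup>+x. norm (F n x * \<psi> x - f x * \<psi> x) \<partial>M)"
        using integral_norm_bound_ennreal[of M "\<lambda>x. F n x * \<psi> x - f x * \<psi> x"] int fi by simp
      also have "\<dots> \<le> (\<integral>\<^sup>+x. ennreal B * (ennreal (norm (F n x - f x)) * indicator (space M) x) \<partial>M)"
      proof (rule nn_integral_mono)
        fix x assume "x \<in> space M"
        have "norm (F n x * \<psi> x - f x * \<psi> x) = norm (F n x - f x) * norm (\<psi> x)"
          by (simp add: left_diff_distrib[symmetric] norm_mult)
        also have "\<dots> \<le> B * norm (F n x - f x)" using \<psi>(2)[of x] by (simp add: mult.commute mult_right_mono)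
        finally show "ennreal (norm (F n x * \<psi> x - f x * \<psi> x)) \<le> ennreal B * (ennreal (norm (F n x - f x)) * indicator (space M) x)"
          using \<open>x \<in> space M\<close> B by (simp add: ennreal_mult[symmetric] ennreal_leI)
      qed
      also have "\<dots> = ennreal B * (\<integral>\<^sup>+x\<in>space M. ennreal (norm (F n x - f x)) \<partial>M)"
        by (rule nn_integral_cmult) measurable
      finally show "ennreal (norm ((LINT x|M. F n x * \<psi> x) - (LINT x|M. f x * \<psi> x)))
       \<le> ennreal B * (\<integral>\<^sup>+x\<in>space M. ennreal (norm (F n x - f x)) \<partial>M)" .
  qed
  then show ?thesis by (intro LIM_zero_cancel[OF tendsto_0_ennreal_norm])
qed

text \<open>Convex and reflex corners are handled together through the disjunction
  \<open>cone\<close>; \<open>a\<close> and \<open>b\<close> are the unit directions of the two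
  sides.\<close>

locale corner_domain =
  fixes \<Omega> W :: "(real^2) set" and a b :: "real^2" and h :: real
  assumes open_domain: "open \<Omega>" and bounded_domain: "bounded \<Omega>"
    and norm_sides: "norm a = 1" "norm b = 1" and indep: "cross2 a b \<noteq> 0"
    and cone: "W = cone2 {0<..} a b \<or> W = - cone2 {0..} a b"
    and h_pos: "h > 0" and local_cone: "\<Omega> \<inter> ball 0 h = W \<inter> ball 0 h"
begin

section \<open>Geometry of the domain near the corner\<close>

lemma local_cone_iff: "norm x < h \<Longrightarrow> x \<in> \<Omega> \<longleftrightarrow> x \<in> W"
proof -
  assume "norm x < h"
  moreover have "x \<in> \<Omega> \<inter> ball 0 h \<longleftrightarrow> x \<in> W \<inter> ball 0 h" by (simp only: local_cone)
  ultimately show ?thesis by simp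
qed

abbreviation "\<M> \<equiv> boundary_measure \<Omega>"

definition "side c = (\<lambda>s. s *\<^sub>R c) ` {0<..<h}" for c :: "real^2"

lemma side_norm: "c \<in> {a, b} \<Longrightarrow> norm c = 1"
  using norm_sides by auto

lemma side_iff: "c \<in> {a, b} \<Longrightarrow> x \<in> side c \<longleftrightarrow> x = norm x *\<^sub>R c \<and> 0 < norm x \<and> norm x < h"
  unfolding side_def using side_norm[of c] by auto

text \<open>A direction that leads from the side \<open>c\<close> into the sector. The other side
  serves in the convex case; in the reflex case it points into the complement and has to be
  reversed.\<close>

definition transversal :: "real^2 \<Rightarrow> real^2" where
  "transversal c = (if W = cone2 {0<..} a b then 1 else -1) *\<^sub>R (if c = a then b else a)"

lemma sides_distinct: "a \<noteq> b"
  using indep by (auto simp: cross2_def)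

lemma transversal_props:
  assumes "c \<in> {a, b}"
  shows "norm (transversal c) = 1" "cross2 c (transversal c) \<noteq> 0"
    "\<And>s r. s > 0 \<Longrightarrow> r > 0 \<Longrightarrow> s *\<^sub>R c + r *\<^sub>R transversal c \<in> W"
proof -
  show "norm (transversal c) = 1" using norm_sides by (auto simp: transversal_def)
  show "cross2 c (transversal c) \<noteq> 0" using assms indep sides_distinct by (auto simp: transversal_def cross2_def mult.commute)
  fix s r :: real assume sr: "s > 0" "r > 0"
  show "s *\<^sub>R c + r *\<^sub>R transversal c \<in> W"
  proof (cases "W = cone2 {0<..} a b")
    case True
    then have W: "x \<in> W \<longleftrightarrow> x \<in> cone2 {0<..} a b" for x by simp
    show ?thesis unfolding W transversal_def if_P[OF True]
      using assms sides_distinct sr cone2_comb_iff[OF indep, of s r "{0<..}"] cone2_comb_iff[OF indep, of r s "{0<..}"]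
      by (auto simp: add.commute)
  next
    case False
    then have W: "x \<in> W \<longleftrightarrow> x \<notin> cone2 {0..} a b" for x using cone by simp
    show ?thesis unfolding W transversal_def if_not_P[OF False]
      using assms sides_distinct sr cone2_comb_iff[OF indep, of s "-r" "{0..}"] cone2_comb_iff[OF indep, of "-r" s "{0..}"]
      by (auto simp: transversal_def add.commute)
  qed
qed

lemma strip_in_domain:
  assumes "c \<in> {a, b}" "0 < s" "0 < r" "s + r < h"
  shows "s *\<^sub>R c + r *\<^sub>R transversal c \<in> \<Omega> \<inter> ball 0 h"
proof -
  have "norm (s *\<^sub>R c + r *\<^sub>R transversal c) \<le> s * norm c + r * norm (transversal c)"
    using assms norm_triangle_ineq[of "s *\<^sub>R c" "r *\<^sub>R transversal c"] by simp
  then have "s *\<^sub>R c + r *\<^sub>R transversal c \<in> ball 0 h"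
    using assms side_norm transversal_props(1) by simp
  moreover have "s *\<^sub>R c + r *\<^sub>R transversal c \<in> W"
    by (rule transversal_props(3)[OF assms(1-3)])
  ultimately show ?thesis using local_cone by blast
qed

lemma side_closure:
  assumes "c \<in> {a, b}" "0 \<le> s" "s < h"
  shows "s *\<^sub>R c \<in> closure (\<Omega> \<inter> ball 0 h)"
proof -
  \<comment> \<open>The factor \<open>(h - s) / 3\<close> keeps the sum of the two coefficients
    below \<open>h\<close>, as \<open>strip_in_domain\<close> requires.\<close>
  let ?x = "\<lambda>n. (s + (h - s) / 3 * (1 / real (Suc n))) *\<^sub>R c + ((h - s) / 3 * (1 / real (Suc n))) *\<^sub>R transversal c"
  have "?x n \<in> \<Omega> \<inter> ball 0 h" for n
  proof (rule strip_in_domain[OF assms(1)])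
    define e where "e = (h - s) / 3 * (1 / real (Suc n))"
    have p: "0 < e" using assms by (simp add: e_def)
    have "e \<le> (h - s) / 3 * 1" unfolding e_def using assms by (intro mult_left_mono) auto
    then have "3 * e \<le> h - s" by simp
    then show "0 < s + (h - s) / 3 * (1 / real (Suc n))" "0 < (h - s) / 3 * (1 / real (Suc n))" 
      "s + (h - s) / 3 * (1 / real (Suc n)) + (h - s) / 3 * (1 / real (Suc n)) < h"
      using p assms unfolding e_def[symmetric] by linarith+
  qed
  moreover have "?x \<longlonglongrightarrow> (s + (h - s) / 3 * 0) *\<^sub>R c + ((h - s) / 3 * 0) *\<^sub>R transversal c"
    by (intro tendsto_intros LIMSEQ_Suc lim_1_over_n)
  ultimately show ?thesis unfolding closure_sequential by (intro exI[of _ ?x]) auto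
qed

lemma side_not_in_W: "c \<in> {a, b} \<Longrightarrow> 0 \<le> s \<Longrightarrow> s *\<^sub>R c \<notin> W"
  using cone cone2_comb_iff[OF indep, of s 0 "{0<..}"] cone2_comb_iff[OF indep, of 0 s "{0<..}"]
    cone2_comb_iff[OF indep, of s 0 "{0..}"] cone2_comb_iff[OF indep, of 0 s "{0..}"] by auto

lemma side_frontier:
  assumes "c \<in> {a, b}" "0 \<le> s" "s < h" shows "s *\<^sub>R c \<in> frontier \<Omega>"
proof -
  have "s *\<^sub>R c \<in> closure \<Omega>" using side_closure[OF assms] closure_mono[of "\<Omega> \<inter> ball 0 h" \<Omega>] by blast
  moreover have "s *\<^sub>R c \<notin> \<Omega>"
    using side_not_in_W[OF assms(1,2)] local_cone_iff[of "s *\<^sub>R c"] side_norm[OF assms(1)] assms(2,3) by simp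
  ultimately show ?thesis using open_domain by (simp add: frontier_def interior_open)
qed

lemma closed_cone: "closed (cone2 {0..} a b)"
proof -
  have "cone2 {0..} a b = {x. 0 \<le> cross2 x b / cross2 a b} \<inter> {x. 0 \<le> cross2 a x / cross2 a b}"
    using cone2_iff[OF indep] by auto
  then show ?thesis unfolding cross2_def
    by (simp only:) (intro closed_Int closed_Collect_le continuous_intros; use indep in \<open>simp add: cross2_def\<close>)
qed

lemma open_cone: "open (cone2 {0<..} a b)"
proof -
  have "cone2 {0<..} a b = {x. 0 < cross2 x b / cross2 a b} \<inter> {x. 0 < cross2 a x / cross2 a b}"
    using cone2_iff[OF indep] by auto
  then show ?thesis unfolding cross2_def
    by (simp only:) (intro open_Int open_Collect_less continuous_intros; use indep in \<open>simp add: cross2_def\<close>)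
qed

lemma open_W: "open W"
  using cone closed_cone open_cone by auto

text \<open>A frontier point near 0 lies in the closure of \<open>W\<close> but not in
  \<open>W\<close>. In both the convex and the reflex case this forces nonnegative oblique
  coordinates, one of which is 0.\<close>

lemma frontier_near_corner:
  assumes "x \<in> frontier \<Omega>" "norm x < h"
  shows "x = 0 \<or> x \<in> side a \<or> x \<in> side b"
proof -
  let ?r = "cross2 x b / cross2 a b" and ?s = "cross2 a x / cross2 a b"
  have x: "x = ?r *\<^sub>R a + ?s *\<^sub>R b" by (rule cross2_coords[OF indep])
  have "x \<notin> \<Omega>" using assms(1) open_domain by (simp add: frontier_def interior_open)
  then have nW: "x \<notin> W" using local_cone_iff assms(2) by simp
  have cl: "S \<inter> W \<noteq> {}" if "open S" "x \<in> S" for S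
  proof -
    have "x \<in> closure \<Omega>" using assms(1) by (simp add: frontier_def)
    then have "x \<in> (S \<inter> ball 0 h) \<inter> closure \<Omega>" using that assms(2) by simp
    then have "S \<inter> ball 0 h \<inter> \<Omega> \<noteq> {}"
      using open_Int_closure_eq_empty[OF open_Int[OF that(1) open_ball], of 0 h \<Omega>] by blast
    then show ?thesis using local_cone_iff by fastforce
  qed
  have "?r \<ge> 0 \<and> ?s \<ge> 0 \<and> (?r = 0 \<or> ?s = 0)"
  proof (cases "W = cone2 {0<..} a b")
    case True
    have "x \<in> cone2 {0..} a b"
    proof (rule ccontr)
      assume "x \<notin> cone2 {0..} a b"
      then have "(- cone2 {0..} a b) \<inter> W \<noteq> {}" using closed_cone by (intro cl) auto
      moreover have "cone2 {0<..} a b \<subseteq> cone2 {0..} a b" using cone2_iff[OF indep] by auto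
      ultimately show False unfolding True by blast
    qed
    moreover have "x \<notin> cone2 {0<..} a b" using nW by (simp only: True not_False_eq_True)
    ultimately show ?thesis unfolding cone2_iff[OF indep] by auto
  next
    case False
    then have W: "W = - cone2 {0..} a b" using cone by simp
    have "x \<notin> cone2 {0<..} a b"
    proof
      assume "x \<in> cone2 {0<..} a b"
      then have "cone2 {0<..} a b \<inter> W \<noteq> {}" using open_cone by (intro cl) auto
      moreover have "cone2 {0<..} a b \<subseteq> cone2 {0..} a b" using cone2_iff[OF indep] by auto
      ultimately show False unfolding W by blast
    qed
    moreover have "x \<in> cone2 {0..} a b" using nW unfolding W by simp
    ultimately show ?thesis unfolding cone2_iff[OF indep] by auto
  qed
  then obtain r s where rs: "x = r *\<^sub>R a + s *\<^sub>R b" "r \<ge> 0" "s \<ge> 0" "r = 0 \<or> s = 0" using x by metis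
  then have "norm x = r + s" using norm_sides by auto
  then show ?thesis using rs assms(2) by (auto simp: side_def)
qed

lemma borel_side: "c \<in> {a, b} \<Longrightarrow> side c \<in> sets borel"
proof -
  assume c: "c \<in> {a, b}"
  have "side c = {x. x = norm x *\<^sub>R c} \<inter> {x. 0 < norm x} \<inter> {x. norm x < h}"
    using side_iff[OF c] by auto
  moreover have "closed {x. x = norm x *\<^sub>R c}" by (intro closed_Collect_eq continuous_intros)
  moreover have "open {x::real^2. 0 < norm x}" "open {x::real^2. norm x < h}"
    by (intro open_Collect_less continuous_intros)+
  ultimately show ?thesis by (simp add: borel_closed borel_open sets.Int)
qed

section \<open>The boundary measure on the sides\<close>

lemma sets_boundary: "A \<in> sets borel \<Longrightarrow> A \<subseteq> frontier \<Omega> \<Longrightarrow> A \<in> sets \<M>"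
  unfolding boundary_measure_def
  by (rule sets_completionI_sets) (auto simp: sets_restrict_space)

lemma space_boundary: "space \<M> = frontier \<Omega>"
  by (simp add: boundary_measure_def space_restrict_space)

lemma measurable_boundary: "f \<in> borel_measurable borel \<Longrightarrow> f \<in> borel_measurable \<M>"
  unfolding boundary_measure_def
  by (intro measurable_completion measurable_restrict_space1) (simp cong: measurable_cong_sets)

lemma side_subset_frontier: "c \<in> {a, b} \<Longrightarrow> side c \<subseteq> frontier \<Omega>"
  using side_frontier by (auto simp: side_def)

lemma nn_integral_side:
  assumes c: "c \<in> {a, b}" and [measurable]: "f \<in> borel_measurable borel"
  shows "(\<integral>\<^sup>+x\<in>side c. f x \<partial>\<M>) = (\<integral>\<^sup>+s\<in>{0<..<h}. f (s *\<^sub>R c) \<partial>lborel)"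
proof -
  note [measurable] = borel_side[OF c]
  have "(\<integral>\<^sup>+x\<in>side c. f x \<partial>\<M>) = (\<integral>\<^sup>+x. f x * indicator (side c) x * indicator (frontier \<Omega>) x \<partial>hausdorff1)"
    unfolding boundary_measure_def nn_integral_completion
    by (intro nn_integral_restrict_space) (simp add: borel_closed)
  also have "\<dots> = (\<integral>\<^sup>+x. (f x * indicator (side c) x) * indicator (range (\<lambda>s. s *\<^sub>R c)) x \<partial>hausdorff1)"
    using side_subset_frontier[OF c] by (intro nn_integral_cong) (auto simp: indicator_def side_def)
  also have "\<dots> = (\<integral>\<^sup>+s. f (s *\<^sub>R c) * indicator (side c) (s *\<^sub>R c) \<partial>lborel)"
    by (rule nn_integral_hausdorff1_line[OF side_norm[OF c]]) measurable
  also have "\<dots> = (\<integral>\<^sup>+s\<in>{0<..<h}. f (s *\<^sub>R c) \<partial>lborel)"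
  proof (intro nn_integral_cong)
    fix s :: real
    have "s *\<^sub>R c \<in> side c \<longleftrightarrow> s \<in> {0<..<h}"
      using side_norm[OF c] by (auto simp: side_def)
    then show "f (s *\<^sub>R c) * indicator (side c) (s *\<^sub>R c) = f (s *\<^sub>R c) * indicator {0<..<h} s"
      by (simp add: indicator_def)
  qed
  finally show ?thesis .
qed

lemma emeasure_side: "c \<in> {a, b} \<Longrightarrow> emeasure \<M> (side c) = ennreal h"
  using nn_integral_side[of c "\<lambda>_. 1"] h_pos sets_boundary[OF borel_side side_subset_frontier]
  by simp

text \<open>The corner belongs to neither \<open>side a\<close> nor \<open>side b\<close> and is
  discarded as a null set; it lies on the line through \<open>a\<close>, where Hausdorff measure is
  length.\<close>

lemma AE_boundary_nonzero: "AE x in \<M>. x \<noteq> 0"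
proof -
  have "emeasure hausdorff1 {0} = (\<integral>\<^sup>+x. indicator {0} x * indicator (range (\<lambda>s. s *\<^sub>R a)) x \<partial>hausdorff1)"
  proof -
    have "(\<integral>\<^sup>+x. indicator {0} x * indicator (range (\<lambda>s. s *\<^sub>R a)) x \<partial>hausdorff1) = (\<integral>\<^sup>+x. indicator {0} x \<partial>hausdorff1)"
      by (intro nn_integral_cong) (auto simp: indicator_def intro: image_eqI[of _ _ 0])
    then show ?thesis by simp
  qed
  also have "\<dots> = (\<integral>\<^sup>+s. indicator {0} (s *\<^sub>R a) \<partial>lborel)"
    by (rule nn_integral_hausdorff1_line[OF norm_sides(1)]) simp
  also have "(\<lambda>s. indicator {0} (s *\<^sub>R a)) = (indicator {0} :: real \<Rightarrow> ennreal)"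
    using norm_sides by (auto simp: fun_eq_iff indicator_def)
  finally have "emeasure hausdorff1 {0} = 0" by simp
  then have "AE x in hausdorff1. x \<noteq> 0"
    by (intro AE_I[of _ _ "{0}"]) auto
  then have "AE x in restrict_space hausdorff1 (frontier \<Omega>). x \<noteq> 0"
    by (subst AE_restrict_space_iff) (auto simp: borel_closed)
  then show ?thesis unfolding boundary_measure_def by (rule AE_completion)
qed

end

section \<open>Traces on the sides of a corner\<close>

lemma bounded_compact_support:
  fixes f :: "real^2 \<Rightarrow> complex"
  assumes "continuous_on UNIV f" "compact (supp f)"
  obtains B where "B > 0" "\<And>x. norm (f x) \<le> B"
proof -
  have "compact (f ` supp f)" using assms by (intro compact_continuous_image) (auto intro: continuous_on_subset)
  then obtain B where B: "B > 0" "\<And>y. y \<in> f ` supp f \<Longrightarrow> norm y \<le> B"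
    using compact_imp_bounded[of "f ` supp f"] unfolding bounded_pos by auto
  have "norm (f x) \<le> B" for x
    using B outside_supp[of x f] by (cases "x \<in> supp f") auto
  then show ?thesis using that B(1) by blast
qed

lemma supp_pderiv_at: "supp (pderiv_at i f) \<subseteq> supp f"
proof -
  have "{x. pderiv_at i f x \<noteq> 0} \<subseteq> supp f" using pderiv_at_outside_supp by blast
  then show ?thesis unfolding supp_def[of "pderiv_at i f"] by (intro closure_minimal) (auto simp: supp_def)
qed

lemma compact_supp_subset: "compact (supp f) \<Longrightarrow> supp g \<subseteq> supp f \<Longrightarrow> compact (supp g)"
  by (metis closed_closure compact_Int_closed inf.absorb_iff2 supp_def)

lemma supp_mult: "supp (\<lambda>x. f x * g x) \<subseteq> supp g"
  unfolding supp_def by (intro closure_mono) auto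

lemma weak_pderiv_L2: "H1 \<Omega> f \<Longrightarrow> L2 (lebesgue_on \<Omega>) (weak_pderiv \<Omega> i f)"
proof -
  assume "H1 \<Omega> f"
  then have "is_weak_pderiv \<Omega> i f (weak_pderiv \<Omega> i f)"
    unfolding H1_def weak_pderiv_def by (metis someI_ex)
  then show ?thesis by (simp add: is_weak_pderiv_def)
qed

text \<open>First \<open>m\<close> is fixed to make \<open>q m\<close> small, then \<open>n\<close>
  grows. This handles errors that blow up with \<open>m\<close> but vanish in \<open>n\<close> for
  each fixed \<open>m\<close>.\<close>

lemma tendsto_0_double_ennreal:
  fixes Z :: "nat \<Rightarrow> ennreal"
  assumes le: "\<And>m n. Z n \<le> p m n + q m" and p: "\<And>m. p m \<longlonglongrightarrow> 0" and q: "q \<longlonglongrightarrow> 0"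
  shows "Z \<longlonglongrightarrow> 0"
proof (rule order_tendstoI)
  fix y :: ennreal assume "0 < y"
  then obtain z where z: "0 < z" "z < y" using dense by blast
  then have "z < top" using less_trans top.not_eq_extremum by (metis top_greatest order_less_le_trans)
  then obtain e where e: "z = ennreal e" "e > 0" using z by (cases z) auto
  have e2: "ennreal (e / 2) > 0" using e by simp
  obtain m where m: "q m < ennreal (e / 2)"
    using order_tendstoD(2)[OF q e2] by (auto simp: eventually_sequentially)
  have "\<forall>\<^sub>F n in sequentially. p m n < ennreal (e / 2)" using order_tendstoD(2)[OF p e2] .
  then show "\<forall>\<^sub>F n in sequentially. Z n < y"
  proof (rule eventually_mono)
    fix n assume "p m n < ennreal (e / 2)"
    then have "p m n + q m \<le> ennreal (e / 2) + ennreal (e / 2)" using m by (intro add_mono) auto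
    also have "\<dots> = z" using e by (simp add: ennreal_plus[symmetric] del: ennreal_plus)
    finally show "Z n < y" using le[of n m] z by order
  qed
qed auto

lemma holder_on_imp_continuous_on:
  assumes "holder_on \<alpha> S f" "0 < \<alpha>" shows "continuous_on S f"
proof (rule continuous_onI)
  obtain A where A: "\<And>x y. x \<in> S \<Longrightarrow> y \<in> S \<Longrightarrow> dist (f x) (f y) \<le> A * dist x y powr \<alpha>"
    using assms(1) unfolding holder_on_def by blast
  fix x e assume x: "x \<in> S" and e: "(0::real) < e"
  have "((\<lambda>d. A * d powr \<alpha>) \<longlongrightarrow> A * 0) (at_right 0)"
    using assms(2) by (intro tendsto_intros tendsto_zero_powrI[of "\<lambda>x. x" _ "\<lambda>_. \<alpha>" \<alpha>]) 
      (auto simp: eventually_at_right_less eventually_at_filter)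
  then have "\<forall>\<^sub>F d in at_right 0. A * d powr \<alpha> < e" using e by (intro order_tendstoD) auto
  then obtain d where d: "d > 0" "\<And>y. 0 < y \<Longrightarrow> y < d \<Longrightarrow> A * y powr \<alpha> < e"
    unfolding eventually_at_right_field by auto
  show "\<exists>d>0. \<forall>x'\<in>S. dist x' x < d \<longrightarrow> dist (f x') (f x) \<le> e"
  proof (intro exI[of _ d] conjI ballI impI d(1))
    fix y assume y: "y \<in> S" "dist y x < d"
    show "dist (f y) (f x) \<le> e"
      using A[OF y(1) x] d(2)[of "dist y x"] y e by (cases "y = x") auto
  qed
qed

section \<open>Integration over the domain and Green's formula at the corner\<close>

context corner_domain
begin

abbreviation "\<L> \<equiv> lebesgue_on \<Omega>"

lemma domain_lebesgue [measurable]: "\<Omega> \<in> sets lebesgue"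
  using open_domain by (simp add: borel_open)

lemma domain_borel: "\<Omega> \<in> sets borel"
  using open_domain by (simp add: borel_open)

lemma finite_domain: "emeasure \<L> (space \<L>) < \<infinity>"
  using emeasure_bounded_finite[OF bounded_domain] domain_borel
  by (simp add: emeasure_restrict_space space_restrict_space)

lemma continuous_measurable_domain: 
  "continuous_on UNIV f \<Longrightarrow> f \<in> borel_measurable \<L>" for f :: "real^2 \<Rightarrow> 'b::topological_space"
  by (intro continuous_imp_measurable_on_sets_lebesgue domain_lebesgue) (auto intro: continuous_on_subset)

lemma borel_measurable_domain: 
  "f \<in> borel_measurable borel \<Longrightarrow> f \<in> borel_measurable \<L>"
  by (intro measurable_restrict_space1 measurable_completion) simp

lemma integral_domain:
  fixes f :: "real^2 \<Rightarrow> complex"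
  assumes "f \<in> borel_measurable borel"
  shows "(LINT x|\<L>. f x) = (LINT x|lborel. indicator \<Omega> x *\<^sub>R f x)"
  using assms domain_borel by (simp add: integral_restrict_space integral_completion)

lemma nn_integral_domain:
  "(\<integral>\<^sup>+x. f x \<partial>\<L>) = (\<integral>\<^sup>+x. f x * indicator \<Omega> x \<partial>lborel)"
  by (simp add: nn_integral_restrict_space nn_integral_completion)

lemma integrable_domain_bounded:
  fixes f :: "real^2 \<Rightarrow> complex"
  assumes "f \<in> borel_measurable \<L>" "\<And>x. norm (f x) \<le> B"
  shows "integrable \<L> f"
proof -
  interpret finite_measure \<L> using finite_domain by (intro finite_measureI) auto
  show ?thesis using assms by (intro integrable_const_bound[of _ B]) auto
qed

lemma integrable_domain_mult:
  assumes "L2 \<L> f" "\<psi> \<in> borel_measurable \<L>" "\<And>x. norm (\<psi> x) \<le> B"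
  shows "integrable \<L> (\<lambda>x. f x * \<psi> x)"
proof (rule Bochner_Integration.integrable_bound)
  have B: "0 \<le> B" using assms(3) norm_ge_zero order_trans by blast
  show "integrable \<L> (\<lambda>x. B * norm (f x))" using L2_integrable[OF assms(1) finite_domain] by simp
  show "AE x in \<L>. norm (f x * \<psi> x) \<le> norm (B * norm (f x))"
    using assms(3) B by (intro AE_I2) (simp add: norm_mult abs_mult mult.commute mult_right_mono)
  show "(\<lambda>x. f x * \<psi> x) \<in> borel_measurable \<L>" using assms by (auto simp: L2_def)
qed

lemma integrable_domain_smooth:
  assumes "L2 \<L> u" "continuous_on UNIV \<psi>" "compact (supp \<psi>)"
  shows "integrable \<L> (\<lambda>x. u x * \<psi> x)"
proof -
  obtain D where D: "\<And>x. norm (\<psi> x) \<le> D" using bounded_compact_support[OF assms(2,3)] by blast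
  show ?thesis by (rule integrable_domain_mult[OF assms(1) continuous_measurable_domain[OF assms(2)] D])
qed

lemma integrable_domain_continuous:
  fixes u :: "real^2 \<Rightarrow> complex"
  assumes "continuous_on UNIV u" "compact (supp u)"
  shows "integrable \<L> u"
proof -
  obtain D where "\<And>x. norm (u x) \<le> D" using bounded_compact_support[OF assms] by blast
  then show ?thesis by (intro integrable_domain_bounded continuous_measurable_domain assms(1))
qed

text \<open>The product rule holds for the smooth approximants, and both of its terms pass to the
  limit because \<open>\<psi>\<close> and its derivative are bounded.\<close>

lemma trace_sequence_limit:
  assumes F: "\<And>n. test_fun UNIV (F n)" "L2_tendsto \<L> F f" "L2_tendsto \<L> (\<lambda>n. pderiv_at k (F n)) (weak_pderiv \<Omega> k f)"
    and f: "H1 \<Omega> f" and \<psi>: "\<And>k. C_k k \<psi>" "compact (supp \<psi>)"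
  shows "(\<lambda>n. LINT x|\<L>. pderiv_at k (\<lambda>x. F n x * \<psi> x) x)
      \<longlonglongrightarrow> (LINT x|\<L>. weak_pderiv \<Omega> k f x * \<psi> x) + (LINT x|\<L>. f x * pderiv_at k \<psi> x)"
proof -
  have F1: "C_k (Suc 0) (F n)" "compact (supp (F n))" for n using F(1) by (auto simp: test_fun_def)
  have \<psi>1: "C_k (Suc 0) \<psi>" by (rule \<psi>)
  have cF: "continuous_on UNIV (F n)" "continuous_on UNIV (pderiv_at k (F n))" for n
    using F1 C_k_continuous[OF F1(1)] by auto
  have c\<psi>: "continuous_on UNIV \<psi>" "continuous_on UNIV (pderiv_at k \<psi>)"
    using \<psi>1 C_k_continuous[OF \<psi>1] by auto
  obtain B0 where B0: "\<And>x. norm (\<psi> x) \<le> B0" using bounded_compact_support[OF c\<psi>(1) \<psi>(2)] by blast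
  obtain B1 where B1: "\<And>x. norm (pderiv_at k \<psi> x) \<le> B1"
    using bounded_compact_support[OF c\<psi>(2) compact_supp_subset[OF \<psi>(2) supp_pderiv_at]] by blast
  have i1: "integrable \<L> (\<lambda>x. pderiv_at k (F n) x * \<psi> x)" for n
    by (intro integrable_domain_continuous continuous_on_mult cF c\<psi> compact_supp_subset[OF \<psi>(2) supp_mult])
  have i2: "integrable \<L> (\<lambda>x. F n x * pderiv_at k \<psi> x)" for n
    by (intro integrable_domain_continuous continuous_on_mult cF c\<psi>
        compact_supp_subset[OF \<psi>(2) order_trans[OF supp_mult supp_pderiv_at]])
  have "(LINT x|\<L>. pderiv_at k (\<lambda>x. F n x * \<psi> x) x) = (LINT x|\<L>. pderiv_at k (F n) x * \<psi> x) + (LINT x|\<L>. F n x * pderiv_at k \<psi> x)" for n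
  proof -
    have "pderiv_at k (\<lambda>x. F n x * \<psi> x) = (\<lambda>x. pderiv_at k (F n) x * \<psi> x + F n x * pderiv_at k \<psi> x)"
      using F1 \<psi>1 by (intro ext pderiv_at_mult) auto
    then show ?thesis using i1 i2 by simp
  qed
  moreover have "(\<lambda>n. LINT x|\<L>. pderiv_at k (F n) x * \<psi> x) \<longlonglongrightarrow> (LINT x|\<L>. weak_pderiv \<Omega> k f x * \<psi> x)"
    by (rule L2_tendsto_integral[OF _ weak_pderiv_L2[OF f] finite_domain F(3) _ B0 i1])
      (use cF c\<psi> continuous_measurable_domain in blast)+
  moreover have "(\<lambda>n. LINT x|\<L>. F n x * pderiv_at k \<psi> x) \<longlonglongrightarrow> (LINT x|\<L>. f x * pderiv_at k \<psi> x)"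
    by (rule L2_tendsto_integral[OF _ _ finite_domain F(2) _ B1 i2])
      (use cF c\<psi> continuous_measurable_domain f in \<open>auto simp: H1_def\<close>)
  ultimately show ?thesis by (simp add: tendsto_add)
qed

text \<open>\<open>\<Omega>\<close> and \<open>W\<close> agree on the ball that contains the support
  of \<open>G\<close>; for the same reason the rays may be cut at length \<open>h\<close>, where
  they become the sides.\<close>

lemma divergence_bound_domain:
  obtains C where "C \<ge> 0" "\<And>G k. C_k (Suc 0) G \<Longrightarrow> compact (supp G) \<Longrightarrow> supp G \<subseteq> ball 0 h \<Longrightarrow>
     ennreal (norm (LINT x|\<L>. pderiv_at k G x)) \<le>
     ennreal C * ((\<integral>\<^sup>+x\<in>side a. norm (G x) \<partial>\<M>) + (\<integral>\<^sup>+x\<in>side b. norm (G x) \<partial>\<M>))"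
proof -
  obtain C where C: "C \<ge> 0" "\<And>G k. C_k (Suc 0) G \<Longrightarrow> compact (supp G) \<Longrightarrow>
     ennreal (norm (LINT x|lborel. indicator W x *\<^sub>R pderiv_at k G x)) \<le>
     ennreal C * ((\<integral>\<^sup>+s\<in>{0<..}. norm (G (s *\<^sub>R a)) \<partial>lborel) + (\<integral>\<^sup>+s\<in>{0<..}. norm (G (s *\<^sub>R b)) \<partial>lborel))"
    using divergence_bound_cone[OF indep cone] by blast
  show ?thesis
  proof (rule that[OF C(1)])
    fix G :: "real^2 \<Rightarrow> complex" and k :: 2
    assume G: "C_k (Suc 0) G" "compact (supp G)" "supp G \<subseteq> ball 0 h"
    have Gm [measurable]: "G \<in> borel_measurable borel" "pderiv_at k G \<in> borel_measurable borel"
      using C_k_continuous[OF G(1)] G(1) by (auto intro: borel_measurable_continuous_onI)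
    have s: "(\<integral>\<^sup>+s\<in>{0<..}. norm (G (s *\<^sub>R c)) \<partial>lborel) = (\<integral>\<^sup>+x\<in>side c. norm (G x) \<partial>\<M>)" if c: "c \<in> {a, b}" for c
    proof -
      have "(\<integral>\<^sup>+s\<in>{0<..}. norm (G (s *\<^sub>R c)) \<partial>lborel) = (\<integral>\<^sup>+s\<in>{0<..<h}. ennreal (norm (G (s *\<^sub>R c))) \<partial>lborel)"
      proof (rule nn_integral_cong)
        fix s :: real
        have "G (s *\<^sub>R c) = 0" if "s \<ge> h"
        proof (rule outside_supp)
          have "s *\<^sub>R c \<notin> ball 0 h" using that side_norm[OF c] by simp
          then show "s *\<^sub>R c \<notin> supp G" using G(3) by blast
        qed
        then show "ennreal (norm (G (s *\<^sub>R c))) * indicator {0<..} s = ennreal (norm (G (s *\<^sub>R c))) * indicator {0<..<h} s"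
          by (auto simp: indicator_def not_less)
      qed
      also have "\<dots> = (\<integral>\<^sup>+x\<in>side c. norm (G x) \<partial>\<M>)"
        by (rule nn_integral_side[OF c, symmetric]) measurable
      finally show ?thesis .
    qed
    have "(LINT x|\<L>. pderiv_at k G x) = (LINT x|lborel. indicator W x *\<^sub>R pderiv_at k G x)"
      unfolding integral_domain[OF Gm(2)]
    proof (rule Bochner_Integration.integral_cong)
      fix x
      show "indicator \<Omega> x *\<^sub>R pderiv_at k G x = indicator W x *\<^sub>R pderiv_at k G x"
      proof (cases "norm x < h")
        case True
        then show ?thesis using local_cone_iff by (simp add: indicator_def)
      next
        case False
        then have "x \<notin> supp G" using G(3) by auto
        then show ?thesis by (simp add: pderiv_at_outside_supp)
      qed
    qed simp
    then show "ennreal (norm (LINT x|\<L>. pderiv_at k G x)) \<le>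
     ennreal C * ((\<integral>\<^sup>+x\<in>side a. norm (G x) \<partial>\<M>) + (\<integral>\<^sup>+x\<in>side b. norm (G x) \<partial>\<M>))"
      using C(2)[OF G(1,2), of k] s[of a] s[of b] by simp
  qed
qed

lemma trace_L1_side:
  assumes "\<And>n. test_fun UNIV (F n)" "L2_tendsto \<M> F tf" "L2 \<M> tf" "c \<in> {a, b}"
  shows "(\<lambda>n. \<integral>\<^sup>+x\<in>side c. norm (F n x - tf x) \<partial>\<M>) \<longlonglongrightarrow> 0"
proof (rule L2_tendsto_L1[OF _ _ _ _ assms(2)])
  show "F n \<in> borel_measurable \<M>" for n
  proof -
    have "C_k 0 (F n)" using assms(1) unfolding test_fun_def by blast
    then show ?thesis by (intro measurable_boundary borel_measurable_continuous_onI) simp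
  qed
  show "tf \<in> borel_measurable \<M>" using assms(3) by (simp add: L2_def)
  show "side c \<in> sets \<M>" by (intro sets_boundary borel_side side_subset_frontier assms(4))
  show "emeasure \<M> (side c) < \<infinity>" by (simp add: emeasure_side[OF assms(4)])
qed

text \<open>Integration by parts for \<open>f - g\<close>, whose trace vanishes on the sides. On a
  side the approximants of \<open>f\<close> and \<open>g\<close> converge in \<open>L1\<close> to
  the same function, so the boundary contribution of their difference tends to 0 by
  \<open>divergence_bound_domain\<close>.\<close>

proposition weak_green:
  assumes f: "has_trace \<Omega> f tf" and g: "has_trace \<Omega> g tg"
    and eq: "AE x in \<M>. x \<in> side a \<union> side b \<longrightarrow> tf x = tg x"
    and \<psi>: "\<And>k. C_k k \<psi>" "supp \<psi> \<subseteq> ball 0 h" "compact (supp \<psi>)"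
  shows "(LINT x|\<L>. weak_pderiv \<Omega> k f x * \<psi> x) - (LINT x|\<L>. weak_pderiv \<Omega> k g x * \<psi> x)
     = - ((LINT x|\<L>. f x * pderiv_at k \<psi> x) - (LINT x|\<L>. g x * pderiv_at k \<psi> x))"
proof -
  obtain F where F: "\<And>n. test_fun UNIV (F n)" "L2_tendsto \<L> F f"
      "L2_tendsto \<L> (\<lambda>n. pderiv_at k (F n)) (weak_pderiv \<Omega> k f)" "L2_tendsto \<M> F tf"
    and f': "H1 \<Omega> f" "L2 \<M> tf" using f unfolding has_trace_def by blast
  obtain G where G: "\<And>n. test_fun UNIV (G n)" "L2_tendsto \<L> G g"
      "L2_tendsto \<L> (\<lambda>n. pderiv_at k (G n)) (weak_pderiv \<Omega> k g)" "L2_tendsto \<M> G tg"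
    and g': "H1 \<Omega> g" "L2 \<M> tg" using g unfolding has_trace_def by blast
  obtain C where C: "C \<ge> 0" "\<And>G k. C_k (Suc 0) G \<Longrightarrow> compact (supp G) \<Longrightarrow> supp G \<subseteq> ball 0 h \<Longrightarrow>
     ennreal (norm (LINT x|\<L>. pderiv_at k G x)) \<le>
     ennreal C * ((\<integral>\<^sup>+x\<in>side a. norm (G x) \<partial>\<M>) + (\<integral>\<^sup>+x\<in>side b. norm (G x) \<partial>\<M>))"
    using divergence_bound_domain by blast
  have "continuous_on UNIV \<psi>" using \<psi>(1)[of 0] by simp
  then obtain B where B: "B > 0" "\<And>x. norm (\<psi> x) \<le> B" using bounded_compact_support \<psi>(3) by blast
  have FG: "C_k k (F n)" "C_k k (G n)" for n k using F(1) G(1) by (auto simp: test_fun_def)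
  have mF [measurable]: "F n \<in> borel_measurable \<M>" "G n \<in> borel_measurable \<M>" for n
    using FG[of 0 n] by (auto intro!: measurable_boundary borel_measurable_continuous_onI)
  have mt [measurable]: "tf \<in> borel_measurable \<M>" "tg \<in> borel_measurable \<M>" using f' g' by (auto simp: L2_def)
  let ?e = "\<lambda>n c. (\<integral>\<^sup>+x\<in>side c. norm (F n x - tf x) \<partial>\<M>) + (\<integral>\<^sup>+x\<in>side c. norm (G n x - tg x) \<partial>\<M>)"
  have side: "(\<integral>\<^sup>+x\<in>side c. norm (F n x * \<psi> x - G n x * \<psi> x) \<partial>\<M>) \<le> ennreal B * ?e n c" if c: "c \<in> {a, b}" for n c
  proof -
    have [measurable]: "side c \<in> sets \<M>" by (intro sets_boundary borel_side side_subset_frontier c)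
    have "(\<integral>\<^sup>+x\<in>side c. norm (F n x * \<psi> x - G n x * \<psi> x) \<partial>\<M>) \<le>
      (\<integral>\<^sup>+x. ennreal B * (ennreal (norm (F n x - tf x)) * indicator (side c) x + ennreal (norm (G n x - tg x)) * indicator (side c) x) \<partial>\<M>)"
    proof (rule nn_integral_mono_AE, rule AE_mp[OF eq], intro AE_I2 impI)
      fix x assume t: "x \<in> side a \<union> side b \<longrightarrow> tf x = tg x"
      show "ennreal (norm (F n x * \<psi> x - G n x * \<psi> x)) * indicator (side c) x \<le>
         ennreal B * (ennreal (norm (F n x - tf x)) * indicator (side c) x + ennreal (norm (G n x - tg x)) * indicator (side c) x)"
      proof (cases "x \<in> side c")
        case True
        then have "tf x = tg x" using t c by auto
        then have "norm (F n x - G n x) \<le> norm (F n x - tf x) + norm (G n x - tg x)"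
          using norm_triangle_ineq4[of "F n x - tf x" "G n x - tg x"] by simp
        then have "norm (F n x * \<psi> x - G n x * \<psi> x) \<le> B * (norm (F n x - tf x) + norm (G n x - tg x))"
          unfolding left_diff_distrib[symmetric] norm_mult using B
          by (subst mult.commute) (intro mult_mono; auto intro: less_imp_le)
        then show ?thesis using True B
          by (simp add: ennreal_mult[symmetric] ennreal_plus[symmetric] ennreal_leI del: ennreal_plus)
      qed simp
    qed
    also have "\<dots> = ennreal B * ?e n c"
      by (simp add: nn_integral_cmult nn_integral_add)
    finally show ?thesis .
  qed
  \<comment> \<open>The limit of \<open>?D\<close> is found twice: 0 by the boundary estimate, and
    the sought combination of integrals by the product rule.\<close>
  let ?D = "\<lambda>n. (LINT x|\<L>. pderiv_at k (\<lambda>x. F n x * \<psi> x) x) - (LINT x|\<L>. pderiv_at k (\<lambda>x. G n x * \<psi> x) x)"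
  have bound: "ennreal (norm (?D n)) \<le> ennreal C * (ennreal B * ?e n a + ennreal B * ?e n b)" for n
  proof -
    let ?H = "\<lambda>x. F n x * \<psi> x - G n x * \<psi> x"
    have c1: "C_k (Suc 0) (\<lambda>x. F n x * \<psi> x)" "C_k (Suc 0) (\<lambda>x. G n x * \<psi> x)" by (intro C_k_mult FG \<psi>)+
    have c2: "C_k (Suc 0) ?H" by (intro C_k_diff c1)
    have "?H = (\<lambda>x. (F n x - G n x) * \<psi> x)" by (simp add: left_diff_distrib)
    then have s: "supp ?H \<subseteq> supp \<psi>" using supp_mult[of "\<lambda>x. F n x - G n x" \<psi>] by simp
    have i: "integrable \<L> (pderiv_at k u)" if "C_k (Suc 0) u" "compact (supp u)" for u
      using that by (intro integrable_domain_continuous compact_supp_subset[OF that(2) supp_pderiv_at]) auto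
    have e: "pderiv_at k ?H = (\<lambda>x. pderiv_at k (\<lambda>x. F n x * \<psi> x) x - pderiv_at k (\<lambda>x. G n x * \<psi> x) x)"
      by (intro ext pderiv_at_diff differentiable_pointwiseE[OF c1(1)] differentiable_pointwiseE[OF c1(2)])
    have cs: "compact (supp (\<lambda>x. F n x * \<psi> x))" "compact (supp (\<lambda>x. G n x * \<psi> x))" "compact (supp ?H)"
      using compact_supp_subset[OF \<psi>(3)] supp_mult s by blast+
    have "?D n = (LINT x|\<L>. pderiv_at k ?H x)"
      unfolding e using i[OF c1(1) cs(1)] i[OF c1(2) cs(2)] by simp
    then have "ennreal (norm (?D n)) \<le> ennreal C * ((\<integral>\<^sup>+x\<in>side a. norm (?H x) \<partial>\<M>) + (\<integral>\<^sup>+x\<in>side b. norm (?H x) \<partial>\<M>))"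
      using C(2)[OF c2 cs(3) order_trans[OF s \<psi>(2)], of k] by (simp only:)
    also have "\<dots> \<le> ennreal C * (ennreal B * ?e n a + ennreal B * ?e n b)"
      by (intro mult_left_mono add_mono side) auto
    finally show ?thesis .
  qed
  have "(\<lambda>n. ennreal C * (ennreal B * ?e n a + ennreal B * ?e n b)) \<longlonglongrightarrow> ennreal C * (ennreal B * (0 + 0) + ennreal B * (0 + 0))"
    by (intro tendsto_mult_ennreal tendsto_add tendsto_const trace_L1_side F G f' g') auto
  then have "(\<lambda>n. ennreal (norm (?D n))) \<longlonglongrightarrow> 0"
    by (intro tendsto_0_le_ennreal[OF _ bound]) simp
  then have "?D \<longlonglongrightarrow> 0" by (rule tendsto_0_ennreal_norm)
  moreover have "?D \<longlonglongrightarrow> ((LINT x|\<L>. weak_pderiv \<Omega> k f x * \<psi> x) + (LINT x|\<L>. f x * pderiv_at k \<psi> x))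
      - ((LINT x|\<L>. weak_pderiv \<Omega> k g x * \<psi> x) + (LINT x|\<L>. g x * pderiv_at k \<psi> x))"
    by (intro tendsto_diff trace_sequence_limit F G f' g' \<psi>)
  ultimately have "((LINT x|\<L>. weak_pderiv \<Omega> k f x * \<psi> x) + (LINT x|\<L>. f x * pderiv_at k \<psi> x))
      - ((LINT x|\<L>. weak_pderiv \<Omega> k g x * \<psi> x) + (LINT x|\<L>. g x * pderiv_at k \<psi> x)) = 0"
    using LIMSEQ_unique by blast
  then show ?thesis by (simp add: algebra_simps)
qed

text \<open>A parallelogram of width \<open>t\<close> along the half of the side \<open>c\<close>
  next to the corner, in the coordinates of \<open>c\<close> and \<open>transversal c\<close>. The
  length \<open>h / 2\<close> leaves room inside the ball for widths up to
  \<open>h / 2\<close>.\<close>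

definition strip :: "real^2 \<Rightarrow> real \<Rightarrow> (real^2) set" where
  "strip c t = {x. 0 < cross2 x (transversal c) / cross2 c (transversal c) \<and>
      cross2 x (transversal c) / cross2 c (transversal c) < h / 2 \<and>
      0 < cross2 c x / cross2 c (transversal c) \<and> cross2 c x / cross2 c (transversal c) < t}"

lemma strip_iff:
  assumes "c \<in> {a, b}"
  shows "s *\<^sub>R c + r *\<^sub>R transversal c \<in> strip c t \<longleftrightarrow> s \<in> {0<..<h/2} \<and> r \<in> {0<..<t}"
  using transversal_props(2)[OF assms] by (auto simp: strip_def cross2_comb)

lemma borel_strip: "c \<in> {a, b} \<Longrightarrow> strip c t \<in> sets borel"
proof -
  assume c: "c \<in> {a, b}"
  have "open (strip c t)"
    unfolding strip_def cross2_def
    by (intro open_Collect_conj open_Collect_less continuous_intros;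
        use transversal_props(2)[OF c] in \<open>simp add: cross2_def\<close>)
  then show ?thesis by (rule borel_open)
qed

lemma strip_subset_domain:
  assumes c: "c \<in> {a, b}" and t: "t \<le> h / 2"
  shows "strip c t \<subseteq> \<Omega> \<inter> ball 0 h"
proof
  fix x assume x: "x \<in> strip c t"
  let ?s = "cross2 x (transversal c) / cross2 c (transversal c)" and ?r = "cross2 c x / cross2 c (transversal c)"
  have e: "x = ?s *\<^sub>R c + ?r *\<^sub>R transversal c" by (rule cross2_coords[OF transversal_props(2)[OF c]])
  have p: "0 < ?s" "?s < h / 2" "0 < ?r" "?r < t" using x unfolding strip_def by blast+
  have "?s *\<^sub>R c + ?r *\<^sub>R transversal c \<in> \<Omega> \<inter> ball 0 h"
    by (rule strip_in_domain[OF c p(1,3)]) (use p t in linarith)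
  then show "x \<in> \<Omega> \<inter> ball 0 h" using e by metis
qed

lemma nn_integral_strip:
  assumes c: "c \<in> {a, b}" and t: "t \<le> h / 2" and [measurable]: "f \<in> borel_measurable borel"
  shows "ennreal \<bar>cross2 c (transversal c)\<bar> * (\<integral>\<^sup>+s\<in>{0<..<h/2}. (\<integral>\<^sup>+r\<in>{0<..<t}. f (s *\<^sub>R c + r *\<^sub>R transversal c) \<partial>lborel) \<partial>lborel)
     = (\<integral>\<^sup>+x\<in>strip c t. f x \<partial>\<L>)"
proof -
  note [measurable] = borel_strip[OF c]
  have "(\<integral>\<^sup>+x\<in>strip c t. f x \<partial>\<L>) = (\<integral>\<^sup>+x\<in>strip c t. f x \<partial>lborel)"
    unfolding nn_integral_domain using strip_subset_domain[OF c t]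
    by (intro nn_integral_cong) (auto simp: indicator_def)
  also have "\<dots> = ennreal \<bar>cross2 c (transversal c)\<bar> * (\<integral>\<^sup>+s. \<integral>\<^sup>+r. f (s *\<^sub>R c + r *\<^sub>R transversal c) * indicator (strip c t) (s *\<^sub>R c + r *\<^sub>R transversal c) \<partial>lborel \<partial>lborel)"
    by (rule nn_integral_lborel_coords[OF transversal_props(2)[OF c]]) measurable
  also have "(\<integral>\<^sup>+s. \<integral>\<^sup>+r. f (s *\<^sub>R c + r *\<^sub>R transversal c) * indicator (strip c t) (s *\<^sub>R c + r *\<^sub>R transversal c) \<partial>lborel \<partial>lborel)
     = (\<integral>\<^sup>+s. \<integral>\<^sup>+r. f (s *\<^sub>R c + r *\<^sub>R transversal c) * indicator {0<..<t} r * indicator {0<..<h/2} s \<partial>lborel \<partial>lborel)"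
    by (intro nn_integral_cong) (auto simp: indicator_def strip_iff[OF c])
  also have "\<dots> = (\<integral>\<^sup>+s\<in>{0<..<h/2}. (\<integral>\<^sup>+r\<in>{0<..<t}. f (s *\<^sub>R c + r *\<^sub>R transversal c) \<partial>lborel) \<partial>lborel)"
    by (intro nn_integral_cong nn_integral_multc) measurable
  finally show ?thesis by simp
qed

text \<open>Each point leaves the strips once \<open>t m\<close> drops below its transversal
  coordinate; dominated convergence does the rest.\<close>

lemma strip_vanishes:
  fixes g :: "real^2 \<Rightarrow> complex"
  assumes c: "c \<in> {a, b}" and g: "integrable \<L> g" and t: "t \<longlonglongrightarrow> 0"
  shows "(\<lambda>m. \<integral>\<^sup>+x\<in>strip c (t m). norm (g x) \<partial>\<L>) \<longlonglongrightarrow> 0"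
proof -
  have [measurable]: "g \<in> borel_measurable \<L>" using g by auto
  have st: "(\<lambda>x. indicator (strip c s) x :: ennreal) \<in> borel_measurable \<L>" for s
    by (intro borel_measurable_domain borel_measurable_indicator borel_strip[OF c])
  note [measurable] = st
  have "(\<lambda>m. \<integral>\<^sup>+x. ennreal (norm (g x)) * indicator (strip c (t m)) x \<partial>\<L>) \<longlonglongrightarrow> (\<integral>\<^sup>+x. 0 \<partial>\<L>)"
  proof (rule nn_integral_dominated_convergence[where w="\<lambda>x. ennreal (norm (g x))"])
    show "(\<integral>\<^sup>+x. ennreal (norm (g x)) \<partial>\<L>) < \<infinity>" using g unfolding integrable_iff_bounded by (rule conjunct2)
    show "AE x in \<L>. (\<lambda>m. ennreal (norm (g x)) * indicator (strip c (t m)) x) \<longlonglongrightarrow> 0"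
    proof (intro AE_I2)
      fix x
      have "\<forall>\<^sub>F m in sequentially. x \<notin> strip c (t m)"
      proof (cases "0 < cross2 c x / cross2 c (transversal c)")
        case True
        then have "\<forall>\<^sub>F m in sequentially. t m < cross2 c x / cross2 c (transversal c)" using order_tendstoD(2)[OF t] by blast
        then show ?thesis by (rule eventually_mono) (simp add: strip_def)
      qed (simp add: strip_def)
      then have "\<forall>\<^sub>F m in sequentially. 0 = ennreal (norm (g x)) * indicator (strip c (t m)) x"
        by (rule eventually_mono) simp
      then show "(\<lambda>m. ennreal (norm (g x)) * indicator (strip c (t m)) x) \<longlonglongrightarrow> 0"
        by (rule Lim_transform_eventually[OF tendsto_const])
    qed
    show "(\<lambda>x. ennreal (norm (g x)) * indicator (strip c (t m)) x) \<in> borel_measurable \<L>" for m by measurable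
    show "AE x in \<L>. ennreal (norm (g x)) * indicator (strip c (t m)) x \<le> ennreal (norm (g x))" for m
      by (auto simp: indicator_def intro!: AE_I2)
  qed auto
  then show ?thesis by simp
qed

text \<open>The fundamental theorem of calculus along the unit vector \<open>transversal c\<close>.
  The integral is extended to the full width \<open>t\<close>, so that the bound does not depend on
  \<open>r\<close>.\<close>

lemma strip_increment:
  assumes c: "c \<in> {a, b}" and F: "C_k (Suc 0) F" and r: "0 < r" "r < t"
  shows "ennreal (norm (F (s *\<^sub>R c) - F (s *\<^sub>R c + r *\<^sub>R transversal c)))
     \<le> (\<integral>\<^sup>+\<rho>\<in>{0<..<t}. (\<Sum>i\<in>UNIV. ennreal (norm (pderiv_at i F (s *\<^sub>R c + \<rho> *\<^sub>R transversal c)))) \<partial>lborel)"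
proof -
  let ?d = "transversal c"
  let ?g = "\<lambda>\<rho>. F (\<rho> *\<^sub>R ?d + s *\<^sub>R c)" and ?g' = "\<lambda>\<rho>. dderiv ?d F (\<rho> *\<^sub>R ?d + s *\<^sub>R c)"
  have c': "continuous_on UNIV ?g'"
    by (rule continuous_on_compose2[OF continuous_dderiv[OF F]]) (auto intro!: continuous_intros)
  have val: "(LINT \<rho>|lborel. indicator {0..r} \<rho> *\<^sub>R ?g' \<rho>) = ?g r - ?g 0"
    using has_bochner_integral_FTC_Icc[of 0 r ?g ?g'] has_vector_derivative_dderiv[OF F] c' r
    by (intro has_bochner_integral_integral_eq) (auto intro: has_vector_derivative_at_within continuous_on_subset)
  have int: "integrable lborel (\<lambda>\<rho>. indicator {0..r} \<rho> *\<^sub>R ?g' \<rho>)"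
    using c' by (intro borel_integrable_compact) (auto intro: continuous_on_subset)
  have "ennreal (norm (?g r - ?g 0)) \<le> (\<integral>\<^sup>+\<rho>. norm (indicator {0..r} \<rho> *\<^sub>R ?g' \<rho>) \<partial>lborel)"
    using integral_norm_bound_ennreal[OF int] unfolding val .
  also have "\<dots> \<le> (\<integral>\<^sup>+\<rho>\<in>{0<..<t}. (\<Sum>i\<in>UNIV. ennreal (norm (pderiv_at i F (s *\<^sub>R c + \<rho> *\<^sub>R ?d)))) \<partial>lborel)"
  proof (rule nn_integral_mono_AE)
    have le: "ennreal (norm (?g' \<rho>)) \<le> (\<Sum>i\<in>UNIV. ennreal (norm (pderiv_at i F (s *\<^sub>R c + \<rho> *\<^sub>R ?d))))" for \<rho>
    proof -
      have "norm (?g' \<rho>) \<le> (\<Sum>i\<in>UNIV. norm (?d $ i *\<^sub>R pderiv_at i F (\<rho> *\<^sub>R ?d + s *\<^sub>R c)))"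
        unfolding dderiv_def by (rule norm_sum)
      also have "\<dots> \<le> (\<Sum>i\<in>UNIV. norm (pderiv_at i F (\<rho> *\<^sub>R ?d + s *\<^sub>R c)))"
        using component_le_norm_cart[of ?d] transversal_props(1)[OF c]
        by (intro sum_mono) (auto intro!: mult_left_le_one_le)
      finally show ?thesis by (simp add: sum_ennreal add.commute ennreal_leI)
    qed
    have "AE \<rho> in lborel. \<rho> \<noteq> (0::real)" by (rule AE_lborel_singleton)
    then show "AE \<rho> in lborel. ennreal (norm (indicator {0..r} \<rho> *\<^sub>R ?g' \<rho>))
        \<le> (\<Sum>i\<in>UNIV. ennreal (norm (pderiv_at i F (s *\<^sub>R c + \<rho> *\<^sub>R ?d)))) * indicator {0<..<t} \<rho>"
      by (rule AE_mp) (intro AE_I2 impI, use le r in \<open>auto simp: indicator_def\<close>)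
  qed
  finally show ?thesis by (simp add: norm_minus_commute add.commute)
qed

text \<open>The smooth approximants of \<open>f\<close> are compared with \<open>f0\<close> by averaging over the strip of width \<open>t\<close> along
  the side: their transversal increments are bounded by the integral of the gradient over the strip,
  which tends to zero with \<open>t\<close>.\<close>
proposition trace_eq_holder_rep:
  assumes f: "has_trace \<Omega> f tf" and f0: "holder_on \<alpha> (closure (\<Omega> \<inter> ball 0 h)) f0" and \<alpha>: "0 < \<alpha>"
    and ae: "AE x in lebesgue_on (\<Omega> \<inter> ball 0 h). f x = f0 x"
    and c: "c \<in> {a, b}"
  shows "AE x in \<M>. x \<in> side c \<and> norm x < h / 2 \<longrightarrow> tf x = f0 x"
proof -
  let ?S = "closure (\<Omega> \<inter> ball 0 h)" and ?d = "transversal c" and ?K = "h / 2"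
  let ?D = "\<bar>cross2 c ?d\<bar>"
  obtain F where F: "\<And>n. test_fun UNIV (F n)" "L2_tendsto \<L> F f"
      "\<And>i. L2_tendsto \<L> (\<lambda>n. pderiv_at i (F n)) (weak_pderiv \<Omega> i f)" "L2_tendsto \<M> F tf"
    and f': "H1 \<Omega> f" "L2 \<M> tf" using f unfolding has_trace_def by blast
  obtain A where A: "\<And>x y. x \<in> ?S \<Longrightarrow> y \<in> ?S \<Longrightarrow> dist (f0 x) (f0 y) \<le> A * dist x y powr \<alpha>"
    using f0 unfolding holder_on_def by blast
  \<comment> \<open>\<open>holder_on\<close> does not fix the sign of its constant.\<close>
  define A' where "A' = max A 0"
  have A': "dist (f0 x) (f0 y) \<le> A' * dist x y powr \<alpha>" if "x \<in> ?S" "y \<in> ?S" for x y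
    by (rule order_trans[OF A[OF that]]) (auto simp: A'_def intro: mult_right_mono)
  have A'0: "A' \<ge> 0" by (simp add: A'_def)
  have contf0: "continuous_on ?S f0" by (rule holder_on_imp_continuous_on[OF f0 \<alpha>])
  \<comment> \<open>\<open>f0\<close> is controlled only on the closure of the corner region; its
    extension by 0 is Borel measurable on the plane, as the integrals require.\<close>
  define f1 where "f1 x = indicator ?S x *\<^sub>R f0 x" for x
  have f1 [measurable]: "f1 \<in> borel_measurable borel"
    unfolding f1_def[abs_def] by (rule borel_measurable_continuous_on_indicator[OF _ contf0]) simp
  have f1eq: "x \<in> ?S \<Longrightarrow> f1 x = f0 x" for x by (simp add: f1_def)
  have FC: "C_k (Suc 0) (F n)" for n using F(1) by (auto simp: test_fun_def)
  have Fc: "continuous_on UNIV (F n)" "continuous_on UNIV (pderiv_at i (F n))" for n i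
    using C_k_continuous[OF FC] FC[of n] by auto
  have Fm [measurable]: "F n \<in> borel_measurable borel" "pderiv_at i (F n) \<in> borel_measurable borel" for n i
    using Fc by (auto intro: borel_measurable_continuous_onI)
  have fm [measurable]: "f \<in> borel_measurable \<L>" "weak_pderiv \<Omega> i f \<in> borel_measurable \<L>" for i
    using f' weak_pderiv_L2[OF f'(1)] by (auto simp: H1_def L2_def)
  have FmL [measurable]: "F n \<in> borel_measurable \<L>" "pderiv_at i (F n) \<in> borel_measurable \<L>" "f1 \<in> borel_measurable \<L>" for n i
    using borel_measurable_domain Fm f1 by blast+
  define X where "X n = (\<integral>\<^sup>+s\<in>{0<..<?K}. norm (F n (s *\<^sub>R c) - f1 (s *\<^sub>R c)) \<partial>lborel)" for n
  define E where "E i n = (\<integral>\<^sup>+x\<in>space \<L>. norm (pderiv_at i (F n) x - weak_pderiv \<Omega> i f x) \<partial>\<L>)" for i n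
  define B where "B n = (\<integral>\<^sup>+x\<in>space \<L>. norm (F n x - f x) \<partial>\<L>)" for n
  define V where "V i t = (\<integral>\<^sup>+x\<in>strip c t. norm (weak_pderiv \<Omega> i f x) \<partial>\<L>)" for i t
  have stm [measurable]: "(\<lambda>x. indicator (strip c t) x :: ennreal) \<in> borel_measurable \<L>" for t
    by (intro borel_measurable_domain borel_measurable_indicator borel_strip[OF c])
  \<comment> \<open>The triangle inequality through the shifted point \<open>s c + r d\<close>, with
    \<open>d = transversal c\<close>, integrated over \<open>0 < r < t\<close>. \<open>E\<close> and
    \<open>B\<close> are errors of the approximants, \<open>V\<close> is the gradient mass of the
    strip, and the last term is the Hoelder modulus at distance \<open>t\<close>.\<close>
  have main: "ennreal t * (ennreal ?D * X n) \<le> ennreal t * (\<Sum>i\<in>UNIV. E i n + V i t) + B n + ennreal t * ennreal (?D * ?K * A' * t powr \<alpha>)"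
    if t: "0 < t" "t \<le> ?K" for t n
  proof -
    let ?P = "\<lambda>s. (\<integral>\<^sup>+\<rho>\<in>{0<..<t}. (\<Sum>i\<in>UNIV. ennreal (norm (pderiv_at i (F n) (s *\<^sub>R c + \<rho> *\<^sub>R ?d)))) \<partial>lborel)"
    let ?Q = "\<lambda>s. (\<integral>\<^sup>+r\<in>{0<..<t}. ennreal (norm (F n (s *\<^sub>R c + r *\<^sub>R ?d) - f1 (s *\<^sub>R c + r *\<^sub>R ?d))) \<partial>lborel)"
    have len: "(\<integral>\<^sup>+r\<in>{0<..<t}. k \<partial>lborel) = ennreal t * k" for k :: ennreal
      using t by (simp add: nn_integral_cmult_indicator mult.commute)
    have pt: "ennreal t * ennreal (norm (F n (s *\<^sub>R c) - f1 (s *\<^sub>R c))) \<le> ennreal t * ?P s + ?Q s + ennreal t * ennreal (A' * t powr \<alpha>)"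
      if s: "s \<in> {0<..<?K}" for s
    proof -
      have "ennreal t * ennreal (norm (F n (s *\<^sub>R c) - f1 (s *\<^sub>R c))) = (\<integral>\<^sup>+r\<in>{0<..<t}. ennreal (norm (F n (s *\<^sub>R c) - f1 (s *\<^sub>R c))) \<partial>lborel)"
        by (rule len[symmetric])
      also have "\<dots> \<le> (\<integral>\<^sup>+r. (?P s + ennreal (A' * t powr \<alpha>)) * indicator {0<..<t} r + ennreal (norm (F n (s *\<^sub>R c + r *\<^sub>R ?d) - f1 (s *\<^sub>R c + r *\<^sub>R ?d))) * indicator {0<..<t} r \<partial>lborel)"
      proof (rule nn_integral_mono)
        fix r
        show "ennreal (norm (F n (s *\<^sub>R c) - f1 (s *\<^sub>R c))) * indicator {0<..<t} r \<le>
           (?P s + ennreal (A' * t powr \<alpha>)) * indicator {0<..<t} r + ennreal (norm (F n (s *\<^sub>R c + r *\<^sub>R ?d) - f1 (s *\<^sub>R c + r *\<^sub>R ?d))) * indicator {0<..<t} r"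
        proof (cases "r \<in> {0<..<t}")
          case True
          let ?y = "s *\<^sub>R c + r *\<^sub>R ?d"
          have yS: "?y \<in> ?S" by (intro subsetD[OF closure_subset] strip_in_domain c) (use s True t in auto)
          have xS: "s *\<^sub>R c \<in> ?S" using side_closure[OF c, of s] s h_pos by auto
          have "dist ?y (s *\<^sub>R c) = r" using True transversal_props(1)[OF c] by (simp add: dist_norm)
          then have "norm (f0 ?y - f0 (s *\<^sub>R c)) \<le> A' * r powr \<alpha>" using A'[OF yS xS] by (simp add: dist_norm)
          also have "\<dots> \<le> A' * t powr \<alpha>" using True A'0 \<alpha> by (intro mult_left_mono powr_mono2) auto
          finally have h0: "norm (f1 ?y - f1 (s *\<^sub>R c)) \<le> A' * t powr \<alpha>" by (simp add: f1eq[OF yS] f1eq[OF xS])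
          have "norm (F n (s *\<^sub>R c) - f1 (s *\<^sub>R c)) \<le> norm (F n (s *\<^sub>R c) - F n ?y) + norm (F n ?y - f1 ?y) + norm (f1 ?y - f1 (s *\<^sub>R c))"
            using norm_triangle_ineq[of "(F n (s *\<^sub>R c) - F n ?y) + (F n ?y - f1 ?y)" "f1 ?y - f1 (s *\<^sub>R c)"]
              norm_triangle_ineq[of "F n (s *\<^sub>R c) - F n ?y" "F n ?y - f1 ?y"] by simp
          also have "\<dots> \<le> norm (F n (s *\<^sub>R c) - F n ?y) + norm (F n ?y - f1 ?y) + A' * t powr \<alpha>"
            using h0 by simp
          finally have "ennreal (norm (F n (s *\<^sub>R c) - f1 (s *\<^sub>R c))) \<le> ennreal (norm (F n (s *\<^sub>R c) - F n ?y) + norm (F n ?y - f1 ?y) + A' * t powr \<alpha>)"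
            by (rule ennreal_leI)
          also have "\<dots> = ennreal (norm (F n (s *\<^sub>R c) - F n ?y)) + ennreal (norm (F n ?y - f1 ?y)) + ennreal (A' * t powr \<alpha>)"
            using A'0 by simp
          also have "\<dots> \<le> ?P s + ennreal (norm (F n ?y - f1 ?y)) + ennreal (A' * t powr \<alpha>)"
            using True by (intro add_right_mono strip_increment[OF c FC]) auto
          finally show ?thesis using True by (simp add: ac_simps)
        qed simp
      qed
      also have "\<dots> = (\<integral>\<^sup>+r\<in>{0<..<t}. (?P s + ennreal (A' * t powr \<alpha>)) \<partial>lborel) + ?Q s"
        by (rule nn_integral_add) measurable
      also have "\<dots> = ennreal t * ?P s + ?Q s + ennreal t * ennreal (A' * t powr \<alpha>)"
        unfolding len by (simp add: distrib_left ac_simps)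
      finally show ?thesis .
    qed
    have "ennreal t * X n = (\<integral>\<^sup>+s. ennreal t * (ennreal (norm (F n (s *\<^sub>R c) - f1 (s *\<^sub>R c))) * indicator {0<..<?K} s) \<partial>lborel)"
      unfolding X_def by (rule nn_integral_cmult[symmetric]) measurable
    also have "\<dots> \<le> (\<integral>\<^sup>+s. ennreal t * (?P s * indicator {0<..<?K} s) + ?Q s * indicator {0<..<?K} s + ennreal t * ennreal (A' * t powr \<alpha>) * indicator {0<..<?K} s \<partial>lborel)"
    proof (rule nn_integral_mono)
      fix s
      show "ennreal t * (ennreal (norm (F n (s *\<^sub>R c) - f1 (s *\<^sub>R c))) * indicator {0<..<?K} s) \<le>
        ennreal t * (?P s * indicator {0<..<?K} s) + ?Q s * indicator {0<..<?K} s + ennreal t * ennreal (A' * t powr \<alpha>) * indicator {0<..<?K} s"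
        using pt[of s] by (cases "s \<in> {0<..<?K}") simp_all
    qed
    also have "\<dots> = ennreal t * (\<integral>\<^sup>+s\<in>{0<..<?K}. ?P s \<partial>lborel) + (\<integral>\<^sup>+s\<in>{0<..<?K}. ?Q s \<partial>lborel) + ennreal t * ennreal (A' * t powr \<alpha>) * ennreal ?K"
      using h_pos by (simp add: nn_integral_add nn_integral_cmult nn_integral_cmult_indicator)
    \<comment> \<open>\<open>?D\<close> is the Jacobian that turns the iterated integrals into
      integrals over the strip.\<close>
    finally have "ennreal ?D * (ennreal t * X n) \<le> ennreal ?D * (ennreal t * (\<integral>\<^sup>+s\<in>{0<..<?K}. ?P s \<partial>lborel) + (\<integral>\<^sup>+s\<in>{0<..<?K}. ?Q s \<partial>lborel) + ennreal t * ennreal (A' * t powr \<alpha>) * ennreal ?K)"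
      by (rule mult_left_mono) simp
    also have "\<dots> = ennreal t * (ennreal ?D * (\<integral>\<^sup>+s\<in>{0<..<?K}. ?P s \<partial>lborel)) + ennreal ?D * (\<integral>\<^sup>+s\<in>{0<..<?K}. ?Q s \<partial>lborel) + ennreal t * (ennreal ?D * ennreal ?K * ennreal (A' * t powr \<alpha>))"
      by (simp add: distrib_left ac_simps)
    also have "ennreal ?D * ennreal ?K * ennreal (A' * t powr \<alpha>) = ennreal (?D * ?K * A' * t powr \<alpha>)"
      using h_pos A'0 by (simp add: ennreal_mult[symmetric] mult.assoc)
    finally have step: "ennreal ?D * (ennreal t * X n) \<le> ennreal t * (ennreal ?D * (\<integral>\<^sup>+s\<in>{0<..<?K}. ?P s \<partial>lborel))
        + ennreal ?D * (\<integral>\<^sup>+s\<in>{0<..<?K}. ?Q s \<partial>lborel) + ennreal t * ennreal (?D * ?K * A' * t powr \<alpha>)" .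
    have "ennreal ?D * (\<integral>\<^sup>+s\<in>{0<..<?K}. ?P s \<partial>lborel) = (\<integral>\<^sup>+x\<in>strip c t. (\<Sum>i\<in>UNIV. ennreal (norm (pderiv_at i (F n) x))) \<partial>\<L>)"
      by (rule nn_integral_strip[OF c t(2)]) measurable
    also have "\<dots> \<le> (\<Sum>i\<in>UNIV. E i n + V i t)"
    proof -
      have "(\<integral>\<^sup>+x\<in>strip c t. (\<Sum>i\<in>UNIV. ennreal (norm (pderiv_at i (F n) x))) \<partial>\<L>) = (\<Sum>i\<in>UNIV. \<integral>\<^sup>+x\<in>strip c t. ennreal (norm (pderiv_at i (F n) x)) \<partial>\<L>)"
        unfolding sum_distrib_right by (rule nn_integral_sum) measurable
      also have "\<dots> \<le> (\<Sum>i\<in>UNIV. E i n + V i t)"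
      proof (rule sum_mono)
        fix i :: 2
        have "(\<integral>\<^sup>+x\<in>strip c t. ennreal (norm (pderiv_at i (F n) x)) \<partial>\<L>) \<le>
          (\<integral>\<^sup>+x. ennreal (norm (pderiv_at i (F n) x - weak_pderiv \<Omega> i f x)) * indicator (space \<L>) x + ennreal (norm (weak_pderiv \<Omega> i f x)) * indicator (strip c t) x \<partial>\<L>)"
        proof (rule nn_integral_mono)
          fix x assume x: "x \<in> space \<L>"
          have "norm (pderiv_at i (F n) x) \<le> norm (pderiv_at i (F n) x - weak_pderiv \<Omega> i f x) + norm (weak_pderiv \<Omega> i f x)"
            using norm_triangle_ineq[of "pderiv_at i (F n) x - weak_pderiv \<Omega> i f x" "weak_pderiv \<Omega> i f x"] by simp
          then have "ennreal (norm (pderiv_at i (F n) x)) \<le> ennreal (norm (pderiv_at i (F n) x - weak_pderiv \<Omega> i f x)) + ennreal (norm (weak_pderiv \<Omega> i f x))"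
            by (simp add: ennreal_plus[symmetric] ennreal_leI del: ennreal_plus)
          then show "ennreal (norm (pderiv_at i (F n) x)) * indicator (strip c t) x \<le> ennreal (norm (pderiv_at i (F n) x - weak_pderiv \<Omega> i f x)) * indicator (space \<L>) x + ennreal (norm (weak_pderiv \<Omega> i f x)) * indicator (strip c t) x"
            using x by (cases "x \<in> strip c t") simp_all
        qed
        also have "\<dots> = E i n + V i t" unfolding E_def V_def by (rule nn_integral_add) measurable
        finally show "(\<integral>\<^sup>+x\<in>strip c t. ennreal (norm (pderiv_at i (F n) x)) \<partial>\<L>) \<le> E i n + V i t" .
      qed
      finally show ?thesis .
    qed
    finally have P_le: "ennreal ?D * (\<integral>\<^sup>+s\<in>{0<..<?K}. ?P s \<partial>lborel) \<le> (\<Sum>i\<in>UNIV. E i n + V i t)" .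
    have "ennreal ?D * (\<integral>\<^sup>+s\<in>{0<..<?K}. ?Q s \<partial>lborel) = (\<integral>\<^sup>+x\<in>strip c t. ennreal (norm (F n x - f1 x)) \<partial>\<L>)"
      by (rule nn_integral_strip[OF c t(2)]) measurable
    also have "\<dots> \<le> B n"
      unfolding B_def
    proof (rule nn_integral_mono_AE)
      have "AE x in lebesgue. x \<in> \<Omega> \<inter> ball 0 h \<longrightarrow> f x = f0 x"
        using ae by (subst (asm) AE_restrict_space_iff) (simp_all add: open_domain borel_open open_Int)
      then have "AE x in \<L>. x \<in> \<Omega> \<inter> ball 0 h \<longrightarrow> f x = f0 x"
        by (subst AE_restrict_space_iff) auto
      then show "AE x in \<L>. ennreal (norm (F n x - f1 x)) * indicator (strip c t) x \<le> ennreal (norm (F n x - f x)) * indicator (space \<L>) x"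
      proof (rule AE_mp, intro AE_I2 impI)
        fix x assume x: "x \<in> space \<L>" "x \<in> \<Omega> \<inter> ball 0 h \<longrightarrow> f x = f0 x"
        show "ennreal (norm (F n x - f1 x)) * indicator (strip c t) x \<le> ennreal (norm (F n x - f x)) * indicator (space \<L>) x"
        proof (cases "x \<in> strip c t")
          case True
          then have xB: "x \<in> \<Omega> \<inter> ball 0 h" by (rule subsetD[OF strip_subset_domain[OF c t(2)]])
          then have "x \<in> ?S" by (rule subsetD[OF closure_subset])
          then have "f1 x = f x" using x(2) xB by (simp only: f1eq simp_thms)
          then show ?thesis using x(1) by (simp add: indicator_def)
        qed simp
      qed
    qed
    finally have Q_le: "ennreal ?D * (\<integral>\<^sup>+s\<in>{0<..<?K}. ?Q s \<partial>lborel) \<le> B n" .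
    have "ennreal t * (ennreal ?D * X n) = ennreal ?D * (ennreal t * X n)" by (simp only: ac_simps)
    also note step
    also have "ennreal t * (ennreal ?D * (\<integral>\<^sup>+s\<in>{0<..<?K}. ?P s \<partial>lborel))
        + ennreal ?D * (\<integral>\<^sup>+s\<in>{0<..<?K}. ?Q s \<partial>lborel) + ennreal t * ennreal (?D * ?K * A' * t powr \<alpha>)
      \<le> ennreal t * (\<Sum>i\<in>UNIV. E i n + V i t) + B n + ennreal t * ennreal (?D * ?K * A' * t powr \<alpha>)"
      by (intro add_mono mult_left_mono P_le Q_le order_refl zero_le)
    finally show ?thesis .
  qed
  have Dpos: "?D > 0" using transversal_props(2)[OF c] by simp
  define t where "t m = ?K / real (Suc m)" for m
  have tm: "0 < t m" "t m \<le> ?K" for m using h_pos by (auto simp: t_def field_simps)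
  have "(\<lambda>m. ?K * (1 / real (Suc m))) \<longlonglongrightarrow> ?K * 0"
    by (intro tendsto_intros LIMSEQ_Suc lim_1_over_n)
  then have t0: "t \<longlonglongrightarrow> 0" by (simp add: t_def[abs_def])
  have "(\<lambda>n. ennreal ?D * X n) \<longlonglongrightarrow> 0"
  proof (rule tendsto_0_double_ennreal)
    fix m n
    have "ennreal (1 / t m) * (ennreal (t m) * (ennreal ?D * X n)) \<le> ennreal (1 / t m) * (ennreal (t m) * (\<Sum>i\<in>UNIV. E i n + V i (t m)) + B n + ennreal (t m) * ennreal (?D * ?K * A' * t m powr \<alpha>))"
      by (intro mult_left_mono main tm) simp
    moreover have cancel: "ennreal (1 / t m) * (ennreal (t m) * k) = k" for k
      using tm(1)[of m] by (simp add: mult.assoc[symmetric] ennreal_mult[symmetric])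
    ultimately have "ennreal ?D * X n \<le> (\<Sum>i\<in>UNIV. E i n + V i (t m)) + ennreal (1 / t m) * B n + ennreal (?D * ?K * A' * t m powr \<alpha>)"
      by (simp only: distrib_left cancel)
    \<comment> \<open>After division by \<open>t m\<close> the terms are sorted into a part that
      vanishes in \<open>n\<close> for fixed \<open>m\<close>, in spite of the factor
      \<open>1 / t m\<close>, and a part that depends on \<open>m\<close> only.\<close>
    then show "ennreal ?D * X n \<le> ((\<Sum>i\<in>UNIV. E i n) + ennreal (1 / t m) * B n) + ((\<Sum>i\<in>UNIV. V i (t m)) + ennreal (?D * ?K * A' * t m powr \<alpha>))"
      by (simp add: sum.distrib ac_simps)
  next
    fix m
    have "(\<lambda>n. (\<Sum>i\<in>UNIV. E i n) + ennreal (1 / t m) * B n) \<longlonglongrightarrow> (\<Sum>i\<in>(UNIV::2 set). 0) + ennreal (1 / t m) * 0"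
      unfolding E_def B_def using finite_domain
      by (intro tendsto_add tendsto_sum tendsto_mult_ennreal tendsto_const L2_tendsto_L1 F FmL fm) auto
    then show "(\<lambda>n. (\<Sum>i\<in>UNIV. E i n) + ennreal (1 / t m) * B n) \<longlonglongrightarrow> 0" by simp
  next
    have 1: "(\<lambda>m. ?D * ?K * A' * t m powr \<alpha>) \<longlonglongrightarrow> ?D * ?K * A' * 0"
      using \<alpha> tm by (intro tendsto_mult tendsto_const tendsto_zero_powrI[OF t0 tendsto_const] always_eventually) (auto intro: less_imp_le)
    have "(\<lambda>m. ennreal (?D * ?K * A' * t m powr \<alpha>)) \<longlonglongrightarrow> ennreal 0"
      using tendsto_ennrealI[OF 1] by simp
    moreover have "(\<lambda>m. \<Sum>i\<in>UNIV. V i (t m)) \<longlonglongrightarrow> (\<Sum>i\<in>(UNIV::2 set). 0)"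
      unfolding V_def
      by (intro tendsto_sum strip_vanishes[OF c _ t0] L2_integrable[OF weak_pderiv_L2[OF f'(1)] finite_domain])
    ultimately show "(\<lambda>m. (\<Sum>i\<in>UNIV. V i (t m)) + ennreal (?D * ?K * A' * t m powr \<alpha>)) \<longlonglongrightarrow> 0"
      using tendsto_add by fastforce
  qed
  then have "(\<lambda>n. ennreal (1 / ?D) * (ennreal ?D * X n)) \<longlonglongrightarrow> ennreal (1 / ?D) * 0"
    by (intro tendsto_mult_ennreal tendsto_const) auto
  moreover have "ennreal (1 / ?D) * (ennreal ?D * k) = k" for k
    using Dpos by (simp add: mult.assoc[symmetric] ennreal_mult[symmetric] del: abs_divide)
  ultimately have X0: "X \<longlonglongrightarrow> 0" by simp
  \<comment> \<open>\<open>?N\<close> does not depend on \<open>n\<close>, so a bound that tends to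
    0 makes it vanish.\<close>
  let ?N = "(\<integral>\<^sup>+x\<in>side c. ennreal (norm (tf x - f1 x)) * indicator (ball 0 ?K) x \<partial>\<M>)"
  have tfm [measurable]: "tf \<in> borel_measurable \<M>" using f' by (simp add: L2_def)
  have M1 [measurable]: "F n \<in> borel_measurable \<M>" "f1 \<in> borel_measurable \<M>" for n
    using measurable_boundary Fm f1 by blast+
  have sM [measurable]: "side c \<in> sets \<M>" by (intro sets_boundary borel_side side_subset_frontier c)
  have bM [measurable]: "(\<lambda>x. indicator (ball 0 ?K) x :: ennreal) \<in> borel_measurable \<M>" by (intro measurable_boundary borel_measurable_indicator borel_open open_ball)
  have "?N \<le> (\<integral>\<^sup>+x\<in>side c. norm (F n x - tf x) \<partial>\<M>) + X n" for n
  proof -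
    have X: "X n = (\<integral>\<^sup>+x\<in>side c. ennreal (norm (F n x - f1 x)) * indicator (ball 0 ?K) x \<partial>\<M>)"
    proof -
      have "(\<integral>\<^sup>+x\<in>side c. ennreal (norm (F n x - f1 x)) * indicator (ball 0 ?K) x \<partial>\<M>)
        = (\<integral>\<^sup>+s\<in>{0<..<h}. ennreal (norm (F n (s *\<^sub>R c) - f1 (s *\<^sub>R c))) * indicator (ball 0 ?K) (s *\<^sub>R c) \<partial>lborel)"
        by (rule nn_integral_side[OF c]) (intro borel_measurable_times_ennreal borel_measurable_indicator borel_open open_ball; measurable)
      also have "\<dots> = X n" unfolding X_def
        using side_norm[OF c] h_pos by (intro nn_integral_cong) (auto simp: indicator_def)
      finally show ?thesis by simp
    qed
    have "?N \<le> (\<integral>\<^sup>+x. ennreal (norm (F n x - tf x)) * indicator (side c) x + ennreal (norm (F n x - f1 x)) * indicator (ball 0 ?K) x * indicator (side c) x \<partial>\<M>)"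
    proof (rule nn_integral_mono)
      fix x
      have "norm (tf x - f1 x) \<le> norm (F n x - tf x) + norm (F n x - f1 x)"
        using norm_triangle_ineq4[of "F n x - f1 x" "F n x - tf x"] by simp
      then have "ennreal (norm (tf x - f1 x)) \<le> ennreal (norm (F n x - tf x)) + ennreal (norm (F n x - f1 x))"
        by (simp add: ennreal_plus[symmetric] ennreal_leI del: ennreal_plus)
      then show "ennreal (norm (tf x - f1 x)) * indicator (ball 0 ?K) x * indicator (side c) x \<le>
         ennreal (norm (F n x - tf x)) * indicator (side c) x + ennreal (norm (F n x - f1 x)) * indicator (ball 0 ?K) x * indicator (side c) x"
        by (auto simp: indicator_def)
    qed
    also have "\<dots> = (\<integral>\<^sup>+x\<in>side c. norm (F n x - tf x) \<partial>\<M>) + X n"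
      unfolding X by (rule nn_integral_add) measurable
    finally show ?thesis .
  qed
  moreover have "(\<lambda>n. (\<integral>\<^sup>+x\<in>side c. norm (F n x - tf x) \<partial>\<M>) + X n) \<longlonglongrightarrow> 0 + 0"
    by (intro tendsto_add X0 trace_L1_side F f' c)
  ultimately have "?N \<le> 0 + 0"
    by (intro LIMSEQ_le_const[of _ "0 + 0"]) auto
  then have "?N = 0" by simp
  then have "AE x in \<M>. ennreal (norm (tf x - f1 x)) * indicator (ball 0 ?K) x * indicator (side c) x = 0"
    by (subst (asm) nn_integral_0_iff_AE) measurable
  then show ?thesis
  proof (rule AE_mp, intro AE_I2 impI)
    fix x assume e: "ennreal (norm (tf x - f1 x)) * indicator (ball 0 ?K) x * indicator (side c) x = 0" "x \<in> side c \<and> norm x < ?K"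
    then have "tf x = f1 x" by (simp add: indicator_def ennreal_eq_0_iff)
    moreover have "x \<in> (\<lambda>s. s *\<^sub>R c) ` {0<..<h}" using e(2) by (simp only: side_def)
    then obtain s where "x = s *\<^sub>R c" "s \<in> {0<..<h}" by (rule imageE)
    ultimately show "tf x = f0 x" using f1eq side_closure[OF c, of s] by simp
  qed
qed

end

section \<open>Removing the corner from the boundary condition\<close>

context corner_domain
begin

lemma zero_notin_domain: "0 \<notin> \<Omega>"
  using side_frontier[of a 0] h_pos open_domain by (simp add: frontier_def interior_open)

text \<open>A cutoff at scale \<open>1 / n\<close> has a gradient of size \<open>n\<close> on a disk
  of area of order \<open>1 / n^2\<close>. By Cauchy-Schwarz these two cancel, and the square
  integral of \<open>g\<close> over the shrinking disks tends to 0.\<close>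

lemma L2_concentrated:
  assumes g: "L2 \<L> g"
  shows "(\<lambda>n. \<integral>\<^sup>+x\<in>cball 0 (2 / real (Suc n)). ennreal (real (Suc n) * norm (g x)) \<partial>\<L>) \<longlonglongrightarrow> 0"
proof -
  let ?B = "\<lambda>n. cball (0::real^2) (2 / real (Suc n))"
  have [measurable]: "g \<in> borel_measurable \<L>" using g by (simp add: L2_def)
  have im [measurable]: "(\<lambda>x. indicator (?B n) x :: ennreal) \<in> borel_measurable \<L>" for n
    by (intro borel_measurable_domain borel_measurable_indicator) simp
  \<comment> \<open>The area of the disk of radius \<open>2 / Suc n\<close> times the square of
    \<open>Suc n\<close>.\<close>
  let ?V = "ennreal (4 * unit_ball_vol 2)"
  let ?G = "\<lambda>n. \<integral>\<^sup>+x\<in>?B n. ennreal ((norm (g x))\<^sup>2) \<partial>\<L>"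
  let ?X = "\<lambda>n. \<integral>\<^sup>+x\<in>?B n. ennreal (real (Suc n) * norm (g x)) \<partial>\<L>"
  have vol: "(\<integral>\<^sup>+x. (ennreal (real (Suc n)) * indicator (?B n) x)\<^sup>2 \<partial>\<L>) \<le> ?V" for n
  proof -
    have "(\<integral>\<^sup>+x. (ennreal (real (Suc n)) * indicator (?B n) x)\<^sup>2 \<partial>\<L>) \<le> (\<integral>\<^sup>+x. ennreal ((real (Suc n))\<^sup>2) * indicator (?B n) x \<partial>lborel)"
      unfolding nn_integral_domain
      by (intro nn_integral_mono) (auto simp: indicator_def power2_eq_square ennreal_mult[symmetric] simp del: of_nat_Suc)
    also have "\<dots> = ennreal ((real (Suc n))\<^sup>2) * ennreal (unit_ball_vol 2 * (2 / real (Suc n))\<^sup>2)"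
      by (simp add: nn_integral_cmult_indicator emeasure_cball)
    also have "\<dots> = ?V"
      by (simp add: ennreal_mult[symmetric] field_simps power2_eq_square del: of_nat_Suc)
    finally show ?thesis .
  qed
  have CS: "(?X n)\<^sup>2 \<le> ?G n * ?V" for n
  proof -
    have "?X n = (\<integral>\<^sup>+x. (ennreal (norm (g x)) * indicator (?B n) x) * (ennreal (real (Suc n)) * indicator (?B n) x) \<partial>\<L>)"
      by (intro nn_integral_cong) (auto simp: indicator_def ennreal_mult[symmetric] mult.commute simp del: of_nat_Suc)
    then have "(?X n)\<^sup>2 \<le> (\<integral>\<^sup>+x. (ennreal (norm (g x)) * indicator (?B n) x)\<^sup>2 \<partial>\<L>) * (\<integral>\<^sup>+x. (ennreal (real (Suc n)) * indicator (?B n) x)\<^sup>2 \<partial>\<L>)"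
      by (simp only:) (rule Cauchy_Schwarz_nn_integral; measurable)
    also have "(\<integral>\<^sup>+x. (ennreal (norm (g x)) * indicator (?B n) x)\<^sup>2 \<partial>\<L>) = ?G n"
      by (intro nn_integral_cong) (auto simp: indicator_def ennreal_power)
    also have "?G n * (\<integral>\<^sup>+x. (ennreal (real (Suc n)) * indicator (?B n) x)\<^sup>2 \<partial>\<L>) \<le> ?G n * ?V"
      by (intro mult_left_mono vol) simp
    finally show ?thesis .
  qed
  have "?G \<longlonglongrightarrow> (\<integral>\<^sup>+x. 0 \<partial>\<L>)"
  proof (rule nn_integral_dominated_convergence[where w="\<lambda>x. ennreal ((norm (g x))\<^sup>2)"])
    show "(\<integral>\<^sup>+x. ennreal ((norm (g x))\<^sup>2) \<partial>\<L>) < \<infinity>" using g unfolding L2_def integrable_iff_bounded by simp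
    show "(\<lambda>x. ennreal ((norm (g x))\<^sup>2) * indicator (?B n) x) \<in> borel_measurable \<L>" for n by measurable
    show "AE x in \<L>. ennreal ((norm (g x))\<^sup>2) * indicator (?B n) x \<le> ennreal ((norm (g x))\<^sup>2)" for n
      by (auto simp: indicator_def intro!: AE_I2)
    show "AE x in \<L>. (\<lambda>n. ennreal ((norm (g x))\<^sup>2) * indicator (?B n) x) \<longlonglongrightarrow> 0"
    proof (intro AE_I2)
      fix x assume "x \<in> space \<L>"
      then have "x \<noteq> 0" using zero_notin_domain by (auto simp: space_restrict_space)
      moreover have "(\<lambda>n. 2 * (1 / real (Suc n))) \<longlonglongrightarrow> 2 * 0"
        by (intro tendsto_intros LIMSEQ_Suc lim_1_over_n)
      ultimately have "\<forall>\<^sub>F n in sequentially. 2 / real (Suc n) < norm x"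
        using order_tendstoD(2)[of "\<lambda>n. 2 * (1 / real (Suc n))" 0 sequentially "norm x"] by simp
      then have "\<forall>\<^sub>F n in sequentially. 0 = ennreal ((norm (g x))\<^sup>2) * indicator (?B n) x"
        by (rule eventually_mono) simp
      then show "(\<lambda>n. ennreal ((norm (g x))\<^sup>2) * indicator (?B n) x) \<longlonglongrightarrow> 0"
        by (rule Lim_transform_eventually[OF tendsto_const])
    qed
  qed auto
  then have "(\<lambda>n. ?G n * ?V) \<longlonglongrightarrow> 0 * ?V"
    by (intro tendsto_mult_ennreal tendsto_const) auto
  then have "(\<lambda>n. (?X n)\<^sup>2) \<longlonglongrightarrow> 0"
    by (intro tendsto_0_le_ennreal[OF _ CS]) simp
  then show ?thesis by (rule tendsto_power2_0_ennreal)
qed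

lemma sets_sides: "side a \<union> side b \<in> sets \<M>"
  by (intro sets.Un sets_boundary borel_side side_subset_frontier) auto

text \<open>Within the support of \<open>\<psi>\<close> the boundary consists of the two sides and
  the corner, which is a null set.\<close>

lemma boundary_mult_eq:
  fixes \<beta> :: "real^2 \<Rightarrow> complex"
  assumes "supp \<psi> \<subseteq> ball 0 h"
  shows "AE x in \<M>. \<beta> x * \<psi> x = (indicator (side a \<union> side b) x *\<^sub>R \<beta> x) * \<psi> x"
  using AE_boundary_nonzero
proof (rule AE_mp, intro AE_I2 impI)
  fix x assume x: "x \<in> space \<M>" "x \<noteq> 0"
  show "\<beta> x * \<psi> x = (indicator (side a \<union> side b) x *\<^sub>R \<beta> x) * \<psi> x"
  proof (cases "x \<in> side a \<union> side b")
    case False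
    then have "\<not> norm x < h" using frontier_near_corner[of x] x by (auto simp: space_boundary)
    then have "x \<notin> supp \<psi>" using assms by auto
    then show ?thesis using outside_supp[of x \<psi>] by simp
  qed simp
qed

lemma borel_measurable_sides_mult:
  fixes \<beta> :: "real^2 \<Rightarrow> complex"
  assumes "\<beta> \<in> borel_measurable \<M>" "\<And>k. C_k k \<psi>"
  shows "(\<lambda>x. (indicator (side a \<union> side b) x *\<^sub>R \<beta> x) * \<psi> x) \<in> borel_measurable \<M>"
  using assms(2)[of 0]
  by (intro borel_measurable_times borel_measurable_scaleR borel_measurable_indicator sets_sides assms(1)
      measurable_boundary borel_measurable_continuous_onI) simp

lemma integrable_boundary_mult:
  fixes \<beta> :: "real^2 \<Rightarrow> complex"
  assumes \<beta>: "\<beta> \<in> borel_measurable \<M>" "integrable \<M> (\<lambda>x. indicator (side a \<union> side b) x *\<^sub>R \<beta> x)"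
    and \<psi>: "\<And>k. C_k k \<psi>" "supp \<psi> \<subseteq> ball 0 h" "compact (supp \<psi>)"
  shows "integrable \<M> (\<lambda>x. \<beta> x * \<psi> x)"
proof -
  have c: "continuous_on UNIV \<psi>" using \<psi>(1)[of 0] by auto
    obtain D0 where D0: "\<And>x. norm (\<psi> x) \<le> D0" using bounded_compact_support[OF c \<psi>(3)] by blast
    have "integrable \<M> (\<lambda>x. (indicator (side a \<union> side b) x *\<^sub>R \<beta> x) * \<psi> x)"
    proof (rule Bochner_Integration.integrable_bound)
      show "integrable \<M> (\<lambda>x. norm (indicator (side a \<union> side b) x *\<^sub>R \<beta> x) * D0)"
        using \<beta>(2) by (intro integrable_mult_left integrable_norm)
      show "(\<lambda>x. (indicator (side a \<union> side b) x *\<^sub>R \<beta> x) * \<psi> x) \<in> borel_measurable \<M>"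
        by (rule borel_measurable_sides_mult[OF \<beta>(1) \<psi>(1)])
      have "0 \<le> D0" using D0 norm_ge_zero order_trans by blast
      then show "AE x in \<M>. norm ((indicator (side a \<union> side b) x *\<^sub>R \<beta> x) * \<psi> x) \<le> norm (norm (indicator (side a \<union> side b) x *\<^sub>R \<beta> x) * D0)"
      proof (intro AE_I2)
        fix x
        have "norm ((indicator (side a \<union> side b) x *\<^sub>R \<beta> x) * \<psi> x) = norm (indicator (side a \<union> side b) x *\<^sub>R \<beta> x) * norm (\<psi> x)"
          by (rule norm_mult)
        also have "\<dots> \<le> norm (indicator (side a \<union> side b) x *\<^sub>R \<beta> x) * D0" by (intro mult_left_mono D0) simp
        also have "\<dots> \<le> norm (norm (indicator (side a \<union> side b) x *\<^sub>R \<beta> x) * D0)" unfolding real_norm_def by (rule abs_ge_self)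
        finally show "norm ((indicator (side a \<union> side b) x *\<^sub>R \<beta> x) * \<psi> x) \<le> norm (norm (indicator (side a \<union> side b) x *\<^sub>R \<beta> x) * D0)" .
      qed
    qed
    then show ?thesis
    proof (rule integrable_cong_AE_imp)
      show "(\<lambda>x. \<beta> x * \<psi> x) \<in> borel_measurable \<M>" using c by (intro borel_measurable_times \<beta>(1) measurable_boundary borel_measurable_continuous_onI)
      show "AE x in \<M>. (indicator (side a \<union> side b) x *\<^sub>R \<beta> x) * \<psi> x = \<beta> x * \<psi> x"
        by (rule AE_mp[OF boundary_mult_eq[OF \<psi>(2)]]) (intro AE_I2 impI, rule sym, assumption)
    qed
  qed
text \<open>\<open>\<Gamma>\<close> need not contain the corner itself. Test functions are cut off at scale \<open>1/n\<close>; the gradients of the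
  cutoffs are bounded in \<open>L2\<close> and supported in shrinking disks.\<close>
proposition corner_removable:
  assumes S: "\<And>k. L2 \<L> (S k)" "L2 \<L> f" and \<beta>: "\<beta> \<in> borel_measurable \<M>" "integrable \<M> (\<lambda>x. indicator (side a \<union> side b) x *\<^sub>R \<beta> x)"
    and \<Gamma>: "side a \<union> side b \<subseteq> \<Gamma>"
    and id: "\<And>\<phi>. test_fun UNIV \<phi> \<Longrightarrow> supp \<phi> \<inter> frontier \<Omega> \<subseteq> \<Gamma> \<Longrightarrow>
      (LINT x|\<L>. (\<Sum>k\<in>UNIV. S k x * pderiv_at k \<phi> x) + f x * \<phi> x) + (LINT x|\<M>. \<beta> x * \<phi> x) = 0"
    and \<phi>: "\<And>k. C_k k \<phi>" "supp \<phi> \<subseteq> ball 0 h" "compact (supp \<phi>)"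
  shows "(LINT x|\<L>. (\<Sum>k\<in>UNIV. S k x * pderiv_at k \<phi> x) + f x * \<phi> x) + (LINT x|\<M>. \<beta> x * \<phi> x) = 0"
proof -
  define I where "I \<psi> = (LINT x|\<L>. (\<Sum>k\<in>UNIV. S k x * pderiv_at k \<psi> x) + f x * \<psi> x)" for \<psi>
  define J where "J \<psi> = (LINT x|\<M>. \<beta> x * \<psi> x)" for \<psi>
  obtain X where X: "\<And>k. C_k k X" "\<And>x. norm x \<le> 1 \<Longrightarrow> X x = 1" "\<And>x. norm x \<ge> 2 \<Longrightarrow> X x = 0"
    using smooth_cutoff[of 1 2] by auto
  have Xc: "continuous_on UNIV X" "continuous_on UNIV (pderiv_at k X)" for k
    using X(1)[of 0] X(1)[of "Suc 0"] by auto
  have Xs: "compact (supp X)" "supp X \<subseteq> cball 0 2" using compact_suppI[of 2 X] supp_subset_cball[of 2 X] X(3) by auto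
  \<comment> \<open>\<open>Y n\<close> is the part of \<open>\<phi>\<close> near the corner. The
    remainder \<open>\<phi> - Y n\<close> vanishes in a neighbourhood of 0, so it is admissible in
    \<open>id\<close>; it remains to let the contribution of \<open>Y n\<close> tend to 0.\<close>
  define Y where "Y n x = \<phi> x * X (real (Suc n) *\<^sub>R x)" for n x
  have Ysm: "C_k k (Y n)" for k n unfolding Y_def[abs_def] by (intro C_k_mult C_k_scale \<phi> X)
  have Ysupp: "supp (Y n) \<subseteq> supp \<phi>" for n
  proof -
    have "Y n = (\<lambda>x. X (real (Suc n) *\<^sub>R x) * \<phi> x)" by (auto simp: Y_def fun_eq_iff mult.commute)
    then show ?thesis using supp_mult[of "\<lambda>x. X (real (Suc n) *\<^sub>R x)" \<phi>] by simp
  qed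
  obtain B0 where B0: "B0 > 0" "\<And>x. norm (\<phi> x) \<le> B0"
    using bounded_compact_support[OF _ \<phi>(3)] \<phi>(1)[of 0] by auto
  obtain BX where BX: "BX > 0" "\<And>x. norm (X x) \<le> BX" using bounded_compact_support[OF Xc(1) Xs(1)] by blast
  have "\<exists>B. B > 0 \<and> (\<forall>x. norm (pderiv_at k \<phi> x) \<le> B) \<and> (\<forall>x. norm (pderiv_at k X x) \<le> B)" for k
  proof -
    obtain B1 where "B1 > 0" "\<And>x. norm (pderiv_at k \<phi> x) \<le> B1"
      using bounded_compact_support[OF _ compact_supp_subset[OF \<phi>(3) supp_pderiv_at], of k] \<phi>(1)[of "Suc 0"] by auto
    moreover obtain B2 where "B2 > 0" "\<And>x. norm (pderiv_at k X x) \<le> B2"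
      using bounded_compact_support[OF Xc(2) compact_supp_subset[OF Xs(1) supp_pderiv_at], of k] by auto
    ultimately show ?thesis by (intro exI[of _ "max B1 B2"]) (auto simp: le_max_iff_disj)
  qed
  then obtain B where B: "\<And>k. B k > 0" "\<And>k x. norm (pderiv_at k \<phi> x) \<le> B k" "\<And>k x. norm (pderiv_at k X x) \<le> B k"
    by metis
  define C where "C k = B k * BX + B0 * B k" for k
  have Cpos: "C k \<ge> 0" for k using B(1)[of k] BX B0 by (simp add: C_def)
  have dY: "norm (pderiv_at k (Y n) x) \<le> C k * (real (Suc n) * indicator (cball 0 (2 / real (Suc n))) x)" for k n x
  proof (cases "x \<in> cball 0 (2 / real (Suc n))")
    case True
    have d: "\<phi> differentiable at x" "(\<lambda>x. X (real (Suc n) *\<^sub>R x)) differentiable at x" "X differentiable at (real (Suc n) *\<^sub>R x)"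
      using \<phi>(1)[of "Suc 0"] C_k_scale[OF X(1), of "Suc 0"] X(1)[of "Suc 0"] by auto
    have "pderiv_at k (Y n) x = pderiv_at k \<phi> x * X (real (Suc n) *\<^sub>R x) + \<phi> x * (of_real (real (Suc n)) * pderiv_at k X (real (Suc n) *\<^sub>R x))"
      unfolding Y_def pderiv_at_mult[OF d(1,2)] pderiv_at_scale[OF d(3)] ..
    also have "norm \<dots> \<le> B k * BX + B0 * (real (Suc n) * B k)"
      using B(1)[of k] B0 BX
      by (intro order_trans[OF norm_triangle_ineq] add_mono; unfold norm_mult norm_of_real abs_of_nat;
          intro mult_mono B BX B0) auto
    also have "\<dots> \<le> C k * real (Suc n)"
    proof -
      have "B k * BX * 1 \<le> B k * BX * real (Suc n)" using B(1)[of k] BX by (intro mult_left_mono) auto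
      then show ?thesis by (simp add: C_def algebra_simps)
    qed
    finally show ?thesis using True by simp
  next
    case False
    then have "x \<notin> supp (Y n)"
    proof -
      have "supp (Y n) \<subseteq> cball 0 (2 / real (Suc n))"
        
      proof (rule supp_subset_cball)
        fix y :: "real^2" assume "2 / real (Suc n) \<le> norm y"
        then have "X (real (Suc n) *\<^sub>R y) = 0"
          by (intro X(3)) (simp add: pos_divide_le_eq mult.commute del: of_nat_Suc)
        then show "Y n y = 0" by (simp add: Y_def)
      qed
      then show ?thesis using False by blast
    qed
    then show ?thesis using False by (simp add: pderiv_at_outside_supp)
  qed
  have nY: "norm (Y n x) \<le> B0 * BX * (real (Suc n) * indicator (cball 0 (2 / real (Suc n))) x)" for n x
  proof (cases "x \<in> cball 0 (2 / real (Suc n))")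
    case True
    have "norm (Y n x) \<le> B0 * BX" unfolding Y_def norm_mult using B0 BX by (intro mult_mono) auto
    \<comment> \<open>The wasteful factor \<open>Suc n\<close> gives the undifferentiated term the
      form treated by \<open>L2_concentrated\<close>.\<close>
    also have "\<dots> \<le> B0 * BX * real (Suc n)"
      using B0 BX mult_left_mono[of 1 "real (Suc n)" "B0 * BX"] by simp
    finally show ?thesis using True by simp
  next
    case False
    then have "2 / real (Suc n) \<le> norm x" by simp
    then have "X (real (Suc n) *\<^sub>R x) = 0"
      by (intro X(3)) (simp add: pos_divide_le_eq mult.commute del: of_nat_Suc)
    then show ?thesis using False by (simp add: Y_def)
  qed
  have int: "integrable \<L> (\<lambda>x. S k x * pderiv_at k \<psi> x)" "integrable \<L> (\<lambda>x. f x * \<psi> x)"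
    if \<psi>: "\<And>k. C_k k \<psi>" "supp \<psi> \<subseteq> supp \<phi>" for \<psi> k
  proof -
    have cs: "compact (supp \<psi>)" using \<phi>(3) compact_supp_subset \<psi>(2) by blast
    have c: "continuous_on UNIV \<psi>" "continuous_on UNIV (pderiv_at k \<psi>)" using \<psi>(1)[of 0] \<psi>(1)[of "Suc 0"] by auto
    show "integrable \<L> (\<lambda>x. S k x * pderiv_at k \<psi> x)" "integrable \<L> (\<lambda>x. f x * \<psi> x)"
      by (intro integrable_domain_smooth S c cs compact_supp_subset[OF cs supp_pderiv_at])+
  qed
  have Y0: "(\<lambda>n. I (Y n)) \<longlonglongrightarrow> 0"
  proof -
    have le: "ennreal (norm (I (Y n))) \<le> (\<Sum>k\<in>UNIV. ennreal (C k) * (\<integral>\<^sup>+x\<in>cball 0 (2 / real (Suc n)). ennreal (real (Suc n) * norm (S k x)) \<partial>\<L>))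
        + ennreal (B0 * BX) * (\<integral>\<^sup>+x\<in>cball 0 (2 / real (Suc n)). ennreal (real (Suc n) * norm (f x)) \<partial>\<L>)" for n
    proof -
      have [measurable]: "S k \<in> borel_measurable \<L>" "f \<in> borel_measurable \<L>" for k using S by (auto simp: L2_def)
      have [measurable]: "(\<lambda>x. indicator (cball (0::real^2) r) x :: ennreal) \<in> borel_measurable \<L>" for r
        by (intro borel_measurable_domain borel_measurable_indicator) simp
      have "integrable \<L> (\<lambda>x. (\<Sum>k\<in>UNIV. S k x * pderiv_at k (Y n) x) + f x * Y n x)"
        by (intro Bochner_Integration.integrable_add Bochner_Integration.integrable_sum int Ysm Ysupp)
      then have "ennreal (norm (I (Y n))) \<le> (\<integral>\<^sup>+x. norm ((\<Sum>k\<in>UNIV. S k x * pderiv_at k (Y n) x) + f x * Y n x) \<partial>\<L>)"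
        unfolding I_def by (rule integral_norm_bound_ennreal)
      also have "\<dots> \<le> (\<integral>\<^sup>+x. (\<Sum>k\<in>UNIV. ennreal (C k) * (ennreal (real (Suc n) * norm (S k x)) * indicator (cball 0 (2 / real (Suc n))) x))
          + ennreal (B0 * BX) * (ennreal (real (Suc n) * norm (f x)) * indicator (cball 0 (2 / real (Suc n))) x) \<partial>\<L>)"
      proof (rule nn_integral_mono)
        fix x :: "real^2"
        let ?i = "indicator (cball 0 (2 / real (Suc n))) x :: real"
        have "norm ((\<Sum>k\<in>UNIV. S k x * pderiv_at k (Y n) x) + f x * Y n x) \<le> (\<Sum>k\<in>UNIV. norm (S k x * pderiv_at k (Y n) x)) + norm (f x * Y n x)"
          by (intro order_trans[OF norm_triangle_ineq] add_mono norm_sum) simp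
        also have "\<dots> \<le> (\<Sum>k\<in>UNIV. norm (S k x) * (C k * (real (Suc n) * ?i))) + norm (f x) * (B0 * BX * (real (Suc n) * ?i))"
          unfolding norm_mult by (intro add_mono sum_mono mult_left_mono dY nY) auto
        finally have le: "ennreal (norm ((\<Sum>k\<in>UNIV. S k x * pderiv_at k (Y n) x) + f x * Y n x)) \<le> 
           ennreal ((\<Sum>k\<in>UNIV. norm (S k x) * (C k * (real (Suc n) * ?i))) + norm (f x) * (B0 * BX * (real (Suc n) * ?i)))"
          by (rule ennreal_leI)
        also have "\<dots> = (\<Sum>k\<in>UNIV. ennreal (norm (S k x) * (C k * (real (Suc n) * ?i)))) + ennreal (norm (f x) * (B0 * BX * (real (Suc n) * ?i)))"
          using Cpos B0(1) BX(1) by (subst ennreal_plus) (auto intro!: sum_nonneg simp: sum_ennreal[symmetric] simp del: sum_ennreal of_nat_Suc)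
        also have "\<dots> = (\<Sum>k\<in>UNIV. ennreal (C k) * (ennreal (real (Suc n) * norm (S k x)) * indicator (cball 0 (2 / real (Suc n))) x))
          + ennreal (B0 * BX) * (ennreal (real (Suc n) * norm (f x)) * indicator (cball 0 (2 / real (Suc n))) x)"
          using Cpos B0(1) BX(1)
          by (intro arg_cong2[where f="(+)"] sum.cong refl) (auto simp: indicator_def ennreal_mult[symmetric] algebra_simps simp del: of_nat_Suc)
        finally show "ennreal (norm ((\<Sum>k\<in>UNIV. S k x * pderiv_at k (Y n) x) + f x * Y n x)) \<le> \<dots>" .
      qed
      also have "\<dots> = (\<Sum>k\<in>UNIV. ennreal (C k) * (\<integral>\<^sup>+x\<in>cball 0 (2 / real (Suc n)). ennreal (real (Suc n) * norm (S k x)) \<partial>\<L>))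
        + ennreal (B0 * BX) * (\<integral>\<^sup>+x\<in>cball 0 (2 / real (Suc n)). ennreal (real (Suc n) * norm (f x)) \<partial>\<L>)"
        by (simp add: nn_integral_add nn_integral_sum nn_integral_cmult)
      finally show ?thesis .
    qed
    have "(\<lambda>n. (\<Sum>k\<in>UNIV. ennreal (C k) * (\<integral>\<^sup>+x\<in>cball 0 (2 / real (Suc n)). ennreal (real (Suc n) * norm (S k x)) \<partial>\<L>))
        + ennreal (B0 * BX) * (\<integral>\<^sup>+x\<in>cball 0 (2 / real (Suc n)). ennreal (real (Suc n) * norm (f x)) \<partial>\<L>)) \<longlonglongrightarrow> (\<Sum>k\<in>UNIV. ennreal (C k) * 0) + ennreal (B0 * BX) * 0"
      by (intro tendsto_add tendsto_sum tendsto_mult_ennreal tendsto_const L2_concentrated S) auto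
    then have "(\<lambda>n. ennreal (norm (I (Y n)))) \<longlonglongrightarrow> 0"
      by (intro tendsto_0_le_ennreal[OF _ le]) simp
    then show ?thesis by (rule tendsto_0_ennreal_norm)
  qed
  have off: "AE x in \<M>. \<beta> x * \<psi> x = (indicator (side a \<union> side b) x *\<^sub>R \<beta> x) * \<psi> x" if \<psi>: "supp \<psi> \<subseteq> supp \<phi>" for \<psi>
    by (rule boundary_mult_eq[OF order_trans[OF \<psi> \<phi>(2)]])
  note sM = sets_sides and bm = borel_measurable_sides_mult[OF \<beta>(1)]
  have mM: "\<psi> \<in> borel_measurable \<M>" if "\<And>k. C_k k \<psi>" for \<psi>
    using that[of 0] by (auto intro!: measurable_boundary borel_measurable_continuous_onI)
  have Yneg: "(\<lambda>n. J (Y n)) \<longlonglongrightarrow> 0"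
  proof -
    have "(\<lambda>n. LINT x|\<M>. (indicator (side a \<union> side b) x *\<^sub>R \<beta> x) * Y n x) \<longlonglongrightarrow> (LINT x|\<M>. 0)"
    proof (rule integral_dominated_convergence[where w="\<lambda>x. norm (indicator (side a \<union> side b) x *\<^sub>R \<beta> x) * (B0 * BX)"])
      show "integrable \<M> (\<lambda>x. norm (indicator (side a \<union> side b) x *\<^sub>R \<beta> x) * (B0 * BX))"
        using \<beta>(2) by (intro integrable_mult_left integrable_norm)
      show "(\<lambda>x. (indicator (side a \<union> side b) x *\<^sub>R \<beta> x) * Y n x) \<in> borel_measurable \<M>" for n
        by (rule bm[OF Ysm])
      show "AE x in \<M>. norm ((indicator (side a \<union> side b) x *\<^sub>R \<beta> x) * Y n x) \<le> norm (indicator (side a \<union> side b) x *\<^sub>R \<beta> x) * (B0 * BX)" for n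
      proof (intro AE_I2)
        fix x
        have "norm (Y n x) \<le> B0 * BX" unfolding Y_def norm_mult using B0 BX by (intro mult_mono) auto
        then show "norm ((indicator (side a \<union> side b) x *\<^sub>R \<beta> x) * Y n x) \<le> norm (indicator (side a \<union> side b) x *\<^sub>R \<beta> x) * (B0 * BX)"
          unfolding norm_mult by (intro mult_left_mono) auto
      qed
      show "AE x in \<M>. (\<lambda>n. (indicator (side a \<union> side b) x *\<^sub>R \<beta> x) * Y n x) \<longlonglongrightarrow> 0"
        using AE_boundary_nonzero
      proof (rule AE_mp, intro AE_I2 impI)
        fix x :: "real^2" assume "x \<noteq> 0"
        moreover have "(\<lambda>n. 2 * (1 / real (Suc n))) \<longlonglongrightarrow> 2 * 0"
          by (intro tendsto_intros LIMSEQ_Suc lim_1_over_n)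
        ultimately have "\<forall>\<^sub>F n in sequentially. 2 / real (Suc n) < norm x"
          using order_tendstoD(2)[of "\<lambda>n. 2 * (1 / real (Suc n))" 0 sequentially "norm x"] by simp
        then have "\<forall>\<^sub>F n in sequentially. 0 = (indicator (side a \<union> side b) x *\<^sub>R \<beta> x) * Y n x"
        proof (rule eventually_mono)
          fix n assume "2 / real (Suc n) < norm x"
          then have "X (real (Suc n) *\<^sub>R x) = 0"
            by (intro X(3)) (simp add: pos_divide_less_eq mult.commute del: of_nat_Suc)
          then show "0 = (indicator (side a \<union> side b) x *\<^sub>R \<beta> x) * Y n x" by (simp add: Y_def)
        qed
        then show "(\<lambda>n. (indicator (side a \<union> side b) x *\<^sub>R \<beta> x) * Y n x) \<longlonglongrightarrow> 0"
          by (rule Lim_transform_eventually[OF tendsto_const])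
      qed
    qed simp
    moreover have "J (Y n) = (LINT x|\<M>. (indicator (side a \<union> side b) x *\<^sub>R \<beta> x) * Y n x)" for n
      unfolding J_def by (intro integral_cong_AE bm Ysm off Ysupp borel_measurable_times \<beta>(1) mM)
    ultimately show ?thesis by simp
  qed
  have intJ: "integrable \<M> (\<lambda>x. \<beta> x * \<psi> x)" if \<psi>: "\<And>k. C_k k \<psi>" "supp \<psi> \<subseteq> supp \<phi>" for \<psi>
    by (rule integrable_boundary_mult[OF \<beta> \<psi>(1) order_trans[OF \<psi>(2) \<phi>(2)] compact_supp_subset[OF \<phi>(3) \<psi>(2)]])
  have zero: "I \<phi> + J \<phi> = I (Y n) + J (Y n)" for n
  proof -
    let ?\<psi> = "\<lambda>x. \<phi> x - Y n x"
    have sm: "C_k k ?\<psi>" for k by (intro C_k_diff \<phi> Ysm)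
    have "?\<psi> = (\<lambda>x. (1 - X (real (Suc n) *\<^sub>R x)) * \<phi> x)" by (simp add: Y_def algebra_simps)
    then have ss: "supp ?\<psi> \<subseteq> supp \<phi>" using supp_mult[of "\<lambda>x. 1 - X (real (Suc n) *\<^sub>R x)" \<phi>] by simp
    have "?\<psi> x = 0" if "x \<in> ball 0 (1 / real (Suc n))" for x
    proof -
      have "norm x < 1 / real (Suc n)" using that by simp
      then have "X (real (Suc n) *\<^sub>R x) = 1"
        by (intro X(2)) (simp add: pos_less_divide_eq mult.commute del: of_nat_Suc)
      then show ?thesis by (simp add: Y_def)
    qed
    then have "supp ?\<psi> \<subseteq> - ball 0 (1 / real (Suc n))"
      unfolding supp_def by (intro closure_minimal) auto
    then have "0 \<notin> supp ?\<psi>" by (auto simp: subset_iff)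
    have "supp ?\<psi> \<inter> frontier \<Omega> \<subseteq> \<Gamma>"
    proof
      fix x assume x: "x \<in> supp ?\<psi> \<inter> frontier \<Omega>"
      then have "x \<noteq> 0" using \<open>0 \<notin> supp ?\<psi>\<close> by auto
      moreover have "norm x < h" using x ss \<phi>(2) by auto
      ultimately have "x \<in> side a \<union> side b" using frontier_near_corner[of x] x by auto
      then show "x \<in> \<Gamma>" using \<Gamma> by blast
    qed
    moreover have "test_fun UNIV ?\<psi>" unfolding test_fun_def using sm compact_supp_subset[OF \<phi>(3) ss] by simp
    ultimately have "I ?\<psi> + J ?\<psi> = 0" unfolding I_def J_def by (intro id)
    moreover have "I ?\<psi> = I \<phi> - I (Y n)"
    proof -
      have pd: "pderiv_at k ?\<psi> x = pderiv_at k \<phi> x - pderiv_at k (Y n) x" for k x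
        by (rule pderiv_at_diff) (use \<phi>(1)[of "Suc 0"] Ysm[of "Suc 0" n] in auto)
      have "I ?\<psi> = (LINT x|\<L>. ((\<Sum>k\<in>UNIV. S k x * pderiv_at k \<phi> x) + f x * \<phi> x) - ((\<Sum>k\<in>UNIV. S k x * pderiv_at k (Y n) x) + f x * Y n x))"
        unfolding I_def by (intro Bochner_Integration.integral_cong) (auto simp: pd right_diff_distrib sum_subtractf)
      also have "\<dots> = I \<phi> - I (Y n)" unfolding I_def
        by (intro Bochner_Integration.integral_diff Bochner_Integration.integrable_add Bochner_Integration.integrable_sum int \<phi> Ysm Ysupp order_refl)
      finally show ?thesis .
    qed
    moreover have "J ?\<psi> = J \<phi> - J (Y n)"
    proof -
      have "J ?\<psi> = (LINT x|\<M>. \<beta> x * \<phi> x - \<beta> x * Y n x)" unfolding J_def by (simp add: algebra_simps)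
      also have "\<dots> = J \<phi> - J (Y n)" unfolding J_def
        by (intro Bochner_Integration.integral_diff intJ \<phi> Ysm Ysupp order_refl)
      finally show ?thesis .
    qed
    ultimately show ?thesis by (simp add: algebra_simps)
  qed
  have "(\<lambda>n. I (Y n) + J (Y n)) \<longlonglongrightarrow> 0 + 0" by (intro tendsto_add Y0 Yneg)
  then have "(\<lambda>n::nat. I \<phi> + J \<phi>) \<longlonglongrightarrow> 0" using zero by simp
  then have "I \<phi> + J \<phi> = 0" using LIMSEQ_unique tendsto_const by blast
  then show ?thesis by (simp add: I_def J_def)
qed

end

section \<open>Asymptotics at the corner\<close>

lemma nn_integral_inverse_square_le:
  assumes "\<delta> > 0"
  shows "(\<integral>\<^sup>+t. ennreal (1 / (\<bar>t\<bar> + \<delta>)\<^sup>2) \<partial>lborel) \<le> ennreal (2 / \<delta>)"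
proof -
  let ?f = "\<lambda>t. ennreal (1 / (\<bar>t\<bar> + \<delta>)\<^sup>2)"
  have half: "(\<integral>\<^sup>+t. ?f t * indicator {0..} t \<partial>lborel) = ennreal (1 / \<delta>)"
  proof -
    have "(\<integral>\<^sup>+t. ?f t * indicator {0..} t \<partial>lborel) = (\<integral>\<^sup>+t. ennreal (1 / (t + \<delta>)\<^sup>2) * indicator {0..} t \<partial>lborel)"
      by (intro nn_integral_cong) (auto simp: indicator_def)
    also have "\<dots> = ennreal (0 - (- 1 / (0 + \<delta>)))"
    proof (rule nn_integral_FTC_atLeast)
      show "((\<lambda>t. - 1 / (t + \<delta>)) has_real_derivative 1 / (t + \<delta>)\<^sup>2) (at t)" if "0 \<le> t" for t
        using that assms by (auto intro!: derivative_eq_intros simp: power2_eq_square)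
      show "((\<lambda>t. - 1 / (t + \<delta>)) \<longlongrightarrow> 0) at_top"
        by real_asymp
    qed auto
    finally show ?thesis by simp
  qed
  have "(\<integral>\<^sup>+t. ?f t \<partial>lborel) \<le> (\<integral>\<^sup>+t. ?f t * indicator {0..} t + ?f t * indicator {..0} t \<partial>lborel)"
    by (intro nn_integral_mono) (auto simp: indicator_def)
  also have "\<dots> = (\<integral>\<^sup>+t. ?f t * indicator {0..} t \<partial>lborel) + (\<integral>\<^sup>+t. ?f t * indicator {..0} t \<partial>lborel)"
    by (rule nn_integral_add) measurable
  also have "(\<integral>\<^sup>+t. ?f t * indicator {..0} t \<partial>lborel) = (\<integral>\<^sup>+t. ?f t * indicator {0..} t \<partial>lborel)"
    by (subst nn_integral_real_affine[where c="-1" and t=0]) (auto simp: indicator_def intro!: nn_integral_cong)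
  finally show ?thesis unfolding half using assms by (simp add: ennreal_plus[symmetric] del: ennreal_plus)
qed

lemma pderiv_at_power:
  assumes "f differentiable (at x)"
  shows "pderiv_at i (\<lambda>x. f x ^ Suc p) x = of_nat (Suc p) * f x ^ p * pderiv_at i f x"
proof (induction p)
  case (Suc p)
  have "pderiv_at i (\<lambda>x. f x * f x ^ Suc p) x = pderiv_at i f x * f x ^ Suc p + f x * pderiv_at i (\<lambda>x. f x ^ Suc p) x"
    using assms by (intro pderiv_at_mult differentiable_power)
  then show ?case using Suc by (simp add: algebra_simps)
qed simp

text \<open>The integral along a side after rescaling, with \<open>e\<close> the direction of the
  side as a complex number. The primitive is \<open>- (1 / (3 * e))\<close> times the third power of
  the reciprocal; the lower bound keeps the denominator off 0 and supplies the integrable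
  majorant.\<close>

lemma integral_inverse_power4:
  fixes e :: complex
  assumes e: "e \<noteq> 0" and k: "k > 0" "\<And>\<rho>. \<rho> \<ge> 0 \<Longrightarrow> norm (of_real \<rho> * e + 1) \<ge> k * (\<rho> + 1)"
  shows "integrable lborel (\<lambda>\<rho>. indicator {0<..} \<rho> *\<^sub>R inverse (of_real \<rho> * e + 1) ^ 4)"
    and "(LINT \<rho>|lborel. indicator {0<..} \<rho> *\<^sub>R inverse (of_real \<rho> * e + 1) ^ 4) = 1 / (3 * e)"
proof -
  let ?f = "\<lambda>\<rho>. inverse (of_real \<rho> * e + 1) ^ 4"
  have nz: "of_real \<rho> * e + 1 \<noteq> 0" if "\<rho> \<ge> 0" for \<rho>
  proof
    assume "of_real \<rho> * e + 1 = 0"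
    then have "k * (\<rho> + 1) \<le> 0" using k(2)[OF that] by simp
    then show False using k(1) that by (simp add: mult_le_0_iff)
  qed
  have [measurable]: "?f \<in> borel_measurable borel" by measurable
  have bound: "norm (?f \<rho>) \<le> inverse k ^ 4 * (1 / (\<bar>\<rho>\<bar> + 1)\<^sup>2)" if r: "\<rho> \<ge> 0" for \<rho>
  proof -
    have p: "k * (\<rho> + 1) > 0" using k(1) r by simp
    have "norm (?f \<rho>) = inverse (norm (of_real \<rho> * e + 1)) ^ 4" by (simp add: norm_power norm_inverse)
    also have "\<dots> \<le> inverse (k * (\<rho> + 1)) ^ 4" using k(2)[OF r] p by (intro power_mono le_imp_inverse_le) auto
    also have "\<dots> = inverse k ^ 4 * (inverse (\<rho> + 1)) ^ 4" by (simp add: power_mult_distrib)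
    also have "\<dots> \<le> inverse k ^ 4 * (inverse (\<rho> + 1)) ^ 2"
      using r k(1) by (intro mult_left_mono power_decreasing) (auto simp: field_simps)
    finally show ?thesis using r by (simp add: power_one_over inverse_eq_divide)
  qed
  have "integrable lborel (\<lambda>\<rho>::real. 1 / (\<bar>\<rho>\<bar> + 1)\<^sup>2)"
  proof (rule integrableI_nonneg)
    show "(\<integral>\<^sup>+\<rho>. ennreal (1 / (\<bar>\<rho>\<bar> + 1)\<^sup>2) \<partial>lborel) < \<infinity>"
      using nn_integral_inverse_square_le[of 1] by (simp add: order_le_less_trans)
  qed auto
  then have ib: "integrable lborel (\<lambda>\<rho>::real. inverse k ^ 4 * (1 / (\<bar>\<rho>\<bar> + 1)\<^sup>2))" by (rule integrable_mult_right)
  show int: "integrable lborel (\<lambda>\<rho>. indicator {0<..} \<rho> *\<^sub>R ?f \<rho>)"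
    by (rule Bochner_Integration.integrable_bound[OF ib]) (measurable, auto simp: indicator_def intro!: AE_I2 order_trans[OF bound])
  let ?G = "\<lambda>\<rho>. - (1 / (3 * e)) * inverse (of_real \<rho> * e + 1) ^ 3"
  have "(\<lambda>n. LINT \<rho>|lborel. indicator {0..real n} \<rho> *\<^sub>R ?f \<rho>) \<longlonglongrightarrow> (LINT \<rho>|lborel. indicator {0<..} \<rho> *\<^sub>R ?f \<rho>)"
  proof (rule integral_dominated_convergence[OF _ _ ib])
    show "AE \<rho> in lborel. (\<lambda>n. indicator {0..real n} \<rho> *\<^sub>R ?f \<rho>) \<longlonglongrightarrow> indicator {0<..} \<rho> *\<^sub>R ?f \<rho>"
      using AE_lborel_singleton[of 0]
    proof (rule AE_mp, intro AE_I2 impI)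
      fix \<rho> :: real assume "\<rho> \<noteq> 0"
      obtain N where N: "\<rho> \<le> real N" using real_arch_simple by blast
      have "\<forall>\<^sub>F n in sequentially. indicator {0<..} \<rho> *\<^sub>R ?f \<rho> = indicator {0..real n} \<rho> *\<^sub>R ?f \<rho>"
        using eventually_ge_at_top[of N]
        by (rule eventually_mono) (use \<open>\<rho> \<noteq> 0\<close> N in \<open>auto simp: indicator_def\<close>)
      then show "(\<lambda>n. indicator {0..real n} \<rho> *\<^sub>R ?f \<rho>) \<longlonglongrightarrow> indicator {0<..} \<rho> *\<^sub>R ?f \<rho>"
        by (rule Lim_transform_eventually[OF tendsto_const])
    qed
    show "AE \<rho> in lborel. norm (indicator {0..real n} \<rho> *\<^sub>R ?f \<rho>) \<le> inverse k ^ 4 * (1 / (\<bar>\<rho>\<bar> + 1)\<^sup>2)" for n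
      using bound k(1) by (auto simp: indicator_def intro!: AE_I2)
  qed measurable
  moreover have "(LINT \<rho>|lborel. indicator {0..real n} \<rho> *\<^sub>R ?f \<rho>) = ?G (real n) - ?G 0" for n
  proof (intro has_bochner_integral_integral_eq has_bochner_integral_FTC_Icc)
    show "(?G has_vector_derivative ?f \<rho>) (at \<rho> within {0..real n})" if "0 \<le> \<rho>" "\<rho> \<le> real n" for \<rho>
    proof -
      have "((\<lambda>z. - (1 / (3 * e)) * inverse (z * e + 1) ^ 3) has_field_derivative ?f \<rho>) (at (of_real \<rho>))"
      proof -
        let ?u = "inverse (of_real \<rho> * e + 1)"
        have d: "((\<lambda>z. inverse (z * e + 1)) has_field_derivative - (?u * e * ?u)) (at (of_real \<rho>))"
          using nz[OF that(1)] by (auto intro!: derivative_eq_intros)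
        have "- (1 / (3 * e)) * (of_nat 3 * (- (u * e * u) * u ^ (3 - Suc 0))) = u ^ 4" for u :: complex
          using e by (simp add: power4_eq_xxxx power2_eq_square)
        then show ?thesis by (rule DERIV_cong[OF DERIV_cmult[OF DERIV_power[OF d, of 3]]])
      qed
      then have "((\<lambda>\<rho>. - (1 / (3 * e)) * inverse (of_real \<rho> * e + 1) ^ 3) has_vector_derivative ?f \<rho>) (at \<rho>)"
        by (rule has_vector_derivative_real_field)
      then show ?thesis by (rule has_vector_derivative_at_within)
    qed
    show "continuous_on {0..real n} ?f" using nz by (intro continuous_intros) auto
  qed auto
  moreover have "(\<lambda>n. ?G (real n) - ?G 0) \<longlonglongrightarrow> - (1 / (3 * e)) * 0 ^ 3 - ?G 0"
  proof (intro tendsto_intros)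
    have "(\<lambda>n. inverse (k * (real n + 1))) \<longlonglongrightarrow> 0" using k(1) by real_asymp
    then show "(\<lambda>n. inverse (of_real (real n) * e + 1)) \<longlonglongrightarrow> 0"
    proof (rule Lim_null_comparison[rotated])
      show "\<forall>\<^sub>F n in sequentially. norm (inverse (of_real (real n) * e + 1)) \<le> inverse (k * (real n + 1))"
      proof (intro always_eventually allI)
        fix n
        have p: "k * (real n + 1) > 0" using k(1) by simp
        show "norm (inverse (of_real (real n) * e + 1)) \<le> inverse (k * (real n + 1))"
          unfolding norm_inverse using k(2)[of "real n"] p by (intro le_imp_inverse_le) auto
      qed
    qed
  qed
  ultimately show "(LINT \<rho>|lborel. indicator {0<..} \<rho> *\<^sub>R ?f \<rho>) = 1 / (3 * e)"
    using LIMSEQ_unique by fastforce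
qed

section \<open>Boundary and volume integrals of the singular kernel\<close>

context corner_domain
begin

text \<open>The nonnegative case \<open>nn_integral_side\<close> identifies the image of Lebesgue
  measure on the interval with boundary measure on the side; equal measures have equal Bochner
  integrals.\<close>

lemma integral_side:
  fixes f :: "real^2 \<Rightarrow> complex"
  assumes c: "c \<in> {a, b}" and [measurable]: "f \<in> borel_measurable borel"
  shows "(LINT x|\<M>. indicator (side c) x *\<^sub>R f x) = (LINT s|lborel. indicator {0<..<h} s *\<^sub>R f (s *\<^sub>R c))"
proof -
  have sM [measurable]: "side c \<in> sets \<M>" "side c \<in> sets borel" by (intro sets_boundary borel_side side_subset_frontier c)+
  have idm: "(\<lambda>x. x) \<in> measurable (density \<M> (\<lambda>x. ennreal (indicat_real (side c) x))) borel"
    unfolding measurable_density_eq1 by (rule measurable_boundary) simp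
  have fM [measurable]: "f \<in> borel_measurable \<M>" by (rule measurable_boundary) simp
  define N1 where "N1 = distr (density lborel (\<lambda>s. ennreal (indicat_real {0<..<h} s))) borel (\<lambda>s. s *\<^sub>R c)"
  define N2 where "N2 = distr (density \<M> (\<lambda>x. ennreal (indicat_real (side c) x))) borel (\<lambda>x. x)"
  have "N1 = N2"
  proof (rule measure_eqI)
    fix A assume "A \<in> sets N1"
    then have A [measurable]: "A \<in> sets borel" by (simp add: N1_def)
    have i: "ennreal (indicat_real S x) = indicator S x" for S :: "'z set" and x by (simp add: indicator_def)
    have [measurable]: "(\<lambda>x. indicator A x :: ennreal) \<in> borel_measurable \<M>" by (rule measurable_boundary) measurable
    have "emeasure N1 A = (\<integral>\<^sup>+x. indicator A x \<partial>N1)" by (simp add: N1_def)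
    also have "\<dots> = (\<integral>\<^sup>+s. indicator A (s *\<^sub>R c) \<partial>density lborel (\<lambda>s. ennreal (indicat_real {0<..<h} s)))"
      unfolding N1_def by (rule nn_integral_distr) measurable
    also have "\<dots> = (\<integral>\<^sup>+s. ennreal (indicat_real {0<..<h} s) * indicator A (s *\<^sub>R c) \<partial>lborel)"
      by (rule nn_integral_density) measurable
    also have "\<dots> = (\<integral>\<^sup>+s\<in>{0<..<h}. indicator A (s *\<^sub>R c) \<partial>lborel)"
      by (intro nn_integral_cong) (simp add: i mult.commute)
    also have "\<dots> = (\<integral>\<^sup>+x\<in>side c. indicator A x \<partial>\<M>)"
      by (rule nn_integral_side[OF c, symmetric]) measurable
    also have "\<dots> = (\<integral>\<^sup>+x. ennreal (indicat_real (side c) x) * indicator A x \<partial>\<M>)"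
      by (intro nn_integral_cong) (simp add: i mult.commute)
    also have "\<dots> = (\<integral>\<^sup>+x. indicator A x \<partial>density \<M> (\<lambda>x. ennreal (indicat_real (side c) x)))"
      by (rule nn_integral_density[symmetric]) measurable
    also have "\<dots> = (\<integral>\<^sup>+x. indicator A x \<partial>N2)"
      unfolding N2_def by (rule nn_integral_distr[OF idm, symmetric]) measurable
    also have "\<dots> = emeasure N2 A" by (simp add: N2_def)
    finally show "emeasure N1 A = emeasure N2 A" .
  qed (simp add: N1_def N2_def)
  have "(LINT x|\<M>. indicator (side c) x *\<^sub>R f x) = (LINT x|density \<M> (\<lambda>x. ennreal (indicat_real (side c) x)). f x)"
    by (rule integral_density[symmetric]) (simp_all add: fM sM(1))
  also have "\<dots> = (LINT x|N2. f x)" unfolding N2_def by (rule integral_distr[OF idm, symmetric]) measurable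
  also have "\<dots> = (LINT x|N1. f x)" by (simp add: \<open>N1 = N2\<close>)
  also have "\<dots> = (LINT s|density lborel (\<lambda>s. ennreal (indicat_real {0<..<h} s)). f (s *\<^sub>R c))"
    unfolding N1_def by (rule integral_distr) measurable
  also have "\<dots> = (LINT s|lborel. indicator {0<..<h} s *\<^sub>R f (s *\<^sub>R c))"
    by (rule integral_density) (auto intro!: measurable_compose[OF _ assms(2)])
  finally show ?thesis .
qed

text \<open>The norm dominates both coordinates, so the fourth power splits into two squares and the
  integral into a product over the axes. The resulting order is one power of \<open>\<delta>\<close>
  below that of the boundary term.\<close>

lemma nn_integral_inverse_power4_le:
  assumes d: "\<delta> > 0"
  shows "(\<integral>\<^sup>+x. ennreal (1 / (norm x + \<delta>) ^ 4) \<partial>\<L>) \<le> ennreal (4 / \<delta>\<^sup>2)"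
proof -
  let ?q = "\<lambda>t::real. ennreal (1 / (\<bar>t\<bar> + \<delta>)\<^sup>2)"
  have "(\<integral>\<^sup>+x. ennreal (1 / (norm x + \<delta>) ^ 4) \<partial>\<L>) \<le> (\<integral>\<^sup>+x. ennreal (1 / (norm x + \<delta>) ^ 4) \<partial>(lborel :: (real^2) measure))"
    unfolding nn_integral_domain by (intro nn_integral_mono) (auto simp: indicator_def)
  also have "\<dots> = (\<integral>\<^sup>+x. \<integral>\<^sup>+y. ennreal (1 / (norm (vector [x, y] :: real^2) + \<delta>) ^ 4) \<partial>lborel \<partial>lborel)"
    by (rule nn_integral_lborel_vec2) measurable
  also have "\<dots> \<le> (\<integral>\<^sup>+x. \<integral>\<^sup>+y. ?q x * ?q y \<partial>lborel \<partial>lborel)"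
  proof (intro nn_integral_mono)
    fix x y :: real
    let ?n = "norm (vector [x, y] :: real^2)"
    have "\<bar>x\<bar> \<le> ?n" "\<bar>y\<bar> \<le> ?n"
      using component_le_norm_cart[of "vector [x, y] :: real^2" 1] component_le_norm_cart[of "vector [x, y] :: real^2" 2] by simp_all
    then have "(\<bar>x\<bar> + \<delta>)\<^sup>2 * (\<bar>y\<bar> + \<delta>)\<^sup>2 \<le> (?n + \<delta>)\<^sup>2 * (?n + \<delta>)\<^sup>2"
      using d by (intro mult_mono power_mono) auto
    also have "\<dots> = (?n + \<delta>) ^ 4" by (simp flip: power_add)
    finally have "1 / (?n + \<delta>) ^ 4 \<le> 1 / ((\<bar>x\<bar> + \<delta>)\<^sup>2 * (\<bar>y\<bar> + \<delta>)\<^sup>2)"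
      using d by (intro divide_left_mono mult_pos_pos zero_less_power) (auto intro: add_nonneg_pos)
    then show "ennreal (1 / (?n + \<delta>) ^ 4) \<le> ?q x * ?q y"
      by (simp add: ennreal_mult[symmetric] ennreal_leI)
  qed
  also have "\<dots> = (\<integral>\<^sup>+x. ?q x * (\<integral>\<^sup>+y. ?q y \<partial>lborel) \<partial>lborel)"
    by (intro nn_integral_cong nn_integral_cmult) measurable
  also have "\<dots> = (\<integral>\<^sup>+x. ?q x \<partial>lborel) * (\<integral>\<^sup>+y. ?q y \<partial>lborel)"
    by (rule nn_integral_multc) measurable
  also have "\<dots> \<le> ennreal (2 / \<delta>) * ennreal (2 / \<delta>)"
    by (intro mult_mono nn_integral_inverse_square_le d) auto
  also have "\<dots> = ennreal (4 / \<delta>\<^sup>2)" using d by (simp add: ennreal_mult[symmetric] power2_eq_square)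
  finally show ?thesis .
qed

text \<open>The identification of the plane with the complex numbers; for
  \<open>\<iota> = - \<i>\<close> it is the conjugate one.\<close>

definition cval :: "complex \<Rightarrow> real^2 \<Rightarrow> complex" where
  "cval \<iota> x = of_real (x $ 1) + \<iota> * of_real (x $ 2)"

text \<open>The contribution of the side \<open>c\<close> to the boundary term for
  \<open>\<delta> = 1 / (n + 1)\<close>, where \<open>g c\<close> is the boundary datum as a
  function of the distance from the corner.\<close>

definition side_limit :: "complex \<Rightarrow> (real^2 \<Rightarrow> real \<Rightarrow> complex) \<Rightarrow> (real^2 \<Rightarrow> complex) \<Rightarrow> real^2 \<Rightarrow> nat \<Rightarrow> complex" where
  "side_limit \<iota> g X c n = (LINT s|lborel. indicator {0<..<h} s *\<^sub>R (g c s * (inverse (of_real s * cval \<iota> c + of_real (1 / real (Suc n))) ^ 4 * X (s *\<^sub>R c))))"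

text \<open>Substituting \<open>s = \<delta> \<rho>\<close> turns the kernel into the fixed function
  \<open>(\<rho> e + 1)^-4\<close>, while datum and cutoff are evaluated at
  \<open>\<delta> \<rho>\<close> and tend to their values at the corner. Dominated convergence
  leaves \<open>\<gamma>\<close> times a known integral.\<close>

lemma side_limit_tendsto:
  assumes e: "cval \<iota> c \<noteq> 0" and k: "k > 0" "\<And>\<rho>. \<rho> \<ge> 0 \<Longrightarrow> norm (of_real \<rho> * cval \<iota> c + 1) \<ge> k * (\<rho> + 1)"
    and g: "g c \<in> borel_measurable borel" "\<And>s. norm (g c s) \<le> Cg" "(g c \<longlongrightarrow> \<gamma>) (at_right 0)"
    and X: "continuous_on UNIV X" "\<And>x. norm (X x) \<le> B" "X 0 = 1"
  shows "(\<lambda>n. of_real (1 / real (Suc n)) ^ 3 * side_limit \<iota> g X c n) \<longlonglongrightarrow> \<gamma> / (3 * cval \<iota> c)"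
proof -
  let ?e = "cval \<iota> c" and ?\<delta> = "\<lambda>n. 1 / real (Suc n)"
  let ?f = "\<lambda>\<rho>. inverse (of_real \<rho> * ?e + 1) ^ 4"
  let ?H = "\<lambda>n \<rho>. indicator {0<..<h} (?\<delta> n * \<rho>) *\<^sub>R (g c (?\<delta> n * \<rho>) * (?f \<rho> * X ((?\<delta> n * \<rho>) *\<^sub>R c)))"
  have Xm [measurable]: "X \<in> borel_measurable borel" using X(1) by (rule borel_measurable_continuous_onI)
  note [measurable] = g(1)
  have B: "B \<ge> 0" and Cg: "Cg \<ge> 0" using X(2) g(2) norm_ge_zero order_trans by blast+
  have eq: "of_real (?\<delta> n) ^ 3 * side_limit \<iota> g X c n = (LINT \<rho>|lborel. ?H n \<rho>)" for n
  proof -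
    have d: "?\<delta> n > 0" by simp
    define Q where "Q s = indicator {0<..<h} s *\<^sub>R (g c s * (inverse (of_real s * ?e + of_real (?\<delta> n)) ^ 4 * X (s *\<^sub>R c)))" for s
    have "side_limit \<iota> g X c n = (LINT s|lborel. Q s)" by (simp only: side_limit_def Q_def)
    also have "\<dots> = \<bar>?\<delta> n\<bar> *\<^sub>R (LINT \<rho>|lborel. Q (0 + ?\<delta> n * \<rho>))"
      using d by (intro lborel_integral_real_affine) simp
    finally have sl: "side_limit \<iota> g X c n = \<bar>?\<delta> n\<bar> *\<^sub>R (LINT \<rho>|lborel. Q (0 + ?\<delta> n * \<rho>))" .
    \<comment> \<open>The Jacobian supplies the fourth factor \<open>\<delta>\<close>, which is the
      one that rescales the fourth power of the kernel.\<close>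
    have pw: "of_real (?\<delta> n) ^ 3 * (\<bar>?\<delta> n\<bar> *\<^sub>R z) = of_real (?\<delta> n) ^ 4 * z" for z :: complex
      using d by (simp add: scaleR_conv_of_real power_numeral_reduce mult.assoc del: of_nat_Suc)
    have Q: "of_real (?\<delta> n) ^ 4 * Q (0 + ?\<delta> n * \<rho>) = ?H n \<rho>" for \<rho>
    proof -
      have nz: "complex_of_real (?\<delta> n) \<noteq> 0" using d by (metis less_irrefl of_real_eq_0_iff)
      have m: "of_real (?\<delta> n * \<rho>) * ?e + of_real (?\<delta> n) = of_real (?\<delta> n) * (of_real \<rho> * ?e + 1)"
        by (simp only: of_real_mult distrib_left mult.assoc mult_1_right)
      have "z ^ 4 * inverse (z * w) ^ 4 = inverse w ^ 4" if "z \<noteq> 0" for z w :: complex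
        using that by (simp add: power_mult_distrib[symmetric] mult.assoc[symmetric])
      from this[OF nz] have p: "of_real (?\<delta> n) ^ 4 * inverse (of_real (?\<delta> n * \<rho>) * ?e + of_real (?\<delta> n)) ^ 4 = ?f \<rho>"
        unfolding m .
      have "z * (i *\<^sub>R (u * (v * w))) = i *\<^sub>R (u * ((z * v) * w))" for z u v w :: complex and i :: real
        by (simp add: ac_simps)
      then show ?thesis unfolding Q_def add_0_left p[symmetric] .
    qed
    have "of_real (?\<delta> n) ^ 3 * side_limit \<iota> g X c n = of_real (?\<delta> n) ^ 4 * (LINT \<rho>|lborel. Q (0 + ?\<delta> n * \<rho>))"
      unfolding sl by (rule pw)
    also have "\<dots> = (LINT \<rho>|lborel. of_real (?\<delta> n) ^ 4 * Q (0 + ?\<delta> n * \<rho>))"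
      by (rule integral_mult_right_zero[symmetric])
    also have "\<dots> = (LINT \<rho>|lborel. ?H n \<rho>)" by (simp only: Q)
    finally show ?thesis .
  qed
  have "(\<lambda>n. LINT \<rho>|lborel. ?H n \<rho>) \<longlonglongrightarrow> (LINT \<rho>|lborel. \<gamma> * (indicator {0<..} \<rho> *\<^sub>R ?f \<rho>))"
  proof (rule integral_dominated_convergence[where w="\<lambda>\<rho>. Cg * B * norm (indicator {0<..} \<rho> *\<^sub>R ?f \<rho>)"])
    show "integrable lborel (\<lambda>\<rho>. Cg * B * norm (indicator {0<..} \<rho> *\<^sub>R ?f \<rho>))"
      using integral_inverse_power4(1)[OF e k] by (intro integrable_mult_right integrable_norm)
    show "AE \<rho> in lborel. norm (?H n \<rho>) \<le> Cg * B * norm (indicator {0<..} \<rho> *\<^sub>R ?f \<rho>)" for n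
    proof (intro AE_I2)
      fix \<rho> :: real
      show "norm (?H n \<rho>) \<le> Cg * B * norm (indicator {0<..} \<rho> *\<^sub>R ?f \<rho>)"
      proof (cases "?\<delta> n * \<rho> \<in> {0<..<h}")
        case True
        then have r: "\<rho> > 0" by (simp add: zero_less_divide_iff)
        have "norm (g c (?\<delta> n * \<rho>)) * (norm (?f \<rho>) * norm (X ((?\<delta> n * \<rho>) *\<^sub>R c))) \<le> Cg * (norm (?f \<rho>) * B)"
          using Cg g(2) X(2) by (intro mult_mono mult_left_mono mult_nonneg_nonneg) auto
        then show ?thesis using True r by (simp add: norm_mult indicator_def ac_simps)
      next
        case False
        then have z: "indicat_real {0<..<h} (?\<delta> n * \<rho>) = 0" by (simp only: indicator_simps(2) not_False_eq_True)
        have "norm (?H n \<rho>) = 0" by (simp only: z scaleR_zero_left norm_zero)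
        also have "0 \<le> Cg * B * norm (indicator {0<..} \<rho> *\<^sub>R ?f \<rho>)"
          using Cg B by (intro mult_nonneg_nonneg norm_ge_zero)
        finally show ?thesis .
      qed
    qed
    show "AE \<rho> in lborel. (\<lambda>n. ?H n \<rho>) \<longlonglongrightarrow> \<gamma> * (indicator {0<..} \<rho> *\<^sub>R ?f \<rho>)"
    proof (intro AE_I2)
      fix \<rho> :: real
      show "(\<lambda>n. ?H n \<rho>) \<longlonglongrightarrow> \<gamma> * (indicator {0<..} \<rho> *\<^sub>R ?f \<rho>)"
      proof (cases "\<rho> > 0")
        case True
        have "(\<lambda>n. ?\<delta> n * \<rho>) \<longlonglongrightarrow> 0 * \<rho>" by (intro tendsto_intros LIMSEQ_Suc lim_1_over_n)
        then have t0: "(\<lambda>n. ?\<delta> n * \<rho>) \<longlonglongrightarrow> 0" by simp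
        then have tr: "filterlim (\<lambda>n. ?\<delta> n * \<rho>) (at_right 0) sequentially"
          using True by (auto simp: filterlim_at intro!: always_eventually)
        have gl: "(\<lambda>n. g c (?\<delta> n * \<rho>)) \<longlonglongrightarrow> \<gamma>" by (rule filterlim_compose[OF g(3) tr])
        have "(\<lambda>n. (?\<delta> n * \<rho>) *\<^sub>R c) \<longlonglongrightarrow> 0 *\<^sub>R c" by (intro tendsto_scaleR t0 tendsto_const)
        then have "(\<lambda>n. X ((?\<delta> n * \<rho>) *\<^sub>R c)) \<longlonglongrightarrow> X 0"
          using X(1) by (intro continuous_on_tendsto_compose[of UNIV X]) auto
        then have L: "(\<lambda>n. g c (?\<delta> n * \<rho>) * (?f \<rho> * X ((?\<delta> n * \<rho>) *\<^sub>R c))) \<longlonglongrightarrow> \<gamma> * (?f \<rho> * 1)"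
          unfolding X(3) by (intro tendsto_mult gl tendsto_const)
        have "\<forall>\<^sub>F n in sequentially. ?\<delta> n * \<rho> < h" using order_tendstoD(2)[OF t0 h_pos] .
        then have ev: "\<forall>\<^sub>F n in sequentially. g c (?\<delta> n * \<rho>) * (?f \<rho> * X ((?\<delta> n * \<rho>) *\<^sub>R c)) = ?H n \<rho>"
          by (rule eventually_mono) (use True in simp)
        have rhs: "\<gamma> * (indicator {0<..} \<rho> *\<^sub>R ?f \<rho>) = \<gamma> * (?f \<rho> * 1)" using True by simp
        show ?thesis unfolding rhs by (rule Lim_transform_eventually[OF L ev])
      next
        case False
        then have "indicat_real {0<..<h} (?\<delta> n * \<rho>) = 0" for n
          by (simp add: indicator_def zero_less_divide_iff)
        then have z: "?H n \<rho> = 0" for n by (simp only: scaleR_zero_left)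
        show ?thesis unfolding z using False by simp
      qed
    qed
  qed measurable
  also have "(LINT \<rho>|lborel. \<gamma> * (indicator {0<..} \<rho> *\<^sub>R ?f \<rho>)) = \<gamma> * (1 / (3 * ?e))"
    by (simp only: integral_mult_right_zero integral_inverse_power4(2)[OF e k])
  finally show ?thesis unfolding eq by simp
qed

text \<open>The asymptotic argument freed from elasticity: \<open>S\<close> stands for the
  complexified stress of \<open>u\<close>, \<open>U\<close> for
  \<open>2 \<mu> (u1 + \<iota> u2)\<close>, \<open>f\<close> for the source, bounded near the
  corner, and \<open>\<beta>\<close> for the boundary datum, which has the same limit
  \<open>\<gamma>\<close> along both sides.\<close>

proposition corner_limit:
  fixes \<iota> \<gamma> :: complex
  assumes \<iota>: "\<iota>\<^sup>2 = -1"
    and \<kappa>: "0 \<le> \<kappa>" "\<kappa> < 1" "\<And>x. x \<in> W \<Longrightarrow> x $ 1 \<ge> - \<kappa> * norm x" "\<And>c. c \<in> {a, b} \<Longrightarrow> c $ 1 \<ge> - \<kappa>"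
    and S: "\<And>k. L2 \<L> (S k)" "L2 \<L> f" "L2 \<L> U"
    and f: "AE x in \<L>. norm x < h \<longrightarrow> norm (f x) \<le> Cf"
    and \<beta>: "\<beta> \<in> borel_measurable \<M>"
      "\<And>c. c \<in> {a, b} \<Longrightarrow> AE x in \<M>. x \<in> side c \<and> norm x < h / 2 \<longrightarrow> \<beta> x = g c (norm x)"
    and g: "\<And>c. g c \<in> borel_measurable borel" "\<And>c s. norm (g c s) \<le> Cg" "\<And>c. c \<in> {a, b} \<Longrightarrow> (g c \<longlongrightarrow> \<gamma>) (at_right 0)"
    and green: "\<And>\<psi>. (\<And>k. C_k k \<psi>) \<Longrightarrow> supp \<psi> \<subseteq> ball 0 h \<Longrightarrow> compact (supp \<psi>) \<Longrightarrow>
      (LINT x|\<L>. (S 1 x + \<iota> * S 2 x) * \<psi> x) = - (LINT x|\<L>. U x * (pderiv_at 1 \<psi> x + \<iota> * pderiv_at 2 \<psi> x))"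
    and id: "\<And>\<phi>. (\<And>k. C_k k \<phi>) \<Longrightarrow> supp \<phi> \<subseteq> ball 0 h \<Longrightarrow> compact (supp \<phi>) \<Longrightarrow>
      (LINT x|\<L>. (\<Sum>k\<in>UNIV. S k x * pderiv_at k \<phi> x) + f x * \<phi> x) + (LINT x|\<M>. \<beta> x * \<phi> x) = 0"
  shows "\<gamma> = 0"
proof -
  \<comment> \<open>The square root of the constant in \<open>norm_shift_ge\<close>.\<close>
  define k0 where "k0 = sqrt ((1 - \<kappa>) / 2)"
  have k0: "k0 > 0" "k0\<^sup>2 = (1 - \<kappa>) / 2" using \<kappa> by (auto simp: k0_def)
  have \<iota>': "\<iota> = \<i> \<or> \<iota> = - \<i>" using \<iota> by (metis power2_eq_iff power2_i)
  let ?\<delta> = "\<lambda>n. 1 / real (Suc n)"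
  let ?\<zeta> = "\<lambda>\<delta> x. of_real (x $ 1 + \<delta>) + \<iota> * of_real ((x::real^2) $ 2)"
  \<comment> \<open>This condition holds on \<open>W\<close> and on both sides, so that one lower
    bound for the distance to the pole serves the volume and the boundary integrals.\<close>
  define good where "good = {x. x $ 1 \<ge> - \<kappa> * norm (x::real^2)}"
  have goodW: "x \<in> good" if "x \<in> W" for x using \<kappa>(3)[OF that] by (simp add: good_def)
  have goodc: "s *\<^sub>R c \<in> good" if "c \<in> {a, b}" "s \<ge> 0" for c s
    using mult_left_mono[OF \<kappa>(4)[OF that(1)] that(2)] side_norm[OF that(1)] that(2)
    by (simp add: good_def mult.commute)
  have low: "norm (?\<zeta> \<delta> x) \<ge> k0 * (norm x + \<delta>)" if "x \<in> good" "\<delta> \<ge> 0" for x \<delta>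
  proof -
    have "(norm (?\<zeta> \<delta> x))\<^sup>2 = (x $ 1 + \<delta>)\<^sup>2 + (x $ 2)\<^sup>2" using \<iota>' by (auto simp: cmod_power2)
    also have "\<dots> \<ge> (1 - \<kappa>) / 2 * (norm x + \<delta>)\<^sup>2"
      using norm_shift_ge[OF \<kappa>(1,2) _ that(2), of x] that(1) by (simp add: good_def)
    finally have "(k0 * (norm x + \<delta>))\<^sup>2 \<le> (norm (?\<zeta> \<delta> x))\<^sup>2" by (simp add: power_mult_distrib k0(2))
    then show ?thesis by (rule power2_le_imp_le) simp
  qed
  \<comment> \<open>The support radius \<open>h / 4\<close> stays below \<open>h / 2\<close>, up to
    which \<open>\<beta>\<close> is known on the sides.\<close>
  obtain X where X: "\<And>k. C_k k X" "\<And>x. norm x \<le> h / 8 \<Longrightarrow> X x = 1" "\<And>x. norm x \<ge> h / 4 \<Longrightarrow> X x = 0"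
    using smooth_cutoff[of "h / 8" "h / 4"] h_pos by auto
  have Xs: "compact (supp X)" "supp X \<subseteq> cball 0 (h / 4)"
    using compact_suppI[of "h / 4" X] supp_subset_cball[of "h / 4" X] X(3) by auto
  have Xc: "continuous_on UNIV X" "continuous_on UNIV (pderiv_at k X)" for k
    using X(1)[of 0] X(1)[of "Suc 0"] by auto
  obtain B where B: "B > 0" "\<And>x. norm (X x) \<le> B" using bounded_compact_support[OF Xc(1) Xs(1)] by blast
  have "\<exists>A. A > 0 \<and> (\<forall>x. norm (pderiv_at k X x) \<le> A)" for k
    using bounded_compact_support[OF Xc(2) compact_supp_subset[OF Xs(1) supp_pderiv_at], of k] by blast
  then obtain A where A: "\<And>k. A k > 0" "\<And>k x. norm (pderiv_at k X x) \<le> A k" by metis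
  have dX0: "pderiv_at k X x = 0" if "norm x < h / 8" for k x
    by (rule pderiv_at_cong_open[OF open_ball[of 0 "h/8"], where g="\<lambda>_. 1" and g'="\<lambda>_. 0"])
      (use that X(2) in auto)
  \<comment> \<open>Points of \<open>good\<close> keep at least the distance
    \<open>k0 * \<delta>\<close> from the pole, so a regularisation within that radius is invisible
    on them.\<close>
  have "\<exists>m. (\<forall>k. C_k k m) \<and> (\<forall>x. norm (?\<zeta> (?\<delta> n) x) \<ge> k0 * ?\<delta> n \<longrightarrow> m x = inverse (?\<zeta> (?\<delta> n) x))" for n
  proof -
    have "k0 * ?\<delta> n > 0" using k0 by simp
    from smooth_regularized_inverse[OF \<iota> this, of "?\<delta> n"] show ?thesis by metis
  qed
  then obtain m where m: "\<And>n k. C_k k (m n)" "\<And>n x. norm (?\<zeta> (?\<delta> n) x) \<ge> k0 * ?\<delta> n \<Longrightarrow> m n x = inverse (?\<zeta> (?\<delta> n) x)"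
    by metis
  have mgood: "m n x = inverse (?\<zeta> (?\<delta> n) x)" if "x \<in> good" for n x
  proof (rule m(2))
    have "k0 * ?\<delta> n \<le> k0 * (norm x + ?\<delta> n)" using k0 by (intro mult_left_mono) auto
    then show "k0 * ?\<delta> n \<le> norm (?\<zeta> (?\<delta> n) x)" using low[OF that, of "?\<delta> n"] by simp
  qed
  have mnorm: "norm (m n x) \<le> inverse (k0 * (norm x + ?\<delta> n))" if "x \<in> good" for n x
    unfolding mgood[OF that] norm_inverse
    by (intro le_imp_inverse_le low that mult_pos_pos k0 add_nonneg_pos) auto
  \<comment> \<open>Where \<open>X\<close> is constant, \<open>(\<partial>\<^sub>1 \<phi>, \<partial>\<^sub>2 \<phi>) = (\<psi>, \<iota> \<psi>)\<close>.\<close>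
  define \<phi> where "\<phi> n x = m n x ^ 4 * X x" for n x
  define \<psi> where "\<psi> n x = (- 4 * m n x ^ 5) * X x" for n x
  have sm: "C_k k (\<phi> n)" "C_k k (\<psi> n)" for n k
    unfolding \<phi>_def[abs_def] \<psi>_def[abs_def] by (intro C_k_mult C_k_power m X C_k_const)+
  have ss: "supp (\<phi> n) \<subseteq> supp X" "supp (\<psi> n) \<subseteq> supp X" for n
    unfolding \<phi>_def[abs_def] \<psi>_def[abs_def] by (rule supp_mult)+
  have sX: "supp X \<subseteq> ball 0 h" using Xs(2) h_pos by auto
  have sb: "supp (\<phi> n) \<subseteq> ball 0 h" "supp (\<psi> n) \<subseteq> ball 0 h" for n using ss sX by blast+
  have sc: "compact (supp (\<phi> n))" "compact (supp (\<psi> n))" for n using ss compact_supp_subset[OF Xs(1)] by blast+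
  \<comment> \<open>The partial derivative of \<open>x1 + \<iota> x2\<close> in direction
    \<open>k\<close>.\<close>
  define ck where "ck k = (if k = 1 then 1 else \<iota>)" for k :: 2
  have dm: "pderiv_at k (m n) x = - ck k * m n x ^ 2" if "x \<in> W" for k n x
  proof -
    have nz: "?\<zeta> (?\<delta> n) x \<noteq> 0"
    proof
      assume "?\<zeta> (?\<delta> n) x = 0"
      then have "k0 * (norm x + ?\<delta> n) \<le> 0" using low[OF goodW[OF that], of "?\<delta> n"] by simp
      moreover have "k0 * (norm x + ?\<delta> n) > 0" by (intro mult_pos_pos k0 add_nonneg_pos) auto
      ultimately show False by simp
    qed
    have "((\<lambda>x. ?\<zeta> (?\<delta> n) x) has_derivative (\<lambda>y. of_real (y $ 1) + \<iota> * of_real (y $ 2))) (at x)"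
      unfolding of_real_add
      by (rule has_derivative_eq_rhs[OF has_derivative_add[OF has_derivative_add[OF has_derivative_coord has_derivative_const]
            bounded_linear.has_derivative[OF bounded_linear_mult_right has_derivative_coord]]]) simp
    from Deriv.has_derivative_inverse[OF nz this]
    have "((\<lambda>x. inverse (?\<zeta> (?\<delta> n) x)) has_derivative (\<lambda>y. - (inverse (?\<zeta> (?\<delta> n) x) * (of_real (y $ 1) + \<iota> * of_real (y $ 2)) * inverse (?\<zeta> (?\<delta> n) x)))) (at x)" .
    from pderiv_at_cong_open[OF open_W that mgood[OF goodW] this]
    have "pderiv_at k (m n) x = - (inverse (?\<zeta> (?\<delta> n) x) * (of_real ((axis k 1 :: real^2) $ 1) + \<iota> * of_real ((axis k 1 :: real^2) $ 2)) * inverse (?\<zeta> (?\<delta> n) x))" by blast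
    moreover have "of_real ((axis k 1 :: real^2) $ 1) + \<iota> * of_real ((axis k 1 :: real^2) $ 2) = ck k"
      using exhaust_2[of k] by (auto simp: axis_def ck_def)
    ultimately show ?thesis unfolding mgood[OF goodW[OF that]] by (simp add: power2_eq_square)
  qed
  have diff: "m n differentiable at x" "X differentiable at x" for n x
    using m(1)[of "Suc 0" n] X(1)[of "Suc 0"] by auto
  have dpow: "pderiv_at k (\<lambda>x. m n x ^ Suc p) x = of_nat (Suc p) * m n x ^ p * pderiv_at k (m n) x" for k n x p
    by (rule pderiv_at_power[OF diff(1)])
  have outX: "X x = 0 \<and> pderiv_at k X x = 0 \<and> pderiv_at k (\<phi> n) x = 0 \<and> pderiv_at k (\<psi> n) x = 0" if "\<not> norm x < h" for x k n
  proof -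
    have "x \<notin> supp X" using sX that by auto
    then show ?thesis using ss[of n] pderiv_at_outside_supp outside_supp by blast
  qed
  have d\<phi>: "pderiv_at k (\<phi> n) x = m n x ^ 4 * pderiv_at k X x + ck k * \<psi> n x" if "x \<in> \<Omega>" for k n x
  proof (cases "norm x < h")
    case True
    then have W: "x \<in> W" using local_cone_iff that by blast
    have "pderiv_at k (\<phi> n) x = pderiv_at k (\<lambda>x. m n x ^ Suc 3) x * X x + m n x ^ 4 * pderiv_at k X x"
      unfolding \<phi>_def[abs_def] by (subst pderiv_at_mult) (use diff in \<open>auto intro: differentiable_power\<close>)
    then show ?thesis unfolding dpow dm[OF W] by (simp add: \<psi>_def eval_nat_numeral algebra_simps)
  qed (use outX in \<open>simp add: \<psi>_def\<close>)
  \<comment> \<open>Apart from derivatives of the cutoff, the two terms cancel because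
    \<open>\<iota>\<close> squares to \<open>-1\<close>: this is the Cauchy-Riemann equation for the
    derivative of the kernel.\<close>
  have d\<psi>: "pderiv_at 1 (\<psi> n) x + \<iota> * pderiv_at 2 (\<psi> n) x = -4 * m n x ^ 5 * (pderiv_at 1 X x + \<iota> * pderiv_at 2 X x)" if "x \<in> \<Omega>" for n x
  proof (cases "norm x < h")
    case True
    then have W: "x \<in> W" using local_cone_iff that by blast
    have e: "pderiv_at k (\<psi> n) x = ck k * (20 * m n x ^ 6 * X x) - 4 * m n x ^ 5 * pderiv_at k X x" for k
    proof -
      have "pderiv_at k (\<lambda>x. -4 * m n x ^ Suc 4) x = -4 * pderiv_at k (\<lambda>x. m n x ^ Suc 4) x"
        by (subst pderiv_at_mult) (use diff in \<open>auto intro: differentiable_power\<close>)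
      then have p: "pderiv_at k (\<lambda>x. -4 * m n x ^ 5) x = ck k * (20 * m n x ^ 6)"
        unfolding dpow dm[OF W] by (simp add: eval_nat_numeral algebra_simps)
      have "pderiv_at k (\<psi> n) x = pderiv_at k (\<lambda>x. -4 * m n x ^ 5) x * X x + (-4 * m n x ^ 5) * pderiv_at k X x"
        unfolding \<psi>_def[abs_def] by (rule pderiv_at_mult) (use diff in \<open>auto intro!: differentiable_mult differentiable_power\<close>)
      then show ?thesis unfolding p by simp
    qed
    have "\<iota> * (\<iota> * z) = - z" for z using \<iota> by (simp add: mult.assoc[symmetric] power2_eq_square)
    note this[simp]
    show ?thesis unfolding e by (simp add: ck_def algebra_simps)
  qed (use outX in simp)
  \<comment> \<open>A bound for \<open>m n\<close> on the part of \<open>\<Omega>\<close> where the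
    cutoff varies, uniform in \<open>n\<close>, since \<open>norm x \<ge> h / 8\<close>
    there.\<close>
  define K1 where "K1 = max 1 (inverse (k0 * (h / 8)))"
  have K1: "K1 \<ge> 1" by (simp add: K1_def)
  have mX: "norm (m n x ^ p * pderiv_at k X x) \<le> K1 ^ p * A k" if "x \<in> \<Omega>" for n p k x
  proof (cases "h / 8 \<le> norm x \<and> norm x < h")
    case True
    then have W: "x \<in> W" using local_cone_iff that by blast
    have "norm (m n x) \<le> inverse (k0 * (norm x + ?\<delta> n))" by (rule mnorm[OF goodW[OF W]])
    also have "\<dots> \<le> inverse (k0 * (h / 8))"
      using True h_pos k0 by (intro le_imp_inverse_le mult_left_mono mult_pos_pos) (auto intro: add_increasing2)
    also have "\<dots> \<le> K1" by (simp add: K1_def)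
    finally have "norm (m n x) ^ p \<le> K1 ^ p" by (intro power_mono) auto
    then show ?thesis unfolding norm_mult norm_power using A K1 by (intro mult_mono) auto
  next
    case False
    then have "pderiv_at k X x = 0" using dX0 outX by (meson not_le)
    then show ?thesis using K1 A(1)[of k] by simp
  qed
  have cont: "continuous_on UNIV (\<lambda>x. m n x ^ p * pderiv_at k X x)" for n p k
    using C_k_continuous[OF m(1)] Xc by (intro continuous_intros)
  have bnd: "\<exists>D. \<forall>x. norm (m n x ^ p * pderiv_at k X x) \<le> D" for n p k
  proof -
    have "supp (\<lambda>x. m n x ^ p * pderiv_at k X x) \<subseteq> supp X"
      using supp_mult[of "\<lambda>x. m n x ^ p" "pderiv_at k X"] supp_pderiv_at[of k X] by blast
    then have "compact (supp (\<lambda>x. m n x ^ p * pderiv_at k X x))" by (rule compact_supp_subset[OF Xs(1)])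
    then obtain D where "\<And>x. norm (m n x ^ p * pderiv_at k X x) \<le> D" using bounded_compact_support[OF cont, of n p k] by blast
    then show ?thesis by blast
  qed
  have int1: "integrable \<L> (\<lambda>x. u x * (m n x ^ p * pderiv_at k X x))" if "L2 \<L> u" for u n p k
  proof -
    obtain D where D: "\<And>x. norm (m n x ^ p * pderiv_at k X x) \<le> D" using bnd by blast
    show ?thesis by (rule integrable_domain_mult[OF that continuous_measurable_domain[OF cont] D])
  qed
  have int2: "integrable \<L> (\<lambda>x. u x * v x)" if u: "L2 \<L> u" and v: "\<And>k. C_k k v" "compact (supp v)" for u v
  proof -
    have "continuous_on UNIV v" using v(1)[of 0] by simp
    then show ?thesis by (rule integrable_domain_smooth[OF u _ v(2)])
  qed
  have intn: "integrable \<L> (\<lambda>x. norm (u x))" if "L2 \<L> u" for u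
    using L2_integrable[OF that finite_domain] by simp
  have bulk: "norm (LINT x|\<L>. u x * (m n x ^ p * pderiv_at k X x)) \<le> K1 ^ p * A k * (LINT x|\<L>. norm (u x))" if u: "L2 \<L> u" for u n p k
  proof -
    have "norm (LINT x|\<L>. u x * (m n x ^ p * pderiv_at k X x)) \<le> (LINT x|\<L>. norm (u x * (m n x ^ p * pderiv_at k X x)))"
      by (rule integral_norm_bound)
    also have "\<dots> \<le> (LINT x|\<L>. K1 ^ p * A k * norm (u x))"
    proof (rule integral_mono)
      show "integrable \<L> (\<lambda>x. norm (u x * (m n x ^ p * pderiv_at k X x)))" using int1[OF u] by (rule integrable_norm)
      show "integrable \<L> (\<lambda>x. K1 ^ p * A k * norm (u x))" using intn[OF u] by (rule integrable_mult_right)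
      fix x assume "x \<in> space \<L>"
      then have x: "x \<in> \<Omega>" by (simp add: space_restrict_space)
      show "norm (u x * (m n x ^ p * pderiv_at k X x)) \<le> K1 ^ p * A k * norm (u x)"
        unfolding norm_mult[of "u x"] using mX[OF x, of n p k]
        by (subst mult.commute) (intro mult_right_mono, auto)
    qed
    finally show ?thesis by simp
  qed
  \<comment> \<open>\<open>R1\<close> and \<open>R2\<close> collect the errors from the cutoff,
    before and after the integration by parts; \<open>R3\<close> is the source term and
    \<open>J\<close> the boundary term.\<close>
  define R1 where "R1 n = (LINT x|\<L>. S 1 x * (m n x ^ 4 * pderiv_at 1 X x)) + (LINT x|\<L>. S 2 x * (m n x ^ 4 * pderiv_at 2 X x))" for n
  define R2 where "R2 n = (LINT x|\<L>. U x * (m n x ^ 5 * pderiv_at 1 X x)) + \<iota> * (LINT x|\<L>. U x * (m n x ^ 5 * pderiv_at 2 X x))" for n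
  define R3 where "R3 n = (LINT x|\<L>. f x * \<phi> n x)" for n
  define J where "J n = (LINT x|\<M>. \<beta> x * \<phi> n x)" for n
  have ident: "R1 n + 4 * R2 n + R3 n + J n = 0" for n
  proof -
    have "(LINT x|\<L>. (\<Sum>k\<in>UNIV. S k x * pderiv_at k (\<phi> n) x) + f x * \<phi> n x) =
       (LINT x|\<L>. S 1 x * (m n x ^ 4 * pderiv_at 1 X x) + S 2 x * (m n x ^ 4 * pderiv_at 2 X x) + (S 1 x * \<psi> n x + \<iota> * (S 2 x * \<psi> n x)) + f x * \<phi> n x)"
    proof (rule Bochner_Integration.integral_cong)
      fix x assume "x \<in> space \<L>"
      then have x: "x \<in> \<Omega>" by (simp add: space_restrict_space)
      show "(\<Sum>k\<in>UNIV. S k x * pderiv_at k (\<phi> n) x) + f x * \<phi> n x = S 1 x * (m n x ^ 4 * pderiv_at 1 X x) + S 2 x * (m n x ^ 4 * pderiv_at 2 X x) + (S 1 x * \<psi> n x + \<iota> * (S 2 x * \<psi> n x)) + f x * \<phi> n x"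
        unfolding sum_2 d\<phi>[OF x] by (simp add: ck_def algebra_simps)
    qed simp
    also have "\<dots> = R1 n + (LINT x|\<L>. S 1 x * \<psi> n x + \<iota> * (S 2 x * \<psi> n x)) + R3 n"
      unfolding R1_def R3_def
      using int1[OF S(1)] int2[OF S(1) sm(2) sc(2)] int2[OF S(2) sm(1) sc(1)]
      by simp
    also have "(LINT x|\<L>. S 1 x * \<psi> n x + \<iota> * (S 2 x * \<psi> n x)) = (LINT x|\<L>. (S 1 x + \<iota> * S 2 x) * \<psi> n x)"
      by (simp add: distrib_right mult.assoc)
    also have "\<dots> = - (LINT x|\<L>. U x * (pderiv_at 1 (\<psi> n) x + \<iota> * pderiv_at 2 (\<psi> n) x))"
      by (rule green[OF sm(2) sb(2) sc(2)])
    also have "(LINT x|\<L>. U x * (pderiv_at 1 (\<psi> n) x + \<iota> * pderiv_at 2 (\<psi> n) x)) =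
        (LINT x|\<L>. - 4 * (U x * (m n x ^ 5 * pderiv_at 1 X x) + \<iota> * (U x * (m n x ^ 5 * pderiv_at 2 X x))))"
    proof (rule Bochner_Integration.integral_cong)
      fix x assume "x \<in> space \<L>"
      then have x: "x \<in> \<Omega>" by (simp add: space_restrict_space)
      show "U x * (pderiv_at 1 (\<psi> n) x + \<iota> * pderiv_at 2 (\<psi> n) x) = - 4 * (U x * (m n x ^ 5 * pderiv_at 1 X x) + \<iota> * (U x * (m n x ^ 5 * pderiv_at 2 X x)))"
        unfolding d\<psi>[OF x] by (simp add: algebra_simps)
    qed simp
    also have "\<dots> = - 4 * R2 n"
      unfolding R2_def integral_mult_right_zero using int1[OF S(3)] by simp
    finally show ?thesis using id[OF sm(1) sb(1) sc(1), of n] by (simp add: J_def algebra_simps)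
  qed
  let ?d = "\<lambda>n. complex_of_real (?\<delta> n)"
  have d0: "?\<delta> \<longlonglongrightarrow> 0" by (intro LIMSEQ_Suc lim_1_over_n)
  have d30: "(\<lambda>n. (?\<delta> n) ^ 3 * N) \<longlonglongrightarrow> 0" for N :: real
    using tendsto_mult[OF tendsto_power[OF d0, of 3] tendsto_const[of N]] by simp
  have small: "(\<lambda>n. ?d n ^ 3 * R n) \<longlonglongrightarrow> 0" if "\<And>n. norm (R n) \<le> N" for R N
  proof (rule Lim_null_comparison[OF _ d30[of N]])
    show "\<forall>\<^sub>F n in sequentially. norm (?d n ^ 3 * R n) \<le> (?\<delta> n) ^ 3 * N"
    proof (intro always_eventually allI)
      fix n
      have "norm (?d n ^ 3) = (?\<delta> n) ^ 3" by (simp only: norm_power norm_of_real) simp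
      then show "norm (?d n ^ 3 * R n) \<le> (?\<delta> n) ^ 3 * N"
        unfolding norm_mult using that[of n] by (simp only:) (intro mult_left_mono, auto)
    qed
  qed
  \<comment> \<open>The cutoff errors are bounded in \<open>n\<close>, so the factor
    \<open>\<delta> ^ 3\<close> sends them to 0.\<close>
  have l1: "(\<lambda>n. ?d n ^ 3 * R1 n) \<longlonglongrightarrow> 0"
    by (rule small, unfold R1_def, rule norm_triangle_mono[OF bulk[OF S(1)] bulk[OF S(1)]])
  have "norm \<iota> = 1" using \<iota>' by auto
  then have l2: "(\<lambda>n. ?d n ^ 3 * R2 n) \<longlonglongrightarrow> 0"
    unfolding R2_def using bulk[OF S(3)]
    by (intro small) (rule norm_triangle_mono, rule bulk[OF S(3)], simp add: norm_mult, rule bulk[OF S(3)])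
  have l3: "(\<lambda>n. ?d n ^ 3 * R3 n) \<longlonglongrightarrow> 0"
  proof -
    \<comment> \<open>The maximum with 0 is taken because nothing fixes the sign of
      \<open>Cf\<close>.\<close>
    define N where "N = max Cf 0 * inverse k0 ^ 4 * B"
    have N0: "N \<ge> 0" using k0 B by (auto simp: N_def)
    have R3: "norm (R3 n) \<le> N * (4 / (?\<delta> n)\<^sup>2)" for n
    proof -
      have d: "?\<delta> n > 0" by simp
      have "ennreal (norm (R3 n)) \<le> (\<integral>\<^sup>+x. norm (f x * \<phi> n x) \<partial>\<L>)"
        unfolding R3_def by (rule integral_norm_bound_ennreal[OF int2[OF S(2) sm(1) sc(1)]])
      also have "\<dots> \<le> (\<integral>\<^sup>+x. ennreal N * ennreal (1 / (norm x + ?\<delta> n) ^ 4) \<partial>\<L>)"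
      proof (rule nn_integral_mono_AE, rule AE_mp[OF f], intro AE_I2 impI)
        fix x assume x: "x \<in> space \<L>" and fb: "norm x < h \<longrightarrow> norm (f x) \<le> Cf"
        have x\<Omega>: "x \<in> \<Omega>" using x by (simp add: space_restrict_space)
        have "norm (f x * \<phi> n x) \<le> N * (1 / (norm x + ?\<delta> n) ^ 4)"
        proof (cases "norm x < h")
          case True
          then have W: "x \<in> W" using local_cone_iff x\<Omega> by blast
          have "norm (m n x) ^ 4 \<le> inverse (k0 * (norm x + ?\<delta> n)) ^ 4"
            by (intro power_mono mnorm goodW W) auto
          also have "\<dots> = inverse k0 ^ 4 * (1 / (norm x + ?\<delta> n) ^ 4)"
          proof -
            have "inverse (k * z) ^ 4 = inverse k ^ 4 * (1 / z ^ 4)" for k z :: real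
              by (simp add: power_mult_distrib power_inverse divide_inverse)
            then show ?thesis .
          qed
          finally have m4: "norm (m n x) ^ 4 \<le> inverse k0 ^ 4 * (1 / (norm x + ?\<delta> n) ^ 4)" .
          have "norm (f x * \<phi> n x) = norm (f x) * (norm (m n x) ^ 4 * norm (X x))"
            by (simp add: \<phi>_def norm_mult norm_power)
          also have "\<dots> \<le> max Cf 0 * ((inverse k0 ^ 4 * (1 / (norm x + ?\<delta> n) ^ 4)) * B)"
          proof -
            have "norm (f x) \<le> max Cf 0" using fb True by (simp add: le_max_iff_disj)
            then show ?thesis using k0 by (intro mult_mono m4 B) auto
          qed
          also have "\<dots> = N * (1 / (norm x + ?\<delta> n) ^ 4)" by (simp only: N_def ac_simps)
          finally show ?thesis .
        next
          case False
          then have "\<phi> n x = 0" using outX[of x] by (simp add: \<phi>_def)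
          then show ?thesis using N0 by simp
        qed
        then show "ennreal (norm (f x * \<phi> n x)) \<le> ennreal N * ennreal (1 / (norm x + ?\<delta> n) ^ 4)"
          using N0 by (simp add: ennreal_mult[symmetric] ennreal_leI del: of_nat_Suc)
      qed
      also have "\<dots> = ennreal N * (\<integral>\<^sup>+x. ennreal (1 / (norm x + ?\<delta> n) ^ 4) \<partial>\<L>)"
        by (intro nn_integral_cmult borel_measurable_domain) measurable
      also have "\<dots> \<le> ennreal N * ennreal (4 / (?\<delta> n)\<^sup>2)"
        by (intro mult_left_mono nn_integral_inverse_power4_le d) auto
      also have "\<dots> = ennreal (N * (4 / (?\<delta> n)\<^sup>2))" using N0 by (intro ennreal_mult[symmetric]) auto
      finally show ?thesis using N0 by (subst (asm) ennreal_le_iff) auto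
    qed
    have "(\<lambda>n. ?\<delta> n * (4 * N)) \<longlonglongrightarrow> 0 * (4 * N)" by (intro tendsto_mult d0 tendsto_const)
    then have lim: "(\<lambda>n. ?\<delta> n * (4 * N)) \<longlonglongrightarrow> 0" by simp
    show ?thesis
    proof (rule Lim_null_comparison[OF _ lim], intro always_eventually allI)
      fix n
      have d: "?\<delta> n > 0" by simp
      have "norm (?d n ^ 3 * R3 n) = (?\<delta> n) ^ 3 * norm (R3 n)" 
        unfolding norm_mult norm_power norm_of_real using d by (simp only: abs_of_pos)
      also have "\<dots> \<le> (?\<delta> n) ^ 3 * (N * (4 / (?\<delta> n)\<^sup>2))" by (intro mult_left_mono R3) auto
      also have "\<dots> = ?\<delta> n * (4 * N)"
      proof -
        have "z ^ 3 * (N * (4 / z\<^sup>2)) = z * (4 * N)" if "z > 0" for z :: real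
          using that by (simp add: power3_eq_cube power2_eq_square)
        from this[OF d] show ?thesis .
      qed
      finally show "norm (?d n ^ 3 * R3 n) \<le> ?\<delta> n * (4 * N)" .
    qed
  qed
  have ab: "cval \<iota> c \<noteq> 0" "\<And>\<rho>. \<rho> \<ge> 0 \<Longrightarrow> norm (of_real \<rho> * cval \<iota> c + 1) \<ge> k0 * (\<rho> + 1)" if c: "c \<in> {a, b}" for c
  proof -
    show "norm (of_real \<rho> * cval \<iota> c + 1) \<ge> k0 * (\<rho> + 1)" if "\<rho> \<ge> 0" for \<rho>
      using low[OF goodc[OF c that], of 1] side_norm[OF c] that
      by (simp add: cval_def algebra_simps)
    show "cval \<iota> c \<noteq> 0"
    proof
      assume "cval \<iota> c = 0"
      then have "Re (cval \<iota> c) = 0" "Im (cval \<iota> c) = 0" by simp_all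
      then have "c $ 1 = 0" "c $ 2 = 0" using \<iota>' by (auto simp: cval_def)
      then show False using side_norm[OF c] by (simp add: norm_vec2)
    qed
  qed
  have J: "J n = side_limit \<iota> g X a n + side_limit \<iota> g X b n" for n
  proof -
    define F where "F c x = g c (norm x) * \<phi> n x" for c and x :: "real^2"
    have \<phi>m: "\<phi> n \<in> borel_measurable borel" using C_k_continuous[OF sm(1)] by (rule borel_measurable_continuous_onI)
    have Fm: "F c \<in> borel_measurable borel" for c
      unfolding F_def[abs_def] using g(1) \<phi>m by measurable
    have one: "(LINT x|\<M>. indicator (side c) x *\<^sub>R F c x) = side_limit \<iota> g X c n" if c: "c \<in> {a, b}" for c
      unfolding integral_side[OF c Fm] side_limit_def
    proof (rule Bochner_Integration.integral_cong)
      fix s :: real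
      show "indicator {0<..<h} s *\<^sub>R F c (s *\<^sub>R c) = indicator {0<..<h} s *\<^sub>R (g c s * (inverse (of_real s * cval \<iota> c + of_real (?\<delta> n)) ^ 4 * X (s *\<^sub>R c)))"
      proof (cases "s \<in> {0<..<h}")
        case True
        then have s: "s \<ge> 0" by simp
        have n: "norm (s *\<^sub>R c) = s" using s side_norm[OF c] by simp
        have z: "?\<zeta> (?\<delta> n) (s *\<^sub>R c) = of_real s * cval \<iota> c + of_real (?\<delta> n)"
          by (simp add: cval_def algebra_simps del: of_nat_Suc)
        show ?thesis unfolding F_def \<phi>_def mgood[OF goodc[OF c s]] z n ..
      qed simp
    qed simp
    have intF: "integrable \<M> (\<lambda>x. indicator (side c) x *\<^sub>R F c x)" if c: "c \<in> {a, b}" for c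
    proof -
      obtain D where D: "D > 0" "\<And>x. norm (\<phi> n x) \<le> D" using bounded_compact_support[OF C_k_continuous[OF sm(1)] sc(1)] by blast
      have "integrable \<M> (\<lambda>x. (Cg * D) *\<^sub>R indicat_real (side c) x)"
        using emeasure_side[OF c] sets_boundary[OF borel_side[OF c] side_subset_frontier[OF c]]
        by (intro integrable_scaleR_right integrable_real_indicator) auto
      then show ?thesis
      proof (rule Bochner_Integration.integrable_bound)
        show "(\<lambda>x. indicator (side c) x *\<^sub>R F c x) \<in> borel_measurable \<M>"
          by (intro borel_measurable_scaleR borel_measurable_indicator measurable_boundary Fm sets_boundary borel_side side_subset_frontier c)
        have "norm (F c x) \<le> Cg * D" for x
          unfolding F_def norm_mult using g(2) D order_trans[OF norm_ge_zero g(2)] by (intro mult_mono) auto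
        then have "norm (F c x) \<le> \<bar>Cg * D\<bar>" for x using abs_ge_self order_trans by blast
        then show "AE x in \<M>. norm (indicator (side c) x *\<^sub>R F c x) \<le> norm ((Cg * D) *\<^sub>R indicat_real (side c) x)"
          by (intro AE_I2) (auto simp: indicator_def intro: order_trans)
      qed
    qed
    have disj: "side a \<inter> side b = {}"
    proof (rule ccontr)
      assume "side a \<inter> side b \<noteq> {}"
      then obtain s t where st: "s > 0" "t > 0" "s *\<^sub>R a = t *\<^sub>R b" unfolding side_def by force
      have n: "norm (s *\<^sub>R a) = s" "norm (t *\<^sub>R b) = t" using norm_sides st(1,2) by simp_all
      have "s = t" using n unfolding st(3) by simp
      then show False using st sides_distinct by simp
    qed
    have AE_frontier: "AE x in \<M>. x \<in> frontier \<Omega>" by (rule AE_I2) (simp add: space_boundary)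
    \<comment> \<open>Below \<open>h / 2\<close> the boundary consists of the two disjoint sides and
      the corner, a null set; beyond \<open>h / 2\<close> the cutoff vanishes.\<close>
    have "AE x in \<M>. \<beta> x * \<phi> n x = indicator (side a) x *\<^sub>R F a x + indicator (side b) x *\<^sub>R F b x"
      using AE_boundary_nonzero \<beta>(2)[of a, simplified] \<beta>(2)[of b, simplified] AE_frontier
    proof eventually_elim
      case (elim x)
      show ?case
      proof (cases "norm x < h / 2")
        case False
        then have "X x = 0" by (intro X(3)) (use h_pos in simp)
        then show ?thesis by (simp add: F_def \<phi>_def)
      next
        case True
        show ?thesis
        proof (cases "x \<in> frontier \<Omega>")
          case fr: True
          then have x: "x \<in> side a \<or> x \<in> side b" using frontier_near_corner[of x] elim(1) True h_pos by auto
          then show ?thesis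
          proof
            assume xa: "x \<in> side a"
            then have "x \<notin> side b" using disj by blast
            then show ?thesis using xa elim(2) True by (simp add: F_def)
          next
            assume xb: "x \<in> side b"
            then have "x \<notin> side a" using disj by blast
            then show ?thesis using xb elim(3) True by (simp add: F_def)
          qed
        qed (use elim(4) in simp)
      qed
    qed
    then have "J n = (LINT x|\<M>. indicator (side a) x *\<^sub>R F a x + indicator (side b) x *\<^sub>R F b x)"
      unfolding J_def
      by (intro integral_cong_AE borel_measurable_times \<beta>(1) measurable_boundary \<phi>m borel_measurable_add borel_measurable_integrable[OF intF]) auto
    also have "\<dots> = side_limit \<iota> g X a n + side_limit \<iota> g X b n"
      using intF one by simp
    finally show ?thesis .
  qed
  have X0: "X 0 = 1" using X(2)[of 0] h_pos by simp
  have lim: "(\<lambda>n. ?d n ^ 3 * side_limit \<iota> g X c n) \<longlonglongrightarrow> \<gamma> / (3 * cval \<iota> c)" if c: "c \<in> {a, b}" for c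
    by (rule side_limit_tendsto[where g=g and c=c, OF ab(1)[OF c] k0(1) ab(2)[OF c] g(1,2) g(3)[OF c] Xc(1) B(2) X0])
  have "(\<lambda>n. ?d n ^ 3 * R1 n + 4 * (?d n ^ 3 * R2 n) + ?d n ^ 3 * R3 n + (?d n ^ 3 * side_limit \<iota> g X a n + ?d n ^ 3 * side_limit \<iota> g X b n))
     \<longlonglongrightarrow> 0 + 4 * 0 + 0 + (\<gamma> / (3 * cval \<iota> a) + \<gamma> / (3 * cval \<iota> b))"
    by (intro tendsto_add tendsto_mult tendsto_const l1 l2 l3 lim[OF insertI1] lim[OF insertI2[OF insertI1]])
  moreover have "?d n ^ 3 * R1 n + 4 * (?d n ^ 3 * R2 n) + ?d n ^ 3 * R3 n + (?d n ^ 3 * side_limit \<iota> g X a n + ?d n ^ 3 * side_limit \<iota> g X b n) = 0" for n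
  proof -
    have "z * R1 n + 4 * (z * R2 n) + z * R3 n + (z * side_limit \<iota> g X a n + z * side_limit \<iota> g X b n) = z * (R1 n + 4 * R2 n + R3 n + J n)" for z
      unfolding J by (simp add: algebra_simps)
    then show ?thesis unfolding ident by simp
  qed
  ultimately have "(\<lambda>n::nat. 0) \<longlonglongrightarrow> \<gamma> / (3 * cval \<iota> a) + \<gamma> / (3 * cval \<iota> b)" by simp
  then have z: "\<gamma> / (3 * cval \<iota> a) + \<gamma> / (3 * cval \<iota> b) = 0" using LIMSEQ_unique[OF tendsto_const] by metis
  have nz: "cval \<iota> a \<noteq> 0" "cval \<iota> b \<noteq> 0" using ab(1) by auto
  have "\<gamma> * (cval \<iota> a + cval \<iota> b) = 0" using z nz by (simp add: field_simps)
  moreover have "cval \<iota> a + cval \<iota> b \<noteq> 0"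
  proof
    assume s: "cval \<iota> a + cval \<iota> b = 0"
    then have "Re (cval \<iota> a + cval \<iota> b) = 0" "Im (cval \<iota> a + cval \<iota> b) = 0" by (simp_all only: zero_complex.sel)
    then have "a $ 1 = - b $ 1" "a $ 2 = - b $ 2" using \<iota>' by (auto simp: cval_def)
    then show False using indep by (simp add: cross2_def)
  qed
  ultimately show ?thesis by simp
qed

end

section \<open>Vanishing at the corner\<close>

lemma holder_on_component:
  "holder_on \<alpha> S f \<Longrightarrow> holder_on \<alpha> S (\<lambda>x. f x $ j)" for f :: "_ \<Rightarrow> complex^2"
  unfolding holder_on_def using dist_vec_nth_le order_trans by meson

lemma bounded_closure_image:
  fixes f :: "real^2 \<Rightarrow> 'a::metric_space"
  assumes "holder_on \<alpha> (closure S) f" "0 < \<alpha>" "bounded S"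
  shows "bounded (f ` closure S)"
  using assms by (intro compact_imp_bounded compact_continuous_image holder_on_imp_continuous_on) (auto simp: compact_closure)

text \<open>The rotational term turns \<open>2 \<mu>\<close> times the gradient into its symmetric
  part, so these are the entries of a symmetric stress tensor; the symmetry is used when the complex
  combination is formed.\<close>

lemma traction_axis:
  "traction lam mu G (axis 1 1) $ 1 = of_real (2 * mu) * G $ 1 $ 1 + of_real lam * (G $ 1 $ 1 + G $ 2 $ 2)"
  "traction lam mu G (axis 1 1) $ 2 = of_real mu * (G $ 1 $ 2 + G $ 2 $ 1)"
  "traction lam mu G (axis 2 1) $ 1 = of_real mu * (G $ 1 $ 2 + G $ 2 $ 1)"
  "traction lam mu G (axis 2 1) $ 2 = of_real (2 * mu) * G $ 2 $ 2 + of_real lam * (G $ 1 $ 1 + G $ 2 $ 2)"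
  by (simp_all add: traction_def sum_2 axis_def perp_def algebra_simps)

lemma L2_add:
  assumes "L2 M f" "L2 M g" shows "L2 M (\<lambda>x. f x + g x)"
proof -
  have [measurable]: "f \<in> borel_measurable M" "g \<in> borel_measurable M" using assms by (auto simp: L2_def)
  have i: "integrable M (\<lambda>x. 2 * (norm (f x))\<^sup>2 + 2 * (norm (g x))\<^sup>2)" using assms by (auto simp: L2_def)
  have "integrable M (\<lambda>x. (norm (f x + g x))\<^sup>2)"
  proof (rule Bochner_Integration.integrable_bound[OF i])
    show "AE x in M. norm ((norm (f x + g x))\<^sup>2) \<le> norm (2 * (norm (f x))\<^sup>2 + 2 * (norm (g x))\<^sup>2)"
    proof (intro AE_I2)
      fix x
      have "(norm (f x + g x))\<^sup>2 \<le> (norm (f x) + norm (g x))\<^sup>2" by (intro power_mono norm_triangle_ineq) auto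
      also have "\<dots> \<le> 2 * (norm (f x))\<^sup>2 + 2 * (norm (g x))\<^sup>2"
        using sum_squares_bound[of "norm (f x)" "norm (g x)"] by (simp add: power2_sum)
      finally show "norm ((norm (f x + g x))\<^sup>2) \<le> norm (2 * (norm (f x))\<^sup>2 + 2 * (norm (g x))\<^sup>2)" by simp
    qed
  qed measurable
  then show ?thesis by (simp add: L2_def)
qed

lemma L2_cmult:
  assumes "L2 M f" shows "L2 M (\<lambda>x. c * f x)"
  using assms by (auto simp: L2_def norm_mult power_mult_distrib)

lemma L2_diff: "L2 M f \<Longrightarrow> L2 M g \<Longrightarrow> L2 M (\<lambda>x. f x - g x)"
  using L2_add[of M f "\<lambda>x. (-1) * g x"] L2_cmult[of M g "-1"] by simp

section \<open>From the boundary conditions to the corner value\<close>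

context corner_domain
begin

lemma traction_L2:
  assumes "H1_vec \<Omega> v"
  shows "L2 \<L> (\<lambda>x. traction lam mu (weak_grad \<Omega> v x) (axis k 1) $ j)"
proof -
  have *: "L2 \<L> (\<lambda>x. weak_grad \<Omega> v x $ j $ k)" for j k
    using weak_pderiv_L2 assms by (simp add: weak_grad_def H1_vec_def)
  show ?thesis
    using exhaust_2[of k] exhaust_2[of j]
    by (auto simp: traction_axis intro!: L2_add L2_cmult *)
qed

text \<open>The components are combined with weights \<open>1\<close> and \<open>\<iota>\<close> to
  fit \<open>corner_limit\<close>. Each boundary condition brings its own trace of \<open>v\<close>:
  \<open>v'\<close> serves the integration by parts and \<open>tv\<close> the traction term.\<close>

lemma corner_value_zero:
  fixes \<iota> :: complex and v w tv tw v' v0 g0 Lv Lw :: "real^2 \<Rightarrow> complex^2" and \<eta> \<eta>0 :: "real^2 \<Rightarrow> real"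
  assumes \<iota>: "\<iota>\<^sup>2 = -1" 
    and \<kappa>: "0 \<le> \<kappa>" "\<kappa> < 1" "\<And>x. x \<in> W \<Longrightarrow> x $ 1 \<ge> - \<kappa> * norm x" "\<And>c. c \<in> {a, b} \<Longrightarrow> c $ 1 \<ge> - \<kappa>"
    and \<Gamma>: "side a \<union> side b \<subseteq> \<Gamma>"
    and H1: "H1_vec \<Omega> v" "H1_vec \<Omega> w"
    and L: "\<And>j. L2 \<L> (\<lambda>x. Lv x $ j)" "\<And>j. L2 \<L> (\<lambda>x. Lw x $ j)"
    and Lb: "AE x in \<L>. norm x < h \<longrightarrow> norm (Lv x - Lw x) \<le> Cf"
    and tr: "has_trace_vec \<Omega> w tw" "has_trace_vec \<Omega> v v'" "AE x in \<M>. x \<in> \<Gamma> \<longrightarrow> tw x = v' x"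
    and tv: "has_trace_vec \<Omega> v tv"
    and bc: "\<And>\<phi> j. test_fun UNIV \<phi> \<Longrightarrow> supp \<phi> \<inter> frontier \<Omega> \<subseteq> \<Gamma> \<Longrightarrow>
           traction_functional lam mu \<Omega> v Lv j \<phi> + (LINT x|\<M>. of_real (\<eta> x) * (tv x $ j) * \<phi> x)
           = traction_functional lam mu \<Omega> w Lw j \<phi>"
    and \<alpha>: "0 < \<alpha>" and v0: "holder_rep \<alpha> (\<Omega> \<inter> ball 0 h) v v0"
    and \<eta>: "Linf \<M> \<eta>" "\<And>c. c \<in> {a, b} \<Longrightarrow> holder_on \<alpha> (closure (side c)) \<eta>0"
      "AE x in \<M>. x \<in> side a \<union> side b \<longrightarrow> \<eta> x = \<eta>0 x"
  shows "of_real (\<eta>0 0) * (v0 0 $ 1 + \<iota> * v0 0 $ 2) = 0"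
proof -
  define T where "T k j x = traction lam mu (weak_grad \<Omega> v x) (axis k 1) $ j - traction lam mu (weak_grad \<Omega> w x) (axis k 1) $ j" for k j :: 2 and x
  define S where "S k x = T k 1 x + \<iota> * T k 2 x" for k x
  define f where "f x = (Lv x $ 1 - Lw x $ 1) + \<iota> * (Lv x $ 2 - Lw x $ 2)" for x
  define U where "U x = of_real (2 * mu) * ((v x $ 1 - w x $ 1) + \<iota> * (v x $ 2 - w x $ 2))" for x
  define \<beta> where "\<beta> x = of_real (\<eta> x) * (tv x $ 1 + \<iota> * tv x $ 2)" for x
  \<comment> \<open>The boundary datum along a side, set to 0 beyond \<open>h / 2\<close>, where the
    trace is not compared with \<open>v0\<close>, and for all \<open>c\<close> that are not side
    directions, so that it is measurable and bounded for every \<open>c\<close>.\<close>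
  define g where "g c s = (if c \<in> {a, b} then indicator {0..h/2} s *\<^sub>R (of_real (\<eta>0 (s *\<^sub>R c)) * (v0 (s *\<^sub>R c) $ 1 + \<iota> * v0 (s *\<^sub>R c) $ 2)) else 0)" for c s
  have TL2: "L2 \<L> (T k j)" for k j
    unfolding T_def[abs_def] by (intro L2_diff traction_L2 H1)
  have SL2: "L2 \<L> (S k)" for k unfolding S_def[abs_def] by (intro L2_add L2_cmult TL2)
  have fL2: "L2 \<L> f" unfolding f_def[abs_def] by (intro L2_add L2_cmult L2_diff L)
  have vL2: "L2 \<L> (\<lambda>x. v x $ j)" "L2 \<L> (\<lambda>x. w x $ j)" for j
    using H1 by (auto simp: H1_vec_def H1_def)
  have UL2: "L2 \<L> U" unfolding U_def[abs_def] by (intro L2_add L2_cmult L2_diff vL2)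
  have n\<iota>: "norm \<iota> = 1"
  proof -
    have "(norm \<iota>)\<^sup>2 = 1" using \<iota> by (metis norm_power norm_minus_cancel norm_one)
    then show ?thesis using norm_ge_zero[of \<iota>] by (auto simp: power2_eq_1_iff)
  qed
  have fb: "AE x in \<L>. norm x < h \<longrightarrow> norm (f x) \<le> 2 * Cf"
    using Lb
  proof (rule AE_mp, intro AE_I2 impI)
    fix x assume "norm x < h \<longrightarrow> norm (Lv x - Lw x) \<le> Cf" "norm x < h"
    then have "norm (Lv x - Lw x) \<le> Cf" by simp
    then have "norm ((Lv x - Lw x) $ j) \<le> Cf" for j by (rule order_trans[OF Finite_Cartesian_Product.norm_nth_le])
    then have "norm (f x) \<le> Cf + norm \<iota> * Cf"
      unfolding f_def by (intro norm_triangle_le add_mono) (auto simp: norm_mult n\<iota>)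
    then show "norm (f x) \<le> 2 * Cf" by (simp add: n\<iota>)
  qed
  have tvL2: "L2 \<M> (\<lambda>x. tv x $ j)" for j using tv by (auto simp: has_trace_vec_def has_trace_def)
  have \<beta>m: "\<beta> \<in> borel_measurable \<M>"
  proof -
    have [measurable]: "(\<lambda>x. tv x $ j) \<in> borel_measurable \<M>" for j using tvL2 by (simp add: L2_def)
    have [measurable]: "\<eta> \<in> borel_measurable \<M>" using \<eta>(1) by (simp add: Linf_def)
    show ?thesis unfolding \<beta>_def[abs_def] by measurable
  qed
  have sM: "side a \<union> side b \<in> sets \<M>"
    by (intro sets.Un sets_boundary borel_side side_subset_frontier) auto
  have sfin: "emeasure \<M> (side a \<union> side b) < \<infinity>"
  proof -
    have "emeasure \<M> (side a \<union> side b) \<le> emeasure \<M> (side a) + emeasure \<M> (side b)"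
      by (intro emeasure_subadditive sets_boundary borel_side side_subset_frontier) auto
    also have "\<dots> < \<infinity>" by (simp add: emeasure_side less_top)
    finally show ?thesis .
  qed
  obtain C\<eta> where C\<eta>: "AE x in \<M>. \<bar>\<eta> x\<bar> \<le> C\<eta>" using \<eta>(1) by (auto simp: Linf_def)
  have \<eta>tv_int: "integrable \<M> (\<lambda>x. indicator (side a \<union> side b) x *\<^sub>R (of_real (\<eta> x) * z x))" if z: "L2 \<M> z" for z
  proof (rule Bochner_Integration.integrable_bound)
    show "integrable \<M> (\<lambda>x. C\<eta> *\<^sub>R (indicator (side a \<union> side b) x *\<^sub>R z x))"
      by (intro integrable_scaleR_right L2_integrable_on z sM sfin)
    have [measurable]: "z \<in> borel_measurable \<M>" "\<eta> \<in> borel_measurable \<M>" using z \<eta>(1) by (auto simp: L2_def Linf_def)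
    show "(\<lambda>x. indicator (side a \<union> side b) x *\<^sub>R (of_real (\<eta> x) * z x)) \<in> borel_measurable \<M>"
      by (intro borel_measurable_scaleR borel_measurable_indicator sM) measurable
    show "AE x in \<M>. norm (indicator (side a \<union> side b) x *\<^sub>R (of_real (\<eta> x) * z x)) \<le> norm (C\<eta> *\<^sub>R (indicator (side a \<union> side b) x *\<^sub>R z x))"
      using C\<eta> by (rule AE_mp) (intro AE_I2 impI, auto simp: norm_mult indicator_def intro!: mult_right_mono)
  qed
  \<comment> \<open>The traction condition is stated for each component, so the corner is removed
    componentwise, before the combination is formed.\<close>
  have comp: "(LINT x|\<L>. (\<Sum>k\<in>UNIV. T k j x * pderiv_at k \<phi> x) + (Lv x $ j - Lw x $ j) * \<phi> x) + (LINT x|\<M>. (of_real (\<eta> x) * tv x $ j) * \<phi> x) = 0"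
    if \<phi>: "\<And>k. C_k k \<phi>" "supp \<phi> \<subseteq> ball 0 h" "compact (supp \<phi>)" for j \<phi>
  proof (rule corner_removable[OF TL2 _ _ _ \<Gamma> _ \<phi>])
    show "L2 \<L> (\<lambda>x. Lv x $ j - Lw x $ j)" by (intro L2_diff L)
    have [measurable]: "(\<lambda>x. tv x $ j) \<in> borel_measurable \<M>" using tvL2 by (simp add: L2_def)
    have [measurable]: "\<eta> \<in> borel_measurable \<M>" using \<eta>(1) by (simp add: Linf_def)
    show "(\<lambda>x. of_real (\<eta> x) * tv x $ j) \<in> borel_measurable \<M>" by measurable
    show "integrable \<M> (\<lambda>x. indicator (side a \<union> side b) x *\<^sub>R (of_real (\<eta> x) * tv x $ j))" by (rule \<eta>tv_int[OF tvL2])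
    fix \<phi> assume t: "test_fun UNIV \<phi>" "supp \<phi> \<inter> frontier \<Omega> \<subseteq> \<Gamma>"
    have ck: "continuous_on UNIV \<phi>" "continuous_on UNIV (pderiv_at k \<phi>)" "compact (supp \<phi>)" for k
    proof -
      have "C_k 0 \<phi>" "C_k (Suc 0) \<phi>" using t(1) unfolding test_fun_def by blast+
      then show "continuous_on UNIV \<phi>" "continuous_on UNIV (pderiv_at k \<phi>)" by auto
      show "compact (supp \<phi>)" using t(1) by (simp add: test_fun_def)
    qed
    have i: "integrable \<L> (\<lambda>x. u x * pderiv_at k \<phi> x)" "integrable \<L> (\<lambda>x. u x * \<phi> x)" if "L2 \<L> u" for u k
      by (intro integrable_domain_smooth that ck compact_supp_subset[OF ck(3) supp_pderiv_at])+
    have "(LINT x|\<L>. (\<Sum>k\<in>UNIV. T k j x * pderiv_at k \<phi> x) + (Lv x $ j - Lw x $ j) * \<phi> x) =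
       (LINT x|\<L>. ((\<Sum>k\<in>UNIV. traction lam mu (weak_grad \<Omega> v x) (axis k 1) $ j * pderiv_at k \<phi> x) + Lv x $ j * \<phi> x)
         - ((\<Sum>k\<in>UNIV. traction lam mu (weak_grad \<Omega> w x) (axis k 1) $ j * pderiv_at k \<phi> x) + Lw x $ j * \<phi> x))"
      by (intro Bochner_Integration.integral_cong) (auto simp: T_def left_diff_distrib sum_subtractf)
    also have "\<dots> = traction_functional lam mu \<Omega> v Lv j \<phi> - traction_functional lam mu \<Omega> w Lw j \<phi>"
      unfolding traction_functional_def
      by (intro Bochner_Integration.integral_diff Bochner_Integration.integrable_add Bochner_Integration.integrable_sum i traction_L2 H1 L)
    finally show "(LINT x|\<L>. (\<Sum>k\<in>UNIV. T k j x * pderiv_at k \<phi> x) + (Lv x $ j - Lw x $ j) * \<phi> x) + (LINT x|\<M>. of_real (\<eta> x) * tv x $ j * \<phi> x) = 0"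
      using bc[OF t, of j] by (simp add: diff_add_eq)
  qed
  have id: "(LINT x|\<L>. (\<Sum>k\<in>UNIV. S k x * pderiv_at k \<phi> x) + f x * \<phi> x) + (LINT x|\<M>. \<beta> x * \<phi> x) = 0"
    if \<phi>: "\<And>k. C_k k \<phi>" "supp \<phi> \<subseteq> ball 0 h" "compact (supp \<phi>)" for \<phi>
  proof -
    have c: "continuous_on UNIV \<phi>" "continuous_on UNIV (pderiv_at k \<phi>)" for k using \<phi>(1)[of 0] \<phi>(1)[of "Suc 0"] by auto
    have i: "integrable \<L> (\<lambda>x. u x * pderiv_at k \<phi> x)" "integrable \<L> (\<lambda>x. u x * \<phi> x)" if "L2 \<L> u" for u k
      by (intro integrable_domain_smooth that c \<phi>(3) compact_supp_subset[OF \<phi>(3) supp_pderiv_at])+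
    let ?P = "\<lambda>j x. (\<Sum>k\<in>UNIV. T k j x * pderiv_at k \<phi> x) + (Lv x $ j - Lw x $ j) * \<phi> x"
    have iP: "integrable \<L> (?P j)" for j
      by (intro Bochner_Integration.integrable_add Bochner_Integration.integrable_sum i TL2 L2_diff L)
    have m: "(\<lambda>x. of_real (\<eta> x) * tv x $ j) \<in> borel_measurable \<M>" for j
    proof -
      have [measurable]: "(\<lambda>x. tv x $ j) \<in> borel_measurable \<M>" using tvL2 by (simp add: L2_def)
      have [measurable]: "\<eta> \<in> borel_measurable \<M>" using \<eta>(1) by (simp add: Linf_def)
      show ?thesis by measurable
    qed
    have iM: "integrable \<M> (\<lambda>x. (of_real (\<eta> x) * tv x $ j) * \<phi> x)" for j
      by (rule integrable_boundary_mult[OF m \<eta>tv_int[OF tvL2] \<phi>])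
    have "(LINT x|\<L>. (\<Sum>k\<in>UNIV. S k x * pderiv_at k \<phi> x) + f x * \<phi> x) = (LINT x|\<L>. ?P 1 x + \<iota> * ?P 2 x)"
      by (intro Bochner_Integration.integral_cong) (simp_all add: S_def f_def sum_2 algebra_simps)
    also have "\<dots> = (LINT x|\<L>. ?P 1 x) + \<iota> * (LINT x|\<L>. ?P 2 x)"
      unfolding integral_mult_right_zero[symmetric] by (intro Bochner_Integration.integral_add integrable_mult_right iP)
    finally have A: "(LINT x|\<L>. (\<Sum>k\<in>UNIV. S k x * pderiv_at k \<phi> x) + f x * \<phi> x) = (LINT x|\<L>. ?P 1 x) + \<iota> * (LINT x|\<L>. ?P 2 x)" .
    have "(LINT x|\<M>. \<beta> x * \<phi> x) = (LINT x|\<M>. (of_real (\<eta> x) * tv x $ 1) * \<phi> x + \<iota> * ((of_real (\<eta> x) * tv x $ 2) * \<phi> x))"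
      by (intro Bochner_Integration.integral_cong) (simp_all add: \<beta>_def algebra_simps)
    also have "\<dots> = (LINT x|\<M>. (of_real (\<eta> x) * tv x $ 1) * \<phi> x) + \<iota> * (LINT x|\<M>. (of_real (\<eta> x) * tv x $ 2) * \<phi> x)"
      unfolding integral_mult_right_zero[symmetric] by (intro Bochner_Integration.integral_add integrable_mult_right iM)
    finally have B: "(LINT x|\<M>. \<beta> x * \<phi> x) = (LINT x|\<M>. (of_real (\<eta> x) * tv x $ 1) * \<phi> x) + \<iota> * (LINT x|\<M>. (of_real (\<eta> x) * tv x $ 2) * \<phi> x)" .
    have "p1 + \<iota> * p2 + (q1 + \<iota> * q2) = 0" if "p1 + q1 = 0" "p2 + q2 = 0" for p1 p2 q1 q2 :: complex
    proof -
      have "p1 + \<iota> * p2 + (q1 + \<iota> * q2) = (p1 + q1) + \<iota> * (p2 + q2)" by (simp add: algebra_simps)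
      then show ?thesis using that by simp
    qed
    from this[OF comp[OF \<phi>, of 1] comp[OF \<phi>, of 2]] show ?thesis unfolding A B .
  qed
  have green: "(LINT x|\<L>. (S 1 x + \<iota> * S 2 x) * \<psi> x) = - (LINT x|\<L>. U x * (pderiv_at 1 \<psi> x + \<iota> * pderiv_at 2 \<psi> x))"
    if \<psi>: "\<And>k. C_k k \<psi>" "supp \<psi> \<subseteq> ball 0 h" "compact (supp \<psi>)" for \<psi>
  proof -
    have c: "continuous_on UNIV \<psi>" "continuous_on UNIV (pderiv_at k \<psi>)" for k using \<psi>(1)[of 0] \<psi>(1)[of "Suc 0"] by auto
    have i: "integrable \<L> (\<lambda>x. u x * pderiv_at k \<psi> x)" "integrable \<L> (\<lambda>x. u x * \<psi> x)" if "L2 \<L> u" for u k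
      by (intro integrable_domain_smooth that c \<psi>(3) compact_supp_subset[OF \<psi>(3) supp_pderiv_at])+
    define G where "G j k x = (weak_pderiv \<Omega> k (\<lambda>y. v y $ j) x - weak_pderiv \<Omega> k (\<lambda>y. w y $ j) x)" for j k x
    define u where "u j x = v x $ j - w x $ j" for j x
    have wL2: "L2 \<L> (weak_pderiv \<Omega> k (\<lambda>y. v y $ j))" "L2 \<L> (weak_pderiv \<Omega> k (\<lambda>y. w y $ j))" for j k
      using H1 by (auto simp: H1_vec_def intro: weak_pderiv_L2)
    have GL2: "L2 \<L> (G j k)" for j k unfolding G_def[abs_def] by (intro L2_diff wL2)
    have uL2: "L2 \<L> (u j)" for j unfolding u_def[abs_def] by (intro L2_diff vL2)
    have GU: "(LINT x|\<L>. G j k x * \<psi> x) = - (LINT x|\<L>. u j x * pderiv_at k \<psi> x)" for j k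
    proof -
      have ae: "AE x in \<M>. x \<in> side a \<union> side b \<longrightarrow> v' x $ j = tw x $ j"
        using tr(3) by (rule AE_mp) (intro AE_I2 impI, use \<Gamma> in auto)
      have "(LINT x|\<L>. G j k x * \<psi> x) = (LINT x|\<L>. weak_pderiv \<Omega> k (\<lambda>y. v y $ j) x * \<psi> x) - (LINT x|\<L>. weak_pderiv \<Omega> k (\<lambda>y. w y $ j) x * \<psi> x)"
        unfolding G_def left_diff_distrib by (intro Bochner_Integration.integral_diff i wL2)
      also have "\<dots> = - ((LINT x|\<L>. v x $ j * pderiv_at k \<psi> x) - (LINT x|\<L>. w x $ j * pderiv_at k \<psi> x))"
        using tr(1,2) by (intro weak_green[OF _ _ ae \<psi>]) (auto simp: has_trace_vec_def)
      also have "(LINT x|\<L>. v x $ j * pderiv_at k \<psi> x) - (LINT x|\<L>. w x $ j * pderiv_at k \<psi> x) = (LINT x|\<L>. u j x * pderiv_at k \<psi> x)"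
        unfolding u_def left_diff_distrib by (intro Bochner_Integration.integral_diff[symmetric] i vL2)
      finally show ?thesis .
    qed
    have \<iota>\<iota>: "\<iota> * (\<iota> * z) = - z" for z using \<iota> by (simp add: mult.assoc[symmetric] power2_eq_square)
    have "(LINT x|\<L>. (S 1 x + \<iota> * S 2 x) * \<psi> x) = (LINT x|\<L>. of_real (2 * mu) * (G 1 1 x * \<psi> x + \<iota> * (G 2 1 x * \<psi> x) + \<iota> * (G 1 2 x * \<psi> x) - G 2 2 x * \<psi> x))"
    proof (intro Bochner_Integration.integral_cong refl)
      fix x
      \<comment> \<open>This is \<open>T 1 1 - T 2 2 + \<iota> * (T 1 2 + T 2 1)\<close>: the
        divergence terms with \<open>lam\<close> sit equally in both diagonal entries and
        cancel.\<close>
      have "S 1 x + \<iota> * S 2 x = of_real (2 * mu) * (G 1 1 x + \<iota> * G 2 1 x + \<iota> * G 1 2 x - G 2 2 x)"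
        unfolding S_def T_def traction_axis by (simp add: weak_grad_def G_def \<iota>\<iota> algebra_simps)
      then show "(S 1 x + \<iota> * S 2 x) * \<psi> x = of_real (2 * mu) * (G 1 1 x * \<psi> x + \<iota> * (G 2 1 x * \<psi> x) + \<iota> * (G 1 2 x * \<psi> x) - G 2 2 x * \<psi> x)"
        by (simp only:) (simp add: algebra_simps)
    qed
    also have "\<dots> = of_real (2 * mu) * ((LINT x|\<L>. G 1 1 x * \<psi> x) + \<iota> * (LINT x|\<L>. G 2 1 x * \<psi> x) + \<iota> * (LINT x|\<L>. G 1 2 x * \<psi> x) - (LINT x|\<L>. G 2 2 x * \<psi> x))"
      using i(2)[OF GL2] by simp
    also have "\<dots> = - (of_real (2 * mu) * ((LINT x|\<L>. u 1 x * pderiv_at 1 \<psi> x) + \<iota> * (LINT x|\<L>. u 2 x * pderiv_at 1 \<psi> x) + \<iota> * (LINT x|\<L>. u 1 x * pderiv_at 2 \<psi> x) - (LINT x|\<L>. u 2 x * pderiv_at 2 \<psi> x)))"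
      unfolding GU by (simp add: algebra_simps)
    also have "of_real (2 * mu) * ((LINT x|\<L>. u 1 x * pderiv_at 1 \<psi> x) + \<iota> * (LINT x|\<L>. u 2 x * pderiv_at 1 \<psi> x) + \<iota> * (LINT x|\<L>. u 1 x * pderiv_at 2 \<psi> x) - (LINT x|\<L>. u 2 x * pderiv_at 2 \<psi> x))
      = (LINT x|\<L>. of_real (2 * mu) * (u 1 x * pderiv_at 1 \<psi> x + \<iota> * (u 2 x * pderiv_at 1 \<psi> x) + \<iota> * (u 1 x * pderiv_at 2 \<psi> x) - u 2 x * pderiv_at 2 \<psi> x))"
      using i(1)[OF uL2] by simp
    also have "\<dots> = (LINT x|\<L>. U x * (pderiv_at 1 \<psi> x + \<iota> * pderiv_at 2 \<psi> x))"
      by (intro Bochner_Integration.integral_cong refl) (simp add: U_def u_def \<iota>\<iota> algebra_simps)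
    finally show ?thesis .
  qed
  have v0h: "holder_on \<alpha> (closure (\<Omega> \<inter> ball 0 h)) v0" "AE x in lebesgue_on (\<Omega> \<inter> ball 0 h). v x = v0 x"
    using v0 by (auto simp: holder_rep_def)
  have gc: "continuous_on {0..h/2} (\<lambda>s. of_real (\<eta>0 (s *\<^sub>R c)) * (v0 (s *\<^sub>R c) $ 1 + \<iota> * v0 (s *\<^sub>R c) $ 2))" if c: "c \<in> {a, b}" for c
  proof -
    \<comment> \<open>The corner belongs only to the closure of the side, which is where
      \<open>\<eta>0\<close> is known to be Hoelder continuous; thus the datum is continuous up to
      \<open>s = 0\<close>.\<close>
    have sc: "s *\<^sub>R c \<in> closure (side c)" if s: "s \<in> {0..h/2}" for s
    proof (cases "s = 0")
      case True
      have "\<exists>y\<in>side c. dist y 0 < e" if e: "e > 0" for e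
      proof
        have p: "0 < min (e / 2) (h / 2)" "min (e / 2) (h / 2) < h" "min (e / 2) (h / 2) < e" using e h_pos by auto
        show "min (e / 2) (h / 2) *\<^sub>R c \<in> side c" unfolding side_def using p by (intro imageI) simp
        show "dist (min (e / 2) (h / 2) *\<^sub>R c) 0 < e" using p side_norm[OF c] by simp
      qed
      then show ?thesis using True by (simp add: closure_approachable)
    next
      case False
      then have "s *\<^sub>R c \<in> side c" unfolding side_def using s h_pos by (intro imageI) auto
      then show ?thesis by (rule subsetD[OF closure_subset])
    qed
    have sd: "s *\<^sub>R c \<in> closure (\<Omega> \<inter> ball 0 h)" if "s \<in> {0..h/2}" for s
      using that h_pos by (intro side_closure c) auto
    have c1: "continuous_on {0..h/2} (\<lambda>s. \<eta>0 (s *\<^sub>R c))"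
      by (rule continuous_on_compose2[OF holder_on_imp_continuous_on[OF \<eta>(2)[OF c] \<alpha>]]) (use sc in \<open>auto intro!: continuous_intros\<close>)
    have c2: "continuous_on {0..h/2} (\<lambda>s. v0 (s *\<^sub>R c))"
      by (rule continuous_on_compose2[OF holder_on_imp_continuous_on[OF v0h(1) \<alpha>]]) (use sd in \<open>auto intro!: continuous_intros\<close>)
    show ?thesis by (intro continuous_intros c1 c2)
  qed
  have gm: "g c \<in> borel_measurable borel" for c
  proof (cases "c \<in> {a, b}")
    case True
    then show ?thesis unfolding g_def[abs_def] if_P[OF True]
      by (intro borel_measurable_continuous_on_indicator gc) auto
  qed (simp add: g_def[abs_def])
  have "\<exists>C. \<forall>s. norm (g c s) \<le> C" for c
  proof (cases "c \<in> {a, b}")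
    case True
    have "compact ((\<lambda>s. of_real (\<eta>0 (s *\<^sub>R c)) * (v0 (s *\<^sub>R c) $ 1 + \<iota> * v0 (s *\<^sub>R c) $ 2)) ` {0..h/2})"
      by (intro compact_continuous_image gc True) simp
    from compact_imp_bounded[OF this] obtain C where C: "C > 0" "\<And>y. y \<in> (\<lambda>s. of_real (\<eta>0 (s *\<^sub>R c)) * (v0 (s *\<^sub>R c) $ 1 + \<iota> * v0 (s *\<^sub>R c) $ 2)) ` {0..h/2} \<Longrightarrow> norm y \<le> C"
      unfolding bounded_pos by auto
    have "norm (g c s) \<le> C" for s
    proof (cases "s \<in> {0..h/2}")
      case s: True
      then show ?thesis using C(2)[OF imageI[OF s]] unfolding g_def if_P[OF True] by simp
    qed (use C(1) in \<open>simp add: g_def\<close>)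
    then show ?thesis by blast
  qed (auto simp: g_def)
  then obtain C' where C': "\<And>c s. norm (g c s) \<le> C' c" by metis
  \<comment> \<open>One bound for all \<open>c\<close> exists because only the two side directions
    give a nonzero function.\<close>
  have Cg: "norm (g c s) \<le> max 0 (max (C' a) (C' b))" for c s
  proof -
    have "g c s = 0" if "c \<notin> {a, b}" using that by (simp add: g_def)
    then show ?thesis using C'[of a s] C'[of b s]
      by (cases "c = a"; cases "c = b") (auto simp: le_max_iff_disj)
  qed
  have glim: "(g c \<longlongrightarrow> of_real (\<eta>0 0) * (v0 0 $ 1 + \<iota> * v0 0 $ 2)) (at_right 0)" if c: "c \<in> {a, b}" for c
  proof -
    let ?q = "\<lambda>s. of_real (\<eta>0 (s *\<^sub>R c)) * (v0 (s *\<^sub>R c) $ 1 + \<iota> * v0 (s *\<^sub>R c) $ 2)"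
    have "0 \<in> {0..h/2}" using h_pos by simp
    with gc[OF c, unfolded continuous_on_def] have "(?q \<longlongrightarrow> ?q 0) (at 0 within {0..h/2})" by (rule bspec)
    then have q: "(?q \<longlongrightarrow> ?q 0) (at_right 0)" using h_pos by (simp add: at_within_Icc_at_right)
    have ev: "\<forall>\<^sub>F s in at_right 0. ?q s = g c s"
      unfolding eventually_at_right_field using h_pos
      using c by (intro exI[of _ "h/2"]) (auto simp: g_def)
    show ?thesis using Lim_transform_eventually[OF q ev] by simp
  qed
  have \<beta>g: "AE x in \<M>. x \<in> side c \<and> norm x < h / 2 \<longrightarrow> \<beta> x = g c (norm x)" if c: "c \<in> {a, b}" for c
  proof -
    have tj: "AE x in \<M>. x \<in> side c \<and> norm x < h / 2 \<longrightarrow> tv x $ j = v0 x $ j" for j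
    proof (rule trace_eq_holder_rep[OF _ holder_on_component[OF v0h(1)] \<alpha> _ c])
      show "has_trace \<Omega> (\<lambda>x. v x $ j) (\<lambda>x. tv x $ j)" using tv by (simp add: has_trace_vec_def)
      show "AE x in lebesgue_on (\<Omega> \<inter> ball 0 h). v x $ j = v0 x $ j"
        using v0h(2) by (rule AE_mp) (intro AE_I2 impI, simp)
    qed
    show ?thesis
      using tj[of 1] tj[of 2] \<eta>(3)
    proof eventually_elim
      case (elim x)
      show ?case
      proof
        assume x: "x \<in> side c \<and> norm x < h / 2"
        then have e: "x = norm x *\<^sub>R c" "0 < norm x" using side_iff[OF c, of x] by auto
        have "x \<in> side a \<union> side b" using x c by auto
        then have "\<beta> x = of_real (\<eta>0 x) * (v0 x $ 1 + \<iota> * v0 x $ 2)" using elim x by (simp add: \<beta>_def)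
        also have "\<dots> = g c (norm x)" unfolding g_def if_P[OF c] e(1)[symmetric] using x e(2) by simp
        finally show "\<beta> x = g c (norm x)" .
      qed
    qed
  qed
  show ?thesis
    by (rule corner_limit[OF \<iota> \<kappa> SL2 fL2 UL2 fb \<beta>m \<beta>g gm Cg glim green id])
qed

end

theorem theorem2p3:
  fixes lam mu \<omega> \<theta>m \<theta>M h \<alpha> :: real
    and \<Omega> \<Gamma> Sh Gm Gp :: "(real^2) set"
    and V \<eta> \<eta>0 :: "real^2 \<Rightarrow> real"
    and v w v0 :: "real^2 \<Rightarrow> complex^2"
  assumes lame_constants: "mu > 0" "2 * lam + 2 * mu > 0"
    and domain: "bounded_lipschitz_domain \<Omega>" "connected (- closure \<Omega>)"
    and sector: "- pi < \<theta>m" "\<theta>m < \<theta>M" "\<theta>M < pi" "\<theta>M - \<theta>m \<noteq> pi"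
    and corner: "0 \<in> frontier \<Omega>" "h > 0"
      "Sh = sector \<theta>m \<theta>M \<inter> ball 0 h" "\<Omega> \<inter> ball 0 h = Sh"
    and sides: "Gm = ray \<theta>m \<inter> ball 0 h" "Gp = ray \<theta>M \<inter> ball 0 h"
    and V: "Linf (lebesgue_on \<Omega>) V" "\<not> (AE x in lebesgue_on \<Omega>. V x = 0)"
    and eta: "Linf (boundary_measure \<Omega>) \<eta>"
    and omega: "\<omega> > 0"
    and H1: "H1_vec \<Omega> v" "H1_vec \<Omega> w"
    and eq_v: "weak_lame_eq lam mu \<Omega> v (\<lambda>x. - (\<omega>\<^sup>2 *\<^sub>R v x))"
    and eq_w: "weak_lame_eq lam mu \<Omega> w (\<lambda>x. - ((\<omega>\<^sup>2 * (1 + V x)) *\<^sub>R w x))"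
    and Gamma: "openin (top_of_set (frontier \<Omega>)) \<Gamma>" "Gp \<union> Gm \<subseteq> \<Gamma>"
    and bc_trace: "trace_eq_on \<Omega> \<Gamma> w v"
    and bc_traction: "traction_condition lam mu \<Omega> \<Gamma> \<eta>
      v (\<lambda>x. - (\<omega>\<^sup>2 *\<^sub>R v x)) w (\<lambda>x. - ((\<omega>\<^sup>2 * (1 + V x)) *\<^sub>R w x))"
    and alpha: "0 < \<alpha>" "\<alpha> < 1"
    and holder_v: "holder_rep \<alpha> Sh v v0"
    and holder_qw: "\<exists>g. holder_rep \<alpha> Sh (\<lambda>x. (1 + V x) *\<^sub>R w x) g"
    and holder_eta: "holder_on \<alpha> (closure Gm) \<eta>0" "holder_on \<alpha> (closure Gp) \<eta>0"
      "AE x in boundary_measure \<Omega>. x \<in> Gm \<union> Gp \<longrightarrow> \<eta> x = \<eta>0 x"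
      "\<eta>0 0 \<noteq> 0"
  shows "v0 0 = 0"
proof -
  define a where "a = dir \<theta>m"
  define b where "b = dir \<theta>M"
  define W where "W = sector \<theta>m \<theta>M"
  have cr: "cross2 a b = sin (\<theta>M - \<theta>m)" by (simp add: a_def b_def cross2_dir)
  have indep: "cross2 a b \<noteq> 0"
  proof (cases "\<theta>M - \<theta>m < pi")
    case True
    then show ?thesis using sin_gt_zero[of "\<theta>M - \<theta>m"] sector by (simp add: cr)
  next
    case False
    then show ?thesis using sin_lt_zero[of "\<theta>M - \<theta>m"] sector by (simp add: cr)
  qed
  interpret corner_domain \<Omega> W a b h
  proof
    show "open \<Omega>" "bounded \<Omega>" using domain(1) by (auto simp: bounded_lipschitz_domain_def)
    show "norm a = 1" "norm b = 1" by (simp_all add: a_def b_def)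
    show "W = cone2 {0<..} a b \<or> W = - cone2 {0..} a b"
      unfolding W_def a_def b_def sector_eq[OF sector] by simp
    show "\<Omega> \<inter> ball 0 h = W \<inter> ball 0 h" using corner by (simp add: W_def)
  qed (use indep corner in auto)
  have side_eq: "side (dir t) = ray t \<inter> ball 0 h" if "- pi < t" "t < pi" for t
    unfolding ray_eq[OF that] side_def by auto
  have sides_eq: "side a = Gm" "side b = Gp"
    unfolding a_def b_def sides using sector by (auto intro!: side_eq)
  have ang: "- pi < \<theta>m" "\<theta>M < pi" "\<theta>m \<le> \<theta>M" using sector by auto
  obtain \<kappa> where \<kappa>: "0 \<le> \<kappa>" "\<kappa> < 1"
    "\<And>x. x = 0 \<or> \<theta>m \<le> arg2 x \<and> arg2 x \<le> \<theta>M \<Longrightarrow> x $ 1 \<ge> - \<kappa> * norm x"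
    using sector_halfplane_bound[OF ang(1,2)] by blast
  have \<kappa>W: "x $ 1 \<ge> - \<kappa> * norm x" if "x \<in> W" for x
    using that by (intro \<kappa>(3)) (auto simp: W_def sector_def)
  have \<kappa>c: "c $ 1 \<ge> - \<kappa>" if c: "c \<in> {a, b}" for c
  proof -
    have "arg2 (1 *\<^sub>R dir \<theta>m) = \<theta>m" "arg2 (1 *\<^sub>R dir \<theta>M) = \<theta>M"
      using sector by (intro arg2_dir; simp)+
    then have "c $ 1 \<ge> - \<kappa> * norm c" using c ang by (intro \<kappa>(3)) (auto simp: a_def b_def)
    then show ?thesis using side_norm[OF c] by simp
  qed
  define Lv where "Lv x = - (\<omega>\<^sup>2 *\<^sub>R v x)" for x
  define Lw where "Lw x = - ((\<omega>\<^sup>2 * (1 + V x)) *\<^sub>R w x)" for x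
  have L: "L2 (lebesgue_on \<Omega>) (\<lambda>x. Lv x $ j)" "L2 (lebesgue_on \<Omega>) (\<lambda>x. Lw x $ j)" for j
    using eq_v eq_w unfolding weak_lame_eq_def Lv_def Lw_def by blast+
  have Sh: "Sh = \<Omega> \<inter> ball 0 h" using corner by simp
  obtain q0 where q0: "holder_rep \<alpha> Sh (\<lambda>x. (1 + V x) *\<^sub>R w x) q0" using holder_qw by blast
  have bS: "bounded Sh" unfolding Sh by (intro bounded_Int) simp
  have "bounded (v0 ` closure Sh)" "bounded (q0 ` closure Sh)"
    using bounded_closure_image[OF _ alpha(1) bS] holder_v q0 unfolding holder_rep_def by blast+
  then obtain B1 B2 where B: "\<And>x. x \<in> closure Sh \<Longrightarrow> norm (v0 x) \<le> B1" "\<And>x. x \<in> closure Sh \<Longrightarrow> norm (q0 x) \<le> B2"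
    unfolding bounded_iff by auto
  have "AE x in lebesgue_on Sh. v x = v0 x \<and> (1 + V x) *\<^sub>R w x = q0 x"
    using holder_v q0 unfolding holder_rep_def by (auto intro: AE_conjI)
  then have "AE x in lebesgue. x \<in> Sh \<longrightarrow> v x = v0 x \<and> (1 + V x) *\<^sub>R w x = q0 x"
    by (subst (asm) AE_restrict_space_iff) (simp_all add: Sh open_domain borel_open open_Int)
  then have "AE x in lebesgue_on \<Omega>. x \<in> Sh \<longrightarrow> v x = v0 x \<and> (1 + V x) *\<^sub>R w x = q0 x"
    by (subst AE_restrict_space_iff) (auto simp: domain_lebesgue)
  \<comment> \<open>The source is \<open>\<omega>^2\<close> times \<open>(1 + V) w - v\<close>, and
    both summands have representatives that are continuous on the compact closure of
    \<open>Sh\<close>.\<close>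
  then have Lb: "AE x in lebesgue_on \<Omega>. norm x < h \<longrightarrow> norm (Lv x - Lw x) \<le> \<omega>\<^sup>2 * B1 + \<omega>\<^sup>2 * B2"
  proof (rule AE_mp, intro AE_I2 impI)
    fix x assume x: "x \<in> space (lebesgue_on \<Omega>)" "x \<in> Sh \<longrightarrow> v x = v0 x \<and> (1 + V x) *\<^sub>R w x = q0 x" "norm x < h"
    have xS: "x \<in> Sh" using x by (simp add: Sh space_restrict_space)
    then have xc: "x \<in> closure Sh" by (rule subsetD[OF closure_subset])
    have "Lw x = - (\<omega>\<^sup>2 *\<^sub>R ((1 + V x) *\<^sub>R w x))" by (simp add: Lw_def)
    then have "Lv x - Lw x = - (\<omega>\<^sup>2 *\<^sub>R v0 x) + \<omega>\<^sup>2 *\<^sub>R q0 x" using x(2) xS by (simp add: Lv_def)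
    also have "norm \<dots> \<le> norm (\<omega>\<^sup>2 *\<^sub>R v0 x) + norm (\<omega>\<^sup>2 *\<^sub>R q0 x)"
      by (metis norm_minus_cancel norm_triangle_ineq)
    also have "\<dots> \<le> \<omega>\<^sup>2 * B1 + \<omega>\<^sup>2 * B2"
      unfolding norm_scaleR using B[OF xc] by (intro add_mono) (auto intro!: mult_left_mono)
    finally show "norm (Lv x - Lw x) \<le> \<omega>\<^sup>2 * B1 + \<omega>\<^sup>2 * B2" .
  qed
  obtain tw v' where tr: "has_trace_vec \<Omega> w tw" "has_trace_vec \<Omega> v v'"
    "AE x in boundary_measure \<Omega>. x \<in> \<Gamma> \<longrightarrow> tw x = v' x"
    using bc_trace unfolding trace_eq_on_def by blast
  obtain tv where tv: "has_trace_vec \<Omega> v tv"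
    and bc: "\<And>\<phi> j. test_fun UNIV \<phi> \<Longrightarrow> supp \<phi> \<inter> frontier \<Omega> \<subseteq> \<Gamma> \<Longrightarrow>
      traction_functional lam mu \<Omega> v Lv j \<phi> + (LINT x|boundary_measure \<Omega>. of_real (\<eta> x) * (tv x $ j) * \<phi> x)
        = traction_functional lam mu \<Omega> w Lw j \<phi>"
    using bc_traction unfolding traction_condition_def Lv_def[abs_def] Lw_def[abs_def] by blast
  have \<Gamma>: "side a \<union> side b \<subseteq> \<Gamma>" using Gamma(2) sides_eq by blast
  have \<eta>h: "holder_on \<alpha> (closure (side c)) \<eta>0" if "c \<in> {a, b}" for c
    using that holder_eta(1,2) sides_eq by auto
  have \<eta>ae: "AE x in boundary_measure \<Omega>. x \<in> side a \<union> side b \<longrightarrow> \<eta> x = \<eta>0 x"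
    using holder_eta(3) sides_eq by simp
  have v0h: "holder_rep \<alpha> (\<Omega> \<inter> ball 0 h) v v0" using holder_v Sh by simp
  have zero: "v0 0 $ 1 + \<iota> * v0 0 $ 2 = 0" if "\<iota>\<^sup>2 = -1" for \<iota>
  proof -
    have "of_real (\<eta>0 0) * (v0 0 $ 1 + \<iota> * v0 0 $ 2) = 0"
      by (rule corner_value_zero[OF that \<kappa>(1,2) \<kappa>W \<kappa>c \<Gamma> H1 L Lb tr tv bc alpha(1) v0h eta \<eta>h \<eta>ae])
    then show ?thesis using holder_eta(4) by simp
  qed
  \<comment> \<open>The two square roots of \<open>-1\<close> give independent linear equations for
    the two components.\<close>
  have p: "v0 0 $ 1 + \<i> * v0 0 $ 2 = 0" and q: "v0 0 $ 1 + (- \<i>) * v0 0 $ 2 = 0" by (rule zero, simp)+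
  have "2 * v0 0 $ 1 = (v0 0 $ 1 + \<i> * v0 0 $ 2) + (v0 0 $ 1 + (- \<i>) * v0 0 $ 2)" by simp
  then have "v0 0 $ 1 = 0" unfolding p q by simp
  moreover then have "v0 0 $ 2 = 0" using p by simp
  ultimately show ?thesis by (simp add: vec2_eq_iff)
qed

end
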